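(* Under the standing assumptions below, the infinite-player game has a unique mean-field game Nash equilibrium $(\hat\nu,(\hat v^i)_{i\in\mathbb N})\subset\mathcal U$, given for $t\in[0,T]$ by $$\hat\nu_t=\mathcal G(t,b^\infty),\qquad \hat v^i_t=\mathcal F(t,x^i),\quad x^i_s:=b^i_s-\int_0^sA_3(s,r)\hat\nu_r\,dr-\int_s^TA_3(r,s)\mathbb E_s[\hat\nu_r]\,dr,\quad i\in\mathbb N,$$ where $\mathcal F,\mathcal G$ are the solution maps defined below.
   Context: Fix $T>0$ and a filtered probability space $(\Omega,\mathcal F,\mathbb F=(\mathcal F_t)_{0\le t\le T},\mathbb P)$ satisfying the usual conditions; $\mathbb E_t[\cdot]:=\mathbb E[\cdot\mid\mathcal F_t]$. On $L^2([0,T],\mathbb R)$, $\langle f,g\rangle_{L^2}=\int_0^Tf(s)g(s)\,ds$. A kernel $G\in L^2([0,T]^2,\mathbb R)$ induces the integral operator $(\boldsymbol Gf)(s)=\int_0^TG(s,u)f(u)\,du$; $G^*(s,u):=G(u,s)$ and $\boldsymbol G^*$ is the adjoint operator; $\mathrm{id}$ is the identity operator. A measurable kernel $G$ is Volterra if $G(t,s)=0$ whenever $s\ge t$; it is nonnegative definite if $\int_0^T\int_0^T(G(t,s)+G(s,t))f(s)f(t)\,ds\,dt\ge0$ for all $f\in L^2([0,T],\mathbb R)$. The class $\mathcal G$ consists of the nonnegative definite Volterra kernels $G:[0,T]^2\to\mathbb R_+$ with $\sup_{t\le T}\int_0^T|G(t,s)|^2ds+\sup_{s\le T}\int_0^T|G(t,s)|^2dt<\infty$;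 an admissible Volterra operator is one induced by a kernel in $\mathcal G$. For $G\in\mathcal G$ and $t\in[0,T]$, $G_t(s,r):=G(s,r)1_{\{r\ge t\}}$, $\boldsymbol G_t$ is its integral operator and $\boldsymbol G_t^*$ the adjoint of $\boldsymbol G_t$. $\mathcal U$ is the set of $\mathbb F$-progressively measurable real processes $u$ with $\int_0^T\mathbb E[u_s^2]ds<\infty$. $\boldsymbol A_1,\boldsymbol A_3$ are admissible Volterra operators with kernels $A_1,A_3$; $\boldsymbol A_2=\lambda\,\mathrm{id}+\hat{\boldsymbol A}_2$ with $\lambda>0$ and $\hat{\boldsymbol A}_2$ admissible Volterra with kernel $\hat A_2$. Infinite-player setting: $b^0,b^1,b^2,\dots$ are $\mathbb F$-progressively measurable processes with $\int_0^T\mathbb E[(b^i_s)^2]ds<\infty$, $c^1,c^2,\dots$ integrable random variables, and there are an $\mathbb F$-progressively measurable $b^\infty\in L^2(\Omega\times[0,T])$ and a bounded $h:\mathbb R_+\to\mathbb R_+$ with $h(x)\to0$ as $x\to\infty$ such that $\sup_{t\le T}\mathbb E[(\frac1N\sum_{i=1}^Nb^i_t-b^\infty_t)^2]\le h(N)$ for all $N\ge1$. For $v^i,\nu\in\mathcal U$: $J^{i,\infty}(v^i;\nu)=\mathbb E[-\langle\nu,\boldsymbol A_1\nu\rangle_{L^2}-\langle v^i,\boldsymbol A_2v^i\rangle_{L^2}-\langle v^i,(\boldsymbol A_3+\boldsymbol A_3^* )\nu\rangle_{L^2}+\langle b^i,v^i\rangle_{L^2}+\langle b^0,\nu\rangle_{L^2}+c^i]$.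 A mean-field game Nash equilibrium is $(\hat\nu,(\hat v^i)_{i\in\mathbb N})\subset\mathcal U$ such that each $\hat v^i$ maximizes $v\mapsto J^{i,\infty}(v;\hat\nu)$ over $\mathcal U$ and $\lim_{N\to\infty}\sup_{0\le t\le T}\mathbb E[(\frac1N\sum_{i=1}^N\hat v^i_t-\hat\nu_t)^2]=0$. Solution maps: for a progressively measurable square-integrable process $x$, $\mathcal F(t,x):=((\mathrm{id}-\tilde{\boldsymbol B})^{-1}\tilde a(x))(t)$ and $\mathcal G(t,x):=((\mathrm{id}-\hat{\boldsymbol B})^{-1}\hat a(x))(t)$, where $\tilde{\boldsymbol B},\hat{\boldsymbol B}$ are the integral operators with kernels $\tilde B,\hat B$, $\tilde{\boldsymbol D}_t:=2\lambda\,\mathrm{id}+(\hat{\boldsymbol A}_2)_t+(\hat{\boldsymbol A}_2)_t^*$, $\tilde a_t(x):=\frac1{2\lambda}\big(x_t-\langle1_{\{t\le\cdot\}}\hat A_2(\cdot,t),\tilde{\boldsymbol D}_t^{-1}1_{\{t\le\cdot\}}\mathbb E_t[x_\cdot]\rangle_{L^2}\big)$, $\tilde B(t,s):=1_{\{s\le t\}}\frac1{2\lambda}\big(\langle1_{\{t\le\cdot\}}\hat A_2(\cdot,t),\tilde{\boldsymbol D}_t^{-1}1_{\{t\le\cdot\}}\hat A_2(\cdot,s)\rangle_{L^2}-\hat A_2(t,s)\big)$; with $\bar A:=\hat A_2+A_3$: $\hat{\boldsymbol D}_t:=2\lambda\,\mathrm{id}+(\hat{\boldsymbol A}_2)_t+(\hat{\boldsymbol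 A}_2)_t^*+(\boldsymbol A_3)_t+(\boldsymbol A_3)_t^*$, $\hat a_t(x):=\frac1{2\lambda}\big(x_t-\langle1_{\{t\le\cdot\}}\bar A(\cdot,t),\hat{\boldsymbol D}_t^{-1}1_{\{t\le\cdot\}}\mathbb E_t[x_\cdot]\rangle_{L^2}\big)$, $\hat B(t,s):=1_{\{s\le t\}}\frac1{2\lambda}\big(\langle1_{\{t\le\cdot\}}\bar A(\cdot,t),\hat{\boldsymbol D}_t^{-1}1_{\{t\le\cdot\}}\bar A(\cdot,s)\rangle_{L^2}-\bar A(t,s)\big)$. *)

theory Defs
  imports "HOL-Probability.Probability"
begin

definition L2on :: "real \<Rightarrow> (real \<Rightarrow> real) \<Rightarrow> bool" where
  "L2on T f \<longleftrightarrow> set_borel_measurable lborel {0..T} f \<and>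
     (\<integral>\<^sup>+ s. ennreal ((f s)\<^sup>2) * indicator {0..T} s \<partial>lborel) < \<infinity>"

definition ipT :: "real \<Rightarrow> (real \<Rightarrow> real) \<Rightarrow> (real \<Rightarrow> real) \<Rightarrow> real" where
  "ipT T f g = (LINT s:{0..T}|lborel. f s * g s)"

definition kop :: "real \<Rightarrow> (real \<Rightarrow> real \<Rightarrow> real) \<Rightarrow> (real \<Rightarrow> real) \<Rightarrow> real \<Rightarrow> real" where
  "kop T G f s = (LINT u:{0..T}|lborel. G s u * f u)"

definition admissible_kernel :: "real \<Rightarrow> (real \<Rightarrow> real \<Rightarrow> real) \<Rightarrow> bool" where
  "admissible_kernel T G \<longleftrightarrow>
     set_borel_measurable (lborel \<Otimes>\<^sub>M lborel) ({0..T} \<times> {0..T}) (\<lambda>(t,s). G t s) \<and>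
     (\<forall>t\<in>{0..T}. \<forall>s\<in>{0..T}. G t s \<ge> 0) \<and>
     (\<forall>t\<in>{0..T}. \<forall>s\<in>{0..T}. t \<le> s \<longrightarrow> G t s = 0) \<and>
     (\<forall>f. L2on T f \<longrightarrow>
        (LINT t:{0..T}|lborel. LINT s:{0..T}|lborel. (G t s + G s t) * f s * f t) \<ge> 0) \<and>
     (\<exists>C::real.
        (\<forall>t\<in>{0..T}. (\<integral>\<^sup>+ s. ennreal ((G t s)\<^sup>2) * indicator {0..T} s \<partial>lborel) \<le> ennreal C) \<and>
        (\<forall>s\<in>{0..T}. (\<integral>\<^sup>+ t. ennreal ((G t s)\<^sup>2) * indicator {0..T} t \<partial>lborel) \<le> ennreal C))"

text \<open>The operator \<open>2 lam id + K_t + K_t^*\<close>, with \<open>K_t(s,r) = K(s,r) 1_{r \<ge> t}\<close>.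
  For \<open>K = hat A2\<close> this is \<open>tilde D_t\<close>; for \<open>K = hat A2 + A3\<close> it is \<open>hat D_t\<close>.\<close>
definition Dop :: "real \<Rightarrow> real \<Rightarrow> (real \<Rightarrow> real \<Rightarrow> real) \<Rightarrow> real \<Rightarrow> (real \<Rightarrow> real) \<Rightarrow> real \<Rightarrow> real" where
  "Dop T lam K t f s = 2 * lam * f s +
     (LINT r:{0..T}|lborel. (K s r * indicator {t..} r + K r s * indicator {t..} s) * f r)"

text \<open>Its inverse on L2([0,T]): the (a.e. unique) L2 solution f of \<open>Dop f = g\<close>.\<close>
definition Dinv :: "real \<Rightarrow> real \<Rightarrow> (real \<Rightarrow> real \<Rightarrow> real) \<Rightarrow> real \<Rightarrow> (real \<Rightarrow> real) \<Rightarrow> real \<Rightarrow> real" where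
  "Dinv T lam K t g = (SOME f. L2on T f \<and>
     (AE s in lborel. s \<in> {0..T} \<longrightarrow> Dop T lam K t f s = g s))"

definition Bker :: "real \<Rightarrow> real \<Rightarrow> (real \<Rightarrow> real \<Rightarrow> real) \<Rightarrow> real \<Rightarrow> real \<Rightarrow> real" where
  "Bker T lam K t s = (if s \<le> t then
     (1 / (2 * lam)) * (ipT T (\<lambda>r. indicator {t..} r * K r t)
                              (Dinv T lam K t (\<lambda>r. indicator {t..} r * K r s)) - K t s)
     else 0)"

definition progressive :: "real \<Rightarrow> (real \<Rightarrow> 'a measure) \<Rightarrow> (real \<Rightarrow> 'a \<Rightarrow> real) \<Rightarrow> bool" where
  "progressive T F u \<longleftrightarrow> (\<forall>t\<in>{0..T}.
     (\<lambda>(s,\<omega>). u s \<omega>) \<in> borel_measurable (restrict_space lborel {0..t} \<Otimes>\<^sub>M F t))"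

definition Uset :: "real \<Rightarrow> 'a measure \<Rightarrow> (real \<Rightarrow> 'a measure) \<Rightarrow> (real \<Rightarrow> 'a \<Rightarrow> real) set" where
  "Uset T M F = {u. progressive T F u \<and>
     (\<integral>\<^sup>+ s. (\<integral>\<^sup>+ \<omega>. ennreal ((u s \<omega>)\<^sup>2) \<partial>M) * indicator {0..T} s \<partial>lborel) < \<infinity>}"

definition usual_filtration :: "real \<Rightarrow> 'a measure \<Rightarrow> (real \<Rightarrow> 'a measure) \<Rightarrow> bool" where
  "usual_filtration T M F \<longleftrightarrow>
     prob_space M \<and> complete_measure M \<and>
     (\<forall>t\<in>{0..T}. subalgebra M (F t)) \<and>
     (\<forall>s t. 0 \<le> s \<longrightarrow> s \<le> t \<longrightarrow> t \<le> T \<longrightarrow> sets (F s) \<subseteq> sets (F t)) \<and>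
     null_sets M \<subseteq> sets (F 0) \<and>
     (\<forall>t. 0 \<le> t \<longrightarrow> t < T \<longrightarrow> sets (F t) = (\<Inter>s\<in>{t<..T}. sets (F s)))"

definition ceproc :: "real \<Rightarrow> 'a measure \<Rightarrow> (real \<Rightarrow> 'a measure) \<Rightarrow> real \<Rightarrow> (real \<Rightarrow> 'a \<Rightarrow> real)
    \<Rightarrow> real \<Rightarrow> 'a \<Rightarrow> real" where
  "ceproc T M F t x = (SOME y.
     (\<lambda>(s,\<omega>). y s \<omega>) \<in> borel_measurable (restrict_space lborel {0..T} \<Otimes>\<^sub>M M) \<and>
     (AE s in lborel. s \<in> {0..T} \<longrightarrow> (AE \<omega> in M. y s \<omega> = real_cond_exp M (F t) (x s) \<omega>)))"

definition aproc :: "real \<Rightarrow> real \<Rightarrow> (real \<Rightarrow> real \<Rightarrow> real) \<Rightarrow> 'a measure \<Rightarrow> (real \<Rightarrow> 'a measure)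
    \<Rightarrow> (real \<Rightarrow> 'a \<Rightarrow> real) \<Rightarrow> real \<Rightarrow> 'a \<Rightarrow> real" where
  "aproc T lam K M F x t \<omega> = (1 / (2 * lam)) *
     (x t \<omega> - ipT T (\<lambda>r. indicator {t..} r * K r t)
                     (Dinv T lam K t (\<lambda>s. indicator {t..} s * ceproc T M F t x s \<omega>)))"

text \<open>\<open>(id - B)^{-1} a\<close> for a process a: the (a.e. unique) jointly measurable, square
  integrable process z with \<open>z_t - int_0^T B(t,s) z_s ds = a_t\<close> for a.e. t, a.s.\<close>
definition resolv :: "real \<Rightarrow> 'a measure \<Rightarrow> (real \<Rightarrow> real \<Rightarrow> real) \<Rightarrow> (real \<Rightarrow> 'a \<Rightarrow> real)
    \<Rightarrow> real \<Rightarrow> 'a \<Rightarrow> real" where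
  "resolv T M B a = (SOME z.
     (\<lambda>(t,\<omega>). z t \<omega>) \<in> borel_measurable (restrict_space lborel {0..T} \<Otimes>\<^sub>M M) \<and>
     (\<integral>\<^sup>+ t. (\<integral>\<^sup>+ \<omega>. ennreal ((z t \<omega>)\<^sup>2) \<partial>M) * indicator {0..T} t \<partial>lborel) < \<infinity> \<and>
     (AE t in lborel. t \<in> {0..T} \<longrightarrow>
        (AE \<omega> in M. z t \<omega> - (LINT s:{0..T}|lborel. B t s * z s \<omega>) = a t \<omega>)))"

text \<open>Solution map: \<open>(id - B)^{-1} a(x)\<close>. With \<open>K = hat A2\<close> this is \<open>\<F>\<close>,
  with \<open>K = hat A2 + A3\<close> it is \<open>\<G>\<close>.\<close>
definition solmap :: "real \<Rightarrow> real \<Rightarrow> (real \<Rightarrow> real \<Rightarrow> real) \<Rightarrow> 'a measure \<Rightarrow> (real \<Rightarrow> 'a measure)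
    \<Rightarrow> (real \<Rightarrow> 'a \<Rightarrow> real) \<Rightarrow> real \<Rightarrow> 'a \<Rightarrow> real" where
  "solmap T lam K M F x = resolv T M (Bker T lam K) (aproc T lam K M F x)"

definition Jinf :: "real \<Rightarrow> 'a measure \<Rightarrow> (real \<Rightarrow> real \<Rightarrow> real) \<Rightarrow> real \<Rightarrow> (real \<Rightarrow> real \<Rightarrow> real)
    \<Rightarrow> (real \<Rightarrow> real \<Rightarrow> real) \<Rightarrow> (nat \<Rightarrow> real \<Rightarrow> 'a \<Rightarrow> real) \<Rightarrow> (nat \<Rightarrow> 'a \<Rightarrow> real) \<Rightarrow> nat
    \<Rightarrow> (real \<Rightarrow> 'a \<Rightarrow> real) \<Rightarrow> (real \<Rightarrow> 'a \<Rightarrow> real) \<Rightarrow> real" where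
  "Jinf T M A1 lam A2h A3 b c i v \<nu> = (\<integral>\<omega>.
       - ipT T (\<lambda>s. \<nu> s \<omega>) (kop T A1 (\<lambda>s. \<nu> s \<omega>))
       - ipT T (\<lambda>s. v s \<omega>) (\<lambda>s. lam * v s \<omega> + kop T A2h (\<lambda>s. v s \<omega>) s)
       - ipT T (\<lambda>s. v s \<omega>) (kop T (\<lambda>s r. A3 s r + A3 r s) (\<lambda>s. \<nu> s \<omega>))
       + ipT T (\<lambda>s. b i s \<omega>) (\<lambda>s. v s \<omega>)
       + ipT T (\<lambda>s. b 0 s \<omega>) (\<lambda>s. \<nu> s \<omega>)
       + c i \<omega> \<partial>M)"

text \<open>Mean-field game Nash equilibrium (players indexed by i \<ge> 1; v 0 is unused).\<close>
definition MFG_NE :: "real \<Rightarrow> 'a measure \<Rightarrow> (real \<Rightarrow> 'a measure) \<Rightarrow> (real \<Rightarrow> real \<Rightarrow> real) \<Rightarrow> real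
    \<Rightarrow> (real \<Rightarrow> real \<Rightarrow> real) \<Rightarrow> (real \<Rightarrow> real \<Rightarrow> real) \<Rightarrow> (nat \<Rightarrow> real \<Rightarrow> 'a \<Rightarrow> real)
    \<Rightarrow> (nat \<Rightarrow> 'a \<Rightarrow> real) \<Rightarrow> (real \<Rightarrow> 'a \<Rightarrow> real) \<Rightarrow> (nat \<Rightarrow> real \<Rightarrow> 'a \<Rightarrow> real) \<Rightarrow> bool" where
  "MFG_NE T M F A1 lam A2h A3 b c \<nu> v \<longleftrightarrow>
     \<nu> \<in> Uset T M F \<and>
     (\<forall>i\<ge>1. v i \<in> Uset T M F \<and>
        (\<forall>w\<in>Uset T M F. Jinf T M A1 lam A2h A3 b c i w \<nu> \<le> Jinf T M A1 lam A2h A3 b c i (v i) \<nu>)) \<and>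
     ((\<lambda>N::nat. \<Squnion>t\<in>{0..T}. \<integral>\<^sup>+ \<omega>.
         ennreal (((1 / real N) * (\<Sum>i=1..N. v i t \<omega>) - \<nu> t \<omega>)\<^sup>2) \<partial>M) \<longlonglongrightarrow> 0)"

definition xproc :: "real \<Rightarrow> 'a measure \<Rightarrow> (real \<Rightarrow> 'a measure) \<Rightarrow> (real \<Rightarrow> real \<Rightarrow> real)
    \<Rightarrow> (real \<Rightarrow> 'a \<Rightarrow> real) \<Rightarrow> (real \<Rightarrow> 'a \<Rightarrow> real) \<Rightarrow> real \<Rightarrow> 'a \<Rightarrow> real" where
  "xproc T M F A3 \<nu> bi s \<omega> = bi s \<omega>
     - (LINT r:{0..s}|lborel. A3 s r * \<nu> r \<omega>)
     - (LINT r:{s..T}|lborel. A3 r s * ceproc T M F s \<nu> r \<omega>)"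

definition ae_eq_proc :: "real \<Rightarrow> 'a measure \<Rightarrow> (real \<Rightarrow> 'a \<Rightarrow> real) \<Rightarrow> (real \<Rightarrow> 'a \<Rightarrow> real) \<Rightarrow> bool" where
  "ae_eq_proc T M u w \<longleftrightarrow> (AE t in lborel. t \<in> {0..T} \<longrightarrow> (AE \<omega> in M. u t \<omega> = w t \<omega>))"

end

theory Submission
  imports Defs
begin

text \<open>A control is a best response iff it satisfies a first-order condition tested against all
  admissible controls; by coercivity this condition is solvable (Lax--Milgram on the closed subspace
  of progressive processes) and stable in the data. Averaging the conditions of the players and
  passing to the limit turns the mean field into the solution of the same problem with kernel
  \<open>A2h + A3\<close> and target \<open>binf\<close>.

  Testing against progressive versions of conditional expectations makes the condition pointwise:
  \<open>2 lam u_t + \<integral>_0^t K(t,s) u_s ds + \<integral>_t^T K(s,t) E_t[u_s] ds = E_t[y_t]\<close>. Taking \<open>E_t\<close> of it at later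
  times gives a linear equation with the operator \<open>Dop\<close> for \<open>E_t[u_s]\<close>, \<open>s \<ge> t\<close>; eliminating these leaves
  the Volterra equation \<open>u - B u = a\<close>, which has a unique solution by a Gronwall argument.\<close>

section \<open>Square integrable functions\<close>

text \<open>The obstacle is the quantifier over time. An equilibrium asks for a supremum over every
  t in [0,T], while first-order conditions determine controls only for almost every t. Stability is
  therefore proved slice by slice, for almost every time, and in the existence proof all players and
  the mean field are set to zero on one common null set of times. Inverses, conditional expectation
  processes and the resolvent are choices among almost everywhere solutions, and neither
  \<open>aproc\<close> nor \<open>xproc\<close> comes with joint measurability. So the Volterra
  equation is not solved by a Neumann series: the variational solution is the witness, and only
  uniqueness, where the right-hand side cancels, is proved for the equation itself. The 2 in
  \<open>2 lam\<close> comes from symmetrising the quadratic cost. The symmetrised operator is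
  self-adjoint, so minimising a quadratic functional yields existence, and in limits the operator
  can be moved onto a fixed test process. Positivity of the kernels gives coercivity for any horizon
  and any kernel size.\<close>

definition sqint :: "'b measure \<Rightarrow> ('b \<Rightarrow> real) \<Rightarrow> bool" where
  "sqint N f \<longleftrightarrow> f \<in> borel_measurable N \<and> integrable N (\<lambda>x. (f x)\<^sup>2)"

lemma sqint_meas: "sqint N f \<Longrightarrow> f \<in> borel_measurable N"
  by (simp add: sqint_def)

lemma sqint_integrable_power2: "sqint N f \<Longrightarrow> integrable N (\<lambda>x. (f x)\<^sup>2)"
  by (simp add: sqint_def)

lemma sqint_iff_nn:
  "sqint N f \<longleftrightarrow> f \<in> borel_measurable N \<and> (\<integral>\<^sup>+x. ennreal ((f x)\<^sup>2) \<partial>N) < \<infinity>"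
  unfolding sqint_def integrable_iff_bounded by (auto simp: power_mult_distrib)

lemma sqint_mult:
  assumes "sqint N f" "sqint N g"
  shows "integrable N (\<lambda>x. f x * g x)"
proof (rule Bochner_Integration.integrable_bound)
  show "integrable N (\<lambda>x. (f x)\<^sup>2 + (g x)\<^sup>2)"
    using assms by (auto simp: sqint_def)
  show "(\<lambda>x. f x * g x) \<in> borel_measurable N"
    using assms by (auto simp: sqint_def)
  show "AE x in N. norm (f x * g x) \<le> norm ((f x)\<^sup>2 + (g x)\<^sup>2)"
  proof (rule AE_I2)
    fix x
    have "\<bar>f x * g x\<bar> \<le> (f x)\<^sup>2 + (g x)\<^sup>2"
      using sum_squares_bound[of "f x" "g x"] sum_squares_bound[of "f x" "- g x"]
        zero_le_power2[of "f x"] zero_le_power2[of "g x"]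
      by (simp only: abs_le_iff) (auto simp: power2_eq_square)
    then show "norm (f x * g x) \<le> norm ((f x)\<^sup>2 + (g x)\<^sup>2)"
      by simp
  qed
qed

lemma sqint_cmult: "sqint N f \<Longrightarrow> sqint N (\<lambda>x. c * f x)"
  by (auto simp: sqint_def power_mult_distrib)

lemma sqint_add:
  assumes "sqint N f" "sqint N g"
  shows "sqint N (\<lambda>x. f x + g x)"
proof -
  have "integrable N (\<lambda>x. (f x)\<^sup>2 + (g x)\<^sup>2 + 2 * (f x * g x))"
    using assms sqint_mult[OF assms] by (intro Bochner_Integration.integrable_add) (auto simp: sqint_def)
  moreover have "(\<lambda>x. (f x)\<^sup>2 + (g x)\<^sup>2 + 2 * (f x * g x)) = (\<lambda>x. (f x + g x)\<^sup>2)"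
    by (auto simp: power2_eq_square algebra_simps)
  ultimately show ?thesis
    using assms by (auto simp: sqint_def)
qed

lemma sqint_diff:
  assumes "sqint N f" "sqint N g"
  shows "sqint N (\<lambda>x. f x - g x)"
  using sqint_add[OF assms(1) sqint_cmult[OF assms(2), of "-1"]] by simp

lemma sqint_zero: "sqint N (\<lambda>x. 0)"
  by (simp add: sqint_def)

lemma sqint_sum: "(\<And>i. i \<in> I \<Longrightarrow> sqint N (f i)) \<Longrightarrow> sqint N (\<lambda>x. \<Sum>i\<in>I. f i x)"
  by (induction I rule: infinite_finite_induct) (auto intro: sqint_zero sqint_add)

lemma sqint_bounded:
  assumes "sqint N f" "g \<in> borel_measurable N" "\<And>x. x \<in> space N \<Longrightarrow> \<bar>g x\<bar> \<le> \<bar>f x\<bar>"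
  shows "sqint N g"
  unfolding sqint_def
proof (intro conjI assms)
  show "integrable N (\<lambda>x. (g x)\<^sup>2)"
    using assms by (intro Bochner_Integration.integrable_bound[OF sqint_integrable_power2[OF assms(1)]])
      (auto intro!: AE_I2 simp: abs_le_square_iff)
qed

lemma (in finite_measure) sqint_integrable:
  assumes "sqint M f"
  shows "integrable M f"
  using sqint_mult[OF assms, of "\<lambda>_. 1"] by (simp add: sqint_def)

section \<open>Cauchy-Schwarz and completeness\<close>

lemma sqint_cauchy_schwarz:
  assumes f: "sqint N f" and g: "sqint N g"
  shows "(\<integral>x. f x * g x \<partial>N)\<^sup>2 \<le> (\<integral>x. (f x)\<^sup>2 \<partial>N) * (\<integral>x. (g x)\<^sup>2 \<partial>N)"
proof -
  note [measurable] = f[THEN sqint_meas] g[THEN sqint_meas]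
  have i: "integrable N (\<lambda>x. f x * g x)"
    by (rule sqint_mult[OF f g])
  have "ennreal ((\<integral>x. \<bar>f x\<bar> * \<bar>g x\<bar> \<partial>N)\<^sup>2) = (\<integral>\<^sup>+x. ennreal \<bar>f x\<bar> * ennreal \<bar>g x\<bar> \<partial>N)\<^sup>2"
    using i by (subst ennreal_power[symmetric], force, subst nn_integral_eq_integral[symmetric])
      (auto simp: abs_mult ennreal_mult dest: integrable_norm)
  also have "\<dots> \<le> (\<integral>\<^sup>+x. (ennreal \<bar>f x\<bar>)\<^sup>2 \<partial>N) * (\<integral>\<^sup>+x. (ennreal \<bar>g x\<bar>)\<^sup>2 \<partial>N)"
    by (rule Cauchy_Schwarz_nn_integral) auto
  also have "\<dots> = ennreal ((\<integral>x. (f x)\<^sup>2 \<partial>N) * (\<integral>x. (g x)\<^sup>2 \<partial>N))"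
    using f g by (simp add: ennreal_power sqint_def nn_integral_eq_integral ennreal_mult)
  finally have "(\<integral>x. \<bar>f x\<bar> * \<bar>g x\<bar> \<partial>N)\<^sup>2 \<le> (\<integral>x. (f x)\<^sup>2 \<partial>N) * (\<integral>x. (g x)\<^sup>2 \<partial>N)"
    by (subst (asm) ennreal_le_iff) (auto intro!: mult_nonneg_nonneg)
  moreover have "\<bar>\<integral>x. f x * g x \<partial>N\<bar> \<le> (\<integral>x. \<bar>f x\<bar> * \<bar>g x\<bar> \<partial>N)"
    using integral_abs_bound[of N "\<lambda>x. f x * g x"] by (simp add: abs_mult)
  then have "(\<integral>x. f x * g x \<partial>N)\<^sup>2 \<le> (\<integral>x. \<bar>f x\<bar> * \<bar>g x\<bar> \<partial>N)\<^sup>2"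
    by (simp add: abs_le_square_iff[symmetric])
  ultimately show ?thesis by simp
qed

text \<open>Tonelli: the series has finite integral, so it is finite almost everywhere. The almost
  sure limits along fast Cauchy sequences and along dyadic times are both obtained from it.\<close>

lemma AE_summable_of_integrals:
  fixes d :: "nat \<Rightarrow> 'b \<Rightarrow> real"
  assumes d: "\<And>n. d n \<in> borel_measurable N" and nonneg: "\<And>n x. 0 \<le> d n x"
    and b: "\<And>n. (\<integral>\<^sup>+x. ennreal (d n x) \<partial>N) \<le> ennreal (b n)" and sb: "summable b" and b0: "\<And>n. 0 \<le> b n"
  shows "AE x in N. summable (\<lambda>n. d n x)"
proof -
  note [measurable] = d
  have "(\<integral>\<^sup>+x. (\<Sum>n. ennreal (d n x)) \<partial>N) = (\<Sum>n. \<integral>\<^sup>+x. ennreal (d n x) \<partial>N)"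
    by (rule nn_integral_suminf) auto
  also have "\<dots> \<le> (\<Sum>n. ennreal (b n))"
    by (intro suminf_le b) auto
  also have "\<dots> = ennreal (\<Sum>n. b n)"
    by (rule suminf_ennreal2[OF b0 sb])
  finally have "(\<integral>\<^sup>+x. (\<Sum>n. ennreal (d n x)) \<partial>N) \<noteq> \<infinity>"
    by (auto simp: top_unique)
  then have "AE x in N. (\<Sum>n. ennreal (d n x)) \<noteq> \<infinity>"
    by (rule nn_integral_PInf_AE[rotated]) auto
  then show ?thesis
    by (rule AE_mp) (auto intro!: AE_I2 summable_suminf_not_top nonneg)
qed

text \<open>Assuming the rate 4^-n avoids a subsequence and names the limit as the pointwise
  \<open>lim\<close>. A class of functions closed under pointwise limits is then closed in L2 as
  well, which is how progressive processes are treated without equivalence classes.\<close>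

lemma (in finite_measure) riesz_fischer:
  fixes f :: "nat \<Rightarrow> 'a \<Rightarrow> real"
  assumes f: "\<And>n. sqint M (f n)"
    and cauchy: "\<And>n m. n \<le> m \<Longrightarrow> (\<integral>x. (f m x - f n x)\<^sup>2 \<partial>M) \<le> C / 4 ^ n"
  defines "g \<equiv> \<lambda>x. lim (\<lambda>n. f n x)"
  shows "sqint M g" "\<And>n. (\<integral>x. (g x - f n x)\<^sup>2 \<partial>M) \<le> C / 4 ^ n"
proof -
  have fm[measurable]: "\<And>n. f n \<in> borel_measurable M" using f by (auto simp: sqint_def)
  have gm[measurable]: "g \<in> borel_measurable M"
    unfolding g_def by measurable
  have C0: "0 \<le> C"
    using cauchy[of 0 0] by simp
  have "AE x in M. summable (\<lambda>n. \<bar>f (Suc n) x - f n x\<bar>)"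
  proof (rule AE_summable_of_integrals)
    fix n
    have s: "sqint M (\<lambda>x. f (Suc n) x - f n x)"
      by (intro sqint_diff f)
    have "(\<integral>\<^sup>+x. ennreal \<bar>f (Suc n) x - f n x\<bar> \<partial>M) \<le>
        (\<integral>\<^sup>+x. ennreal ((1/2)^n + 2^n * (f (Suc n) x - f n x)\<^sup>2) \<partial>M)"
    proof (intro nn_integral_mono ennreal_leI)
      fix x
      let ?d = "\<bar>f (Suc n) x - f n x\<bar>"
      \<comment> \<open>Completing the square bounds |d| by a summable constant plus 2^n d^2; the
        rate 4^-n still beats the weight 2^n.\<close>
      have "0 \<le> (1 - 2^n * ?d)\<^sup>2 / 2^n + ?d" by simp
      also have "\<dots> = (1/2)^n - ?d + 2^n * ?d\<^sup>2"
        by (simp add: power2_eq_square field_simps)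
      finally show "?d \<le> (1/2)^n + 2^n * (f (Suc n) x - f n x)\<^sup>2" by simp
    qed
    also have "\<dots> = ennreal (\<integral>x. (1/2)^n + 2^n * (f (Suc n) x - f n x)\<^sup>2 \<partial>M)"
      using sqint_integrable_power2[OF s] by (intro nn_integral_eq_integral) auto
    also have "\<dots> \<le> ennreal ((measure M (space M) + C) * (1/2)^n)"
    proof (rule ennreal_leI)
      have "(\<integral>x. (1/2)^n + 2^n * (f (Suc n) x - f n x)\<^sup>2 \<partial>M)
          = measure M (space M) * (1/2)^n + 2^n * (\<integral>x. (f (Suc n) x - f n x)\<^sup>2 \<partial>M)"
        using sqint_integrable_power2[OF s] by simp
      also have "\<dots> \<le> measure M (space M) * (1/2)^n + 2^n * (C / 4^n)"
        by (intro add_left_mono mult_left_mono cauchy) auto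
      also have "2^n * (C / 4^n) = C * (1/2)^n"
        by (simp add: field_simps flip: power_mult_distrib)
      finally show "(\<integral>x. (1/2)^n + 2^n * (f (Suc n) x - f n x)\<^sup>2 \<partial>M) \<le> (measure M (space M) + C) * (1/2)^n"
        by (simp add: algebra_simps)
    qed
    finally show "(\<integral>\<^sup>+x. ennreal \<bar>f (Suc n) x - f n x\<bar> \<partial>M) \<le> ennreal ((measure M (space M) + C) * (1/2)^n)" .
  next
    show "summable (\<lambda>n. (measure M (space M) + C) * (1 / 2) ^ n)"
      by (intro summable_mult summable_geometric) auto
  qed (use C0 in auto)
  then have conv: "AE x in M. (\<lambda>n. f n x) \<longlonglongrightarrow> g x"
  proof (rule AE_mp, intro AE_I2 impI)
    fix x assume "summable (\<lambda>n. \<bar>f (Suc n) x - f n x\<bar>)"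
    then have "summable (\<lambda>n. f (Suc n) x - f n x)"
      by (rule summable_rabs_cancel)
    then have "convergent (\<lambda>n. \<Sum>i<n. f (Suc i) x - f i x)"
      by (simp add: summable_iff_convergent)
    then have "convergent (\<lambda>n. f n x - f 0 x)"
      by (simp only: sum_lessThan_telescope[of "\<lambda>n. f n x"])
    then have "convergent (\<lambda>n. (f n x - f 0 x) + f 0 x)"
      by (intro convergent_add convergent_const)
    then show "(\<lambda>n. f n x) \<longlonglongrightarrow> g x"
      by (simp add: g_def convergent_LIMSEQ_iff)
  qed
  \<comment> \<open>Fatou in m, with n fixed, transfers the Cauchy bound to the limit.\<close>
  have nn: "(\<integral>\<^sup>+x. ennreal ((g x - f n x)\<^sup>2) \<partial>M) \<le> ennreal (C / 4^n)" for n
  proof -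
    have "AE x in M. ennreal ((g x - f n x)\<^sup>2) = liminf (\<lambda>m. ennreal ((f m x - f n x)\<^sup>2))"
      using conv
    proof (rule AE_mp, intro AE_I2 impI)
      fix x assume "(\<lambda>n. f n x) \<longlonglongrightarrow> g x"
      then have "(\<lambda>m. ennreal ((f m x - f n x)\<^sup>2)) \<longlonglongrightarrow> ennreal ((g x - f n x)\<^sup>2)"
        by (intro tendsto_intros)
      then show "ennreal ((g x - f n x)\<^sup>2) = liminf (\<lambda>m. ennreal ((f m x - f n x)\<^sup>2))"
        by (intro lim_imp_Liminf[symmetric]) auto
    qed
    then have "(\<integral>\<^sup>+x. ennreal ((g x - f n x)\<^sup>2) \<partial>M) = (\<integral>\<^sup>+x. liminf (\<lambda>m. ennreal ((f m x - f n x)\<^sup>2)) \<partial>M)"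
      by (rule nn_integral_cong_AE)
    also have "\<dots> \<le> liminf (\<lambda>m. \<integral>\<^sup>+x. ennreal ((f m x - f n x)\<^sup>2) \<partial>M)"
      by (rule nn_integral_liminf) auto
    also have "\<dots> \<le> liminf (\<lambda>m. ennreal (C / 4^n))"
    proof (intro Liminf_mono eventually_sequentiallyI[of n])
      fix m assume "n \<le> m"
      then show "(\<integral>\<^sup>+x. ennreal ((f m x - f n x)\<^sup>2) \<partial>M) \<le> ennreal (C / 4^n)"
        using cauchy[of n m] sqint_integrable_power2[OF sqint_diff[OF f f]]
        by (subst nn_integral_eq_integral) (auto intro!: ennreal_leI)
    qed
    finally show ?thesis by (simp add: Liminf_const)
  qed
  have sq: "sqint M (\<lambda>x. g x - f n x)" for n
    using nn[of n] by (auto simp: sqint_iff_nn intro: le_less_trans)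
  show "sqint M g"
    using sqint_add[OF sq[of 0] f[of 0]] by simp
  show "(\<integral>x. (g x - f n x)\<^sup>2 \<partial>M) \<le> C / 4^n" for n
    using nn[of n] sqint_integrable_power2[OF sq[of n]] C0
    by (subst (asm) nn_integral_eq_integral) auto
qed

section \<open>Minimisation of quadratic functionals on closed subspaces\<close>

lemma tendsto_zero_of_power2_le:
  fixes f :: "nat \<Rightarrow> real"
  assumes "\<And>n. (f n)\<^sup>2 \<le> (1/4)^n * c"
  shows "f \<longlonglongrightarrow> 0"
proof -
  have lim: "(\<lambda>n. (1/4)^n * c) \<longlonglongrightarrow> 0"
    by (intro tendsto_mult_left_zero LIMSEQ_power_zero) simp
  have "(\<lambda>n. (f n)\<^sup>2) \<longlonglongrightarrow> 0"
    by (rule tendsto_sandwich[of "\<lambda>_. 0" _ _ "\<lambda>n. (1/4)^n * c"]) (simp_all add: assms lim)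
  then have "(\<lambda>n. sqrt ((f n)\<^sup>2)) \<longlonglongrightarrow> sqrt 0"
    by (rule tendsto_real_sqrt)
  then show ?thesis by (simp add: tendsto_rabs_zero_iff)
qed

text \<open>Direct method: a minimising sequence of \<open>Q\<close> with errors (1/4)^n is Cauchy
  by the parallelogram identity, hence has its pointwise limit in V by \<open>riesz_fischer\<close>.
  That the limit solves the equation is read off the sequence itself: near-minimality makes the
  residual of \<open>v n\<close> against w tend to zero. Symmetry of the form is what makes the
  equation an Euler-Lagrange equation.\<close>

lemma (in finite_measure) symmetric_lax_milgram:
  fixes V :: "('a \<Rightarrow> real) set" and a :: "('a \<Rightarrow> real) \<Rightarrow> ('a \<Rightarrow> real) \<Rightarrow> real"
  assumes V_sq: "\<And>v. v \<in> V \<Longrightarrow> sqint M v"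
    and V_zero: "(\<lambda>x. 0) \<in> V"
    and V_add: "\<And>v w. v \<in> V \<Longrightarrow> w \<in> V \<Longrightarrow> (\<lambda>x. v x + w x) \<in> V"
    and V_scale: "\<And>c v. v \<in> V \<Longrightarrow> (\<lambda>x. c * v x) \<in> V"
    and V_lim: "\<And>f. (\<And>n. f n \<in> V) \<Longrightarrow> sqint M (\<lambda>x. lim (\<lambda>n::nat. f n x)) \<Longrightarrow> (\<lambda>x. lim (\<lambda>n. f n x)) \<in> V"
    and a_add: "\<And>u v w. u \<in> V \<Longrightarrow> v \<in> V \<Longrightarrow> w \<in> V \<Longrightarrow> a (\<lambda>x. u x + v x) w = a u w + a v w"
    and a_scale: "\<And>c u w. u \<in> V \<Longrightarrow> w \<in> V \<Longrightarrow> a (\<lambda>x. c * u x) w = c * a u w"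
    and a_sym: "\<And>u w. u \<in> V \<Longrightarrow> w \<in> V \<Longrightarrow> a u w = a w u"
    and a_bdd: "\<And>u w. u \<in> V \<Longrightarrow> w \<in> V \<Longrightarrow> (a u w)\<^sup>2 \<le> A * (\<integral>x. (u x)\<^sup>2 \<partial>M) * (\<integral>x. (w x)\<^sup>2 \<partial>M)"
    and a_coercive: "\<And>u. u \<in> V \<Longrightarrow> \<alpha> * (\<integral>x. (u x)\<^sup>2 \<partial>M) \<le> a u u" and \<alpha>: "\<alpha> > 0"
    and y: "sqint M y"
  shows "\<exists>u\<in>V. \<forall>w\<in>V. a u w = (\<integral>x. y x * w x \<partial>M)"
proof -
  define l where "l w = (\<integral>x. y x * w x \<partial>M)" for w
  define Q where "Q v = a v v - 2 * l v" for v
  have a_add2: "a w (\<lambda>x. u x + v x) = a w u + a w v" if "u \<in> V" "v \<in> V" "w \<in> V" for u v w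
    using a_add[OF that] a_sym[OF _ that(3)] that V_add by simp
  have a_scale2: "a w (\<lambda>x. c * u x) = c * a w u" if "u \<in> V" "w \<in> V" for c u w
    using a_scale[OF that] a_sym[OF _ that(2)] that V_scale by simp
  have l_add: "l (\<lambda>x. u x + v x) = l u + l v" if "u \<in> V" "v \<in> V" for u v
    unfolding l_def using sqint_mult[OF y V_sq] that
    by (simp add: distrib_left)
  have l_scale: "l (\<lambda>x. c * u x) = c * l u" if "u \<in> V" for c u
    unfolding l_def using sqint_mult[OF y V_sq] that
    by (simp add: mult.left_commute)
  have V_diff: "(\<lambda>x. u x - v x) \<in> V" if "u \<in> V" "v \<in> V" for u v
    using V_add[OF that(1) V_scale[OF that(2), of "-1"]] by simp
  have a_nonneg: "0 \<le> a v v" if "v \<in> V" for v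
    using order_trans[OF _ a_coercive[OF that]] \<alpha> by simp
  \<comment> \<open>Young's inequality with weight \<alpha> spends exactly the coercivity on the
    linear term.\<close>
  have Q_lower: "- ((\<integral>x. (y x)\<^sup>2 \<partial>M) / \<alpha>) \<le> Q v" if v: "v \<in> V" for v
  proof -
    have sy: "integrable M (\<lambda>x. (y x)\<^sup>2)" and sv: "integrable M (\<lambda>x. (v x)\<^sup>2)"
      using y V_sq[OF v] by (auto simp: sqint_def)
    have "2 * l v = (\<integral>x. 2 * (y x * v x) \<partial>M)"
      by (simp add: l_def)
    also have "\<dots> \<le> (\<integral>x. (1 / \<alpha>) * (y x)\<^sup>2 + \<alpha> * (v x)\<^sup>2 \<partial>M)"
    proof (rule integral_mono)
      show "integrable M (\<lambda>x. 2 * (y x * v x))"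
        using sqint_mult[OF y V_sq[OF v]] by simp
      show "integrable M (\<lambda>x. (1 / \<alpha>) * (y x)\<^sup>2 + \<alpha> * (v x)\<^sup>2)"
        using sy sv by (intro Bochner_Integration.integrable_add integrable_mult_right) auto
      fix x
      have "0 \<le> (y x - \<alpha> * v x)\<^sup>2 / \<alpha>" using \<alpha> by simp
      then show "2 * (y x * v x) \<le> (1 / \<alpha>) * (y x)\<^sup>2 + \<alpha> * (v x)\<^sup>2"
        using \<alpha> by (simp add: field_simps power2_eq_square)
    qed
    also have "\<dots> = (\<integral>x. (y x)\<^sup>2 \<partial>M) / \<alpha> + \<alpha> * (\<integral>x. (v x)\<^sup>2 \<partial>M)"
      using sy sv by simp
    finally show ?thesis
      using a_coercive[OF v] by (simp add: Q_def)
  qed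
  define m where "m = Inf (Q ` V)"
  have bdd: "bdd_below (Q ` V)"
    using Q_lower by (auto simp: bdd_below_def)
  have m_le: "m \<le> Q v" if "v \<in> V" for v
    unfolding m_def using bdd that by (intro cInf_lower) auto
  \<comment> \<open>The error (1/4)^n is chosen to match the rate required by
    \<open>riesz_fischer\<close>.\<close>
  have "\<exists>v\<in>V. Q v < m + (1/4)^n" for n :: nat
    using cInf_lessD[of "Q ` V" "m + (1/4)^n"] V_zero by (auto simp: m_def)
  then obtain v where v: "\<And>n::nat. v n \<in> V" and Qv: "\<And>n. Q (v n) < m + (1/4)^n"
    by metis
  have parallelogram: "a (\<lambda>x. u x - w x) (\<lambda>x. u x - w x)
      = 2 * Q u + 2 * Q w - 4 * Q (\<lambda>x. (1/2) * (u x + w x))" if u: "u \<in> V" and w: "w \<in> V" for u w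
  proof -
    have d: "(\<lambda>x. u x - w x) = (\<lambda>x. u x + (-1) * w x)" by auto
    note simps = a_add a_scale a_add2 a_scale2 l_add l_scale V_add V_scale u w a_sym[OF w u]
    have "a (\<lambda>x. u x - w x) (\<lambda>x. u x - w x) = a u u - 2 * a u w + a w w"
      unfolding d by (simp only: simps) (simp add: simps)
    moreover have "a (\<lambda>x. (1/2) * (u x + w x)) (\<lambda>x. (1/2) * (u x + w x)) = (a u u + 2 * a u w + a w w) / 4"
      by (simp only: simps) (simp add: simps add_divide_distrib)
    moreover have "l (\<lambda>x. (1/2) * (u x + w x)) = (l u + l w) / 2"
      by (simp only: simps)
    ultimately show ?thesis
      unfolding Q_def by simp
  qed
  have cauchy: "(\<integral>x. (v k x - v n x)\<^sup>2 \<partial>M) \<le> (4 / \<alpha>) / 4 ^ n" if "n \<le> k" for n k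
  proof -
    have "\<alpha> * (\<integral>x. (v k x - v n x)\<^sup>2 \<partial>M) \<le> a (\<lambda>x. v k x - v n x) (\<lambda>x. v k x - v n x)"
      by (intro a_coercive V_diff v)
    also have "\<dots> = 2 * Q (v k) + 2 * Q (v n) - 4 * Q (\<lambda>x. (1/2) * (v k x + v n x))"
      by (intro parallelogram v)
    also have "\<dots> \<le> 2 * (m + (1/4)^k) + 2 * (m + (1/4)^n) - 4 * m"
      using Qv[of k] Qv[of n] m_le[OF V_scale[OF V_add[OF v v]], of "1/2" k n] by simp
    also have "\<dots> \<le> 4 * (1/4)^n"
      using power_decreasing[OF that, of "1/4::real"] by simp
    finally show ?thesis
      using \<alpha> by (simp add: field_simps)
  qed
  define u where "u x = lim (\<lambda>n. v n x)" for x
  have u_sq: "sqint M u" and u_lim: "\<And>n. (\<integral>x. (u x - v n x)\<^sup>2 \<partial>M) \<le> (4 / \<alpha>) / 4 ^ n"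
    unfolding u_def using riesz_fischer[of v "4 / \<alpha>", OF V_sq[OF v] cauchy] by auto
  have uV: "u \<in> V"
    using V_lim[of v] v u_sq by (simp add: u_def[abs_def])
  have alg: "2 * (- p / D) * p + (- p / D)\<^sup>2 * D = - (p\<^sup>2 / D)" if "D > 0" for p D :: real
    using that by (simp add: field_simps power2_eq_square)
  have "a u w = l w" if w: "w \<in> V" for w
  proof -
    have "(\<lambda>n. a (v n) w - l w) \<longlonglongrightarrow> 0"
    proof -
      have "(a (v n) w - l w)\<^sup>2 \<le> (1/4)^n * (a w w + 1)" for n
      proof -
        let ?p = "a (v n) w - l w" and ?A = "a w w"
        \<comment> \<open>The optimal step along w for the quadratic bound with
          \<open>?A + 1\<close> in place of \<open>?A\<close>; the added 1 keeps the denominator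
          positive when the form vanishes at w.\<close>
        define s where "s = - ?p / (?A + 1)"
        have A: "0 \<le> ?A" by (rule a_nonneg[OF w])
        have "m \<le> Q (\<lambda>x. v n x + s * w x)"
          by (intro m_le V_add V_scale v w)
        also have "\<dots> = Q (v n) + 2 * s * ?p + s\<^sup>2 * ?A"
          unfolding Q_def
          by (simp add: a_add a_scale a_add2 a_scale2 l_add l_scale V_add V_scale v w a_sym[OF w v])
            (simp add: algebra_simps power2_eq_square)
        also have "\<dots> \<le> m + (1/4)^n + 2 * s * ?p + s\<^sup>2 * (?A + 1)"
        proof -
          have "s\<^sup>2 * ?A \<le> s\<^sup>2 * (?A + 1)" by (intro mult_left_mono) auto
          then show ?thesis using Qv[of n] by linarith
        qed
        also have "\<dots> = m + (1/4)^n + (2 * s * ?p + s\<^sup>2 * (?A + 1))"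
          by simp
        also have "2 * s * ?p + s\<^sup>2 * (?A + 1) = - (?p\<^sup>2 / (?A + 1))"
          unfolding s_def by (rule alg) (use A in simp)
        finally have "?p\<^sup>2 / (?A + 1) \<le> (1/4)^n"
          by simp
        then show ?thesis using A by (simp add: field_simps)
      qed
      then show ?thesis by (rule tendsto_zero_of_power2_le)
    qed
    moreover have "(\<lambda>n. a u w - a (v n) w) \<longlonglongrightarrow> 0"
    proof -
      have "(a u w - a (v n) w)\<^sup>2 \<le> (1/4)^n * (\<bar>A\<bar> * (4/\<alpha>) * (\<integral>x. (w x)\<^sup>2 \<partial>M))" for n
      proof -
        have "a u w - a (v n) w = a (\<lambda>x. u x + (-1) * v n x) w"
          by (simp only: a_add a_scale V_add V_scale v w uV)
        also have "\<dots> = a (\<lambda>x. u x - v n x) w" by simp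
        finally have "(a u w - a (v n) w)\<^sup>2 \<le> A * (\<integral>x. (u x - v n x)\<^sup>2 \<partial>M) * (\<integral>x. (w x)\<^sup>2 \<partial>M)"
          using a_bdd[OF V_diff[OF uV v] w, of n] by simp
        also have "\<dots> \<le> \<bar>A\<bar> * ((4 / \<alpha>) / 4 ^ n) * (\<integral>x. (w x)\<^sup>2 \<partial>M)"
          by (intro mult_right_mono mult_mono u_lim) auto
        finally show ?thesis by (simp add: field_simps)
      qed
      then show ?thesis by (rule tendsto_zero_of_power2_le)
    qed
    ultimately have "(\<lambda>n. (a u w - a (v n) w) + (a (v n) w - l w)) \<longlonglongrightarrow> 0 + 0"
      by (intro tendsto_add)
    then show ?thesis by (simp add: LIMSEQ_const_iff)
  qed
  then show ?thesis using uV by (auto simp: l_def)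
qed

text \<open>First-order condition at a maximum: the linear gain is dominated by a quadratic loss for
  both signs of e. The step p / (Q + 1) is used so that Q = 0 is covered.\<close>

lemma quadratic_perturbation:
  fixes p Q :: real
  assumes "\<And>e. e * p \<le> e\<^sup>2 * Q" "0 \<le> Q"
  shows "p = 0"
proof -
  define e where "e = p / (Q + 1)"
  have Q: "Q + 1 > 0" using assms(2) by simp
  have "e * p \<le> e\<^sup>2 * Q" by (rule assms(1))
  then have "(e * p) * (Q + 1)\<^sup>2 \<le> (e\<^sup>2 * Q) * (Q + 1)\<^sup>2" by (rule mult_right_mono) simp
  moreover have "e * (Q + 1) = p" using Q by (simp add: e_def)
  then have pe: "p = e * (Q + 1)" by simp
  have "(e * p) * (Q + 1)\<^sup>2 = p\<^sup>2 * (Q + 1)" "(e\<^sup>2 * Q) * (Q + 1)\<^sup>2 = p\<^sup>2 * Q"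
    unfolding pe by (simp_all add: power2_eq_square mult_ac)
  ultimately have "p\<^sup>2 * (Q + 1) \<le> p\<^sup>2 * Q" by (simp only:)
  then show ?thesis by (simp add: distrib_left)
qed

section \<open>Kernel operators\<close>

text \<open>Restricting the measure, instead of carrying indicators, makes time a finite measure
  space, so that square integrable functions are integrable and \<open>riesz_fischer\<close>
  applies.\<close>

definition tspace :: "real \<Rightarrow> real measure" where
  "tspace T = restrict_space lborel {0..T}"

lemma space_tspace [simp]: "space (tspace T) = {0..T}"
  by (simp add: tspace_def space_restrict_space)

lemma finite_measure_tspace: "finite_measure (tspace T)"
  unfolding tspace_def
  by (rule finite_measureI) (auto simp: emeasure_restrict_space space_restrict_space emeasure_lborel_Icc_eq)

lemma sigma_finite_tspace: "sigma_finite_measure (tspace T)"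
  using finite_measure_tspace finite_measure_def by blast

lemma measurable_tspace_id: "(\<lambda>x. x) \<in> borel_measurable (tspace T)"
  unfolding tspace_def by (auto intro: measurable_restrict_space1)

lemma borel_measurable_tspace: "f \<in> borel_measurable borel \<Longrightarrow> f \<in> borel_measurable (tspace T)"
  unfolding tspace_def by (auto intro: measurable_restrict_space1)

lemma set_integral_tspace: "(LINT s:{0..T}|lborel. f s) = (\<integral>s. f s \<partial>tspace T)" for f :: "real \<Rightarrow> real"
  unfolding tspace_def set_lebesgue_integral_def by (subst integral_restrict_space) auto

lemma nn_integral_tspace: "(\<integral>\<^sup>+ s. f s * indicator {0..T} s \<partial>lborel) = (\<integral>\<^sup>+ s. f s \<partial>tspace T)"
  unfolding tspace_def by (subst nn_integral_restrict_space) auto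

lemma AE_tspace: "(AE s in lborel. s \<in> {0..T} \<longrightarrow> P s) \<longleftrightarrow> (AE s in tspace T. P s)"
  unfolding tspace_def by (subst AE_restrict_space_iff) auto

lemma L2on_iff_sqint: "L2on T f \<longleftrightarrow> sqint (tspace T) f"
proof -
  have "set_borel_measurable lborel {0..T} f \<longleftrightarrow> f \<in> borel_measurable (tspace T)"
    unfolding tspace_def set_borel_measurable_def
    by (subst borel_measurable_restrict_space_iff) auto
  then show ?thesis
    unfolding L2on_def sqint_iff_nn nn_integral_tspace by simp
qed

lemma ipT_eq: "ipT T f g = (\<integral>s. f s * g s \<partial>tspace T)"
  unfolding ipT_def by (rule set_integral_tspace)

lemma kop_eq: "kop T K f s = (\<integral>r. K s r * f r \<partial>tspace T)"
  unfolding kop_def by (rule set_integral_tspace)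

text \<open>Rows and columns are controlled at every time, not merely at almost every one, because
  later arguments freeze a single time. The two-sided condition is stable under transposition, and
  \<open>C > 0\<close> keeps derived constants strictly positive.\<close>

definition bdd_kernel :: "real \<Rightarrow> real \<Rightarrow> (real \<Rightarrow> real \<Rightarrow> real) \<Rightarrow> bool" where
  "bdd_kernel T C K \<longleftrightarrow> case_prod K \<in> borel_measurable (tspace T \<Otimes>\<^sub>M tspace T) \<and> C > 0 \<and>
     (\<forall>t\<in>{0..T}. sqint (tspace T) (K t) \<and> (\<integral>s. (K t s)\<^sup>2 \<partial>tspace T) \<le> C) \<and>
     (\<forall>s\<in>{0..T}. sqint (tspace T) (\<lambda>t. K t s) \<and> (\<integral>t. (K t s)\<^sup>2 \<partial>tspace T) \<le> C)"

lemma bdd_kernelD: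
  assumes "bdd_kernel T C K"
  shows "case_prod K \<in> borel_measurable (tspace T \<Otimes>\<^sub>M tspace T)" "C > 0"
    "t \<in> {0..T} \<Longrightarrow> sqint (tspace T) (K t)" "t \<in> {0..T} \<Longrightarrow> (\<integral>s. (K t s)\<^sup>2 \<partial>tspace T) \<le> C"
    "s \<in> {0..T} \<Longrightarrow> sqint (tspace T) (\<lambda>t. K t s)" "s \<in> {0..T} \<Longrightarrow> (\<integral>t. (K t s)\<^sup>2 \<partial>tspace T) \<le> C"
  using assms by (auto simp: bdd_kernel_def)

lemma bdd_kernel_transpose:
  assumes "bdd_kernel T C K"
  shows "bdd_kernel T C (\<lambda>s r. K r s)"
proof -
  have [measurable]: "case_prod K \<in> borel_measurable (tspace T \<Otimes>\<^sub>M tspace T)"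
    using assms by (rule bdd_kernelD)
  have "(\<lambda>(s, r). K r s) \<in> borel_measurable (tspace T \<Otimes>\<^sub>M tspace T)"
    by measurable
  then show ?thesis
    using assms by (auto simp: bdd_kernel_def)
qed

lemma sqint_add_bound:
  assumes f: "sqint N f" "(\<integral>x. (f x)\<^sup>2 \<partial>N) \<le> C" and g: "sqint N g" "(\<integral>x. (g x)\<^sup>2 \<partial>N) \<le> D"
  shows "(\<integral>x. (f x + g x)\<^sup>2 \<partial>N) \<le> 2 * (C + D)"
proof -
  have "(\<integral>x. (f x + g x)\<^sup>2 \<partial>N) \<le> (\<integral>x. 2 * (f x)\<^sup>2 + 2 * (g x)\<^sup>2 \<partial>N)"
  proof (rule integral_mono)
    show "integrable N (\<lambda>x. (f x + g x)\<^sup>2)"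
      using sqint_add[OF f(1) g(1)] by (rule sqint_integrable_power2)
    show "integrable N (\<lambda>x. 2 * (f x)\<^sup>2 + 2 * (g x)\<^sup>2)"
      using f g by (auto simp: sqint_def)
    fix x
    have "0 \<le> (f x - g x)\<^sup>2" by simp
    then show "(f x + g x)\<^sup>2 \<le> 2 * (f x)\<^sup>2 + 2 * (g x)\<^sup>2"
      by (simp add: power2_eq_square algebra_simps)
  qed
  also have "\<dots> = 2 * (\<integral>x. (f x)\<^sup>2 \<partial>N) + 2 * (\<integral>x. (g x)\<^sup>2 \<partial>N)"
    using f g by (simp add: sqint_def)
  finally show ?thesis using f g by simp
qed

lemma bdd_kernel_add:
  assumes K: "bdd_kernel T C K" and L: "bdd_kernel T D L"
  shows "bdd_kernel T (2 * (C + D)) (\<lambda>s r. K s r + L s r)"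
proof -
  have [measurable]: "case_prod K \<in> borel_measurable (tspace T \<Otimes>\<^sub>M tspace T)"
    "case_prod L \<in> borel_measurable (tspace T \<Otimes>\<^sub>M tspace T)"
    using assms by (auto dest: bdd_kernelD)
  have "(\<lambda>(s, r). K s r + L s r) \<in> borel_measurable (tspace T \<Otimes>\<^sub>M tspace T)"
    by measurable
  then show ?thesis
    using bdd_kernelD[OF K] bdd_kernelD[OF L]
    by (auto simp: bdd_kernel_def simp del: distrib_left_numeral intro!: sqint_add sqint_add_bound)
qed

lemma bdd_kernel_cut:
  assumes K: "bdd_kernel T C K" and S: "S \<in> sets (tspace T \<Otimes>\<^sub>M tspace T)"
  shows "bdd_kernel T C (\<lambda>s r. K s r * indicator S (s, r))"
proof -
  have [measurable]: "case_prod K \<in> borel_measurable (tspace T \<Otimes>\<^sub>M tspace T)"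
    using assms by (auto dest: bdd_kernelD)
  have meas[measurable]: "(\<lambda>(s, r). K s r * indicator S (s, r)) \<in> borel_measurable (tspace T \<Otimes>\<^sub>M tspace T)"
    using S by measurable
  have [measurable]: "(\<lambda>s. K t s * indicator S (t, s)) \<in> borel_measurable (tspace T)"
    "(\<lambda>s. K s t * indicator S (s, t)) \<in> borel_measurable (tspace T)" if "t \<in> {0..T}" for t
    using measurable_compose[OF measurable_Pair1'[of t "tspace T" "tspace T"] meas]
      measurable_compose[OF measurable_Pair2'[of t "tspace T" "tspace T"] meas] that by simp_all
  have row: "sqint (tspace T) (\<lambda>s. K t s * indicator S (t, s))"
    "(\<integral>s. (K t s * indicator S (t, s))\<^sup>2 \<partial>tspace T) \<le> C" if t: "t \<in> {0..T}" for t
  proof -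
    show s: "sqint (tspace T) (\<lambda>s. K t s * indicator S (t, s))"
      using t by (intro sqint_bounded[OF bdd_kernelD(3)[OF K t]]) (measurable, auto simp: indicator_def)
    show "(\<integral>s. (K t s * indicator S (t, s))\<^sup>2 \<partial>tspace T) \<le> C"
      using bdd_kernelD(3,4)[OF K t] s
      by (intro order_trans[OF integral_mono bdd_kernelD(4)[OF K t]])
        (auto simp: indicator_def sqint_def)
  qed
  have col: "sqint (tspace T) (\<lambda>s. K s t * indicator S (s, t))"
    "(\<integral>s. (K s t * indicator S (s, t))\<^sup>2 \<partial>tspace T) \<le> C" if t: "t \<in> {0..T}" for t
  proof -
    show s: "sqint (tspace T) (\<lambda>s. K s t * indicator S (s, t))"
      using t by (intro sqint_bounded[OF bdd_kernelD(5)[OF K t]]) (measurable, auto simp: indicator_def)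
    show "(\<integral>s. (K s t * indicator S (s, t))\<^sup>2 \<partial>tspace T) \<le> C"
      using bdd_kernelD(5,6)[OF K t] s
      by (intro order_trans[OF integral_mono bdd_kernelD(6)[OF K t]])
        (auto simp: indicator_def sqint_def)
  qed
  show ?thesis
    using meas row col bdd_kernelD(2)[OF K] by (auto simp: bdd_kernel_def)
qed

lemma kop_integrable:
  assumes "bdd_kernel T C K" "sqint (tspace T) f" "s \<in> {0..T}"
  shows "integrable (tspace T) (\<lambda>r. K s r * f r)"
  using assms by (intro sqint_mult) (auto dest: bdd_kernelD)

lemma kop_power2_le:
  assumes K: "bdd_kernel T C K" and f: "sqint (tspace T) f" and s: "s \<in> {0..T}"
  shows "(kop T K f s)\<^sup>2 \<le> C * (\<integral>r. (f r)\<^sup>2 \<partial>tspace T)"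
proof -
  have "(kop T K f s)\<^sup>2 \<le> (\<integral>r. (K s r)\<^sup>2 \<partial>tspace T) * (\<integral>r. (f r)\<^sup>2 \<partial>tspace T)"
    unfolding kop_eq using bdd_kernelD[OF K] s f by (intro sqint_cauchy_schwarz) auto
  also have "\<dots> \<le> C * (\<integral>r. (f r)\<^sup>2 \<partial>tspace T)"
    using bdd_kernelD[OF K] s by (intro mult_right_mono) auto
  finally show ?thesis .
qed

text \<open>For a path that is not square integrable the right-hand side is infinite, as
  \<open>C > 0\<close>. The estimate can thus be integrated over all scenarios without first
  discarding a null set.\<close>

lemma kop_power2_le_nn:
  assumes K: "bdd_kernel T C K" and f: "f \<in> borel_measurable (tspace T)" and s: "s \<in> {0..T}"
  shows "ennreal ((kop T K f s)\<^sup>2) \<le> ennreal C * (\<integral>\<^sup>+r. ennreal ((f r)\<^sup>2) \<partial>tspace T)"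
proof (cases "sqint (tspace T) f")
  case True
  have "ennreal ((kop T K f s)\<^sup>2) \<le> ennreal (C * (\<integral>r. (f r)\<^sup>2 \<partial>tspace T))"
    by (intro ennreal_leI kop_power2_le[OF K True s])
  also have "\<dots> = ennreal C * (\<integral>\<^sup>+r. ennreal ((f r)\<^sup>2) \<partial>tspace T)"
    using True bdd_kernelD(2)[OF K]
    by (subst nn_integral_eq_integral) (auto simp: sqint_def ennreal_mult')
  finally show ?thesis .
next
  case False
  then have "(\<integral>\<^sup>+r. ennreal ((f r)\<^sup>2) \<partial>tspace T) = \<infinity>"
    using f by (auto simp: sqint_iff_nn not_less top_unique)
  then show ?thesis
    using bdd_kernelD(2)[OF K] by (simp add: ennreal_mult_top)
qed

lemma kop_measurable:
  assumes "case_prod K \<in> borel_measurable (tspace T \<Otimes>\<^sub>M tspace T)"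
    and "case_prod u \<in> borel_measurable (tspace T \<Otimes>\<^sub>M M)"
  shows "(\<lambda>(s, \<omega>). kop T K (\<lambda>r. u r \<omega>) s) \<in> borel_measurable (tspace T \<Otimes>\<^sub>M M)"
proof -
  interpret sigma_finite_measure "tspace T" by (rule sigma_finite_tspace)
  note [measurable] = assms
  show ?thesis unfolding kop_eq by measurable
qed

lemma kop_measurable1:
  assumes "case_prod K \<in> borel_measurable (tspace T \<Otimes>\<^sub>M tspace T)"
    and "f \<in> borel_measurable (tspace T)"
  shows "kop T K f \<in> borel_measurable (tspace T)"
proof -
  interpret sigma_finite_measure "tspace T" by (rule sigma_finite_tspace)
  note [measurable] = assms
  show ?thesis unfolding kop_eq[abs_def] by measurable
qed

lemma sqint_kop:
  assumes K: "bdd_kernel T C K" and f: "sqint (tspace T) f"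
  shows "sqint (tspace T) (kop T K f)"
proof -
  interpret finite_measure "tspace T" by (rule finite_measure_tspace)
  have [measurable]: "kop T K f \<in> borel_measurable (tspace T)"
    using bdd_kernelD(1)[OF K] sqint_meas[OF f] by (rule kop_measurable1)
  have "AE x in tspace T. norm ((kop T K f x)\<^sup>2) \<le> C * (\<integral>r. (f r)\<^sup>2 \<partial>tspace T)"
    using kop_power2_le[OF K f] by (auto intro!: AE_I2)
  then show ?thesis
    unfolding sqint_def by (auto intro!: integrable_const_bound)
qed

lemma kop_add:
  assumes "bdd_kernel T C K" "sqint (tspace T) f" "sqint (tspace T) g" "s \<in> {0..T}"
  shows "kop T K (\<lambda>r. f r + g r) s = kop T K f s + kop T K g s"
  unfolding kop_eq using assms kop_integrable by (simp add: distrib_left)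

lemma kop_cmult: "kop T K (\<lambda>r. c * f r) s = c * kop T K f s"
  unfolding kop_eq by (simp add: mult.left_commute[of _ c])

lemma kop_kernel_add:
  assumes "bdd_kernel T C K" "bdd_kernel T D L" "sqint (tspace T) f" "s \<in> {0..T}"
  shows "kop T (\<lambda>s r. K s r + L s r) f s = kop T K f s + kop T L f s"
  unfolding kop_eq using assms kop_integrable by (simp add: distrib_right)

text \<open>The inner integral of absolute values is |f| times the kernel operator of |K| at |g|, so
  the L2 bound on \<open>kop\<close> justifies Fubini.\<close>

lemma kernel_integrable2:
  assumes K: "bdd_kernel T C K" and f: "sqint (tspace T) f" and g: "sqint (tspace T) g"
  shows "integrable (tspace T \<Otimes>\<^sub>M tspace T) (\<lambda>(s, r). f s * K s r * g r)"
proof -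
  interpret finite_measure "tspace T" by (rule finite_measure_tspace)
  interpret pair_sigma_finite "tspace T" "tspace T" ..
  note [measurable] = bdd_kernelD(1)[OF K] sqint_meas[OF f] sqint_meas[OF g]
  have m: "(\<lambda>(s, r). f s * K s r * g r) \<in> borel_measurable (tspace T \<Otimes>\<^sub>M tspace T)"
    by measurable
  have ga: "sqint (tspace T) (\<lambda>r. \<bar>g r\<bar>)" and Ka: "bdd_kernel T C (\<lambda>s r. \<bar>K s r\<bar>)"
    using g K by (auto simp: sqint_def bdd_kernel_def)
  show ?thesis
  proof (rule Fubini_integrable[OF m])
    have "integrable (tspace T) (\<lambda>s. f s * kop T (\<lambda>s r. \<bar>K s r\<bar>) (\<lambda>r. \<bar>g r\<bar>) s)"
      by (intro sqint_mult f sqint_kop[OF Ka ga])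
    then have "integrable (tspace T) (\<lambda>s. \<bar>f s * kop T (\<lambda>s r. \<bar>K s r\<bar>) (\<lambda>r. \<bar>g r\<bar>) s\<bar>)"
      by (rule integrable_abs)
    then show "integrable (tspace T) (\<lambda>x. \<integral>y. norm (case (x, y) of (s, r) \<Rightarrow> f s * K s r * g r) \<partial>tspace T)"
      by (simp add: abs_mult kop_eq mult.assoc)
    show "AE x in tspace T. integrable (tspace T) (\<lambda>y. case (x, y) of (s, r) \<Rightarrow> f s * K s r * g r)"
      using kop_integrable[OF K g] by (auto intro!: AE_I2 simp: mult.assoc)
  qed
qed

lemma kop_duality:
  assumes K: "bdd_kernel T C K" and f: "sqint (tspace T) f" and g: "sqint (tspace T) g"
  shows "(\<integral>s. f s * kop T K g s \<partial>tspace T) = (\<integral>s. kop T (\<lambda>s r. K r s) f s * g s \<partial>tspace T)"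
proof -
  interpret finite_measure "tspace T" by (rule finite_measure_tspace)
  interpret pair_sigma_finite "tspace T" "tspace T" ..
  have "(\<integral>s. f s * kop T K g s \<partial>tspace T) = (\<integral>s. \<integral>r. f s * K s r * g r \<partial>tspace T \<partial>tspace T)"
    unfolding kop_eq by (simp add: mult.assoc)
  also have "\<dots> = (\<integral>r. \<integral>s. f s * K s r * g r \<partial>tspace T \<partial>tspace T)"
    using Fubini_integral[of "\<lambda>s r. f s * K s r * g r"] kernel_integrable2[OF K f g] by simp
  also have "\<dots> = (\<integral>s. kop T (\<lambda>s r. K r s) f s * g s \<partial>tspace T)"
    unfolding kop_eq by (simp add: mult.commute[of "f _"])
  finally show ?thesis .
qed

text \<open>The working form of \<open>admissible_kernel\<close>. Positivity is stated for the
  one-sided form; by \<open>kop_duality\<close> the symmetrised form is twice it.\<close>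

definition vkernel :: "real \<Rightarrow> real \<Rightarrow> (real \<Rightarrow> real \<Rightarrow> real) \<Rightarrow> bool" where
  "vkernel T C K \<longleftrightarrow> bdd_kernel T C K \<and> (\<forall>t\<in>{0..T}. \<forall>s\<in>{0..T}. t \<le> s \<longrightarrow> K t s = 0) \<and>
     (\<forall>f. sqint (tspace T) f \<longrightarrow> 0 \<le> (\<integral>s. f s * kop T K f s \<partial>tspace T))"

lemma vkernelD:
  assumes "vkernel T C K"
  shows "bdd_kernel T C K" "t \<in> {0..T} \<Longrightarrow> s \<in> {0..T} \<Longrightarrow> t \<le> s \<Longrightarrow> K t s = 0"
    "sqint (tspace T) f \<Longrightarrow> 0 \<le> (\<integral>s. f s * kop T K f s \<partial>tspace T)"
  using assms by (auto simp: vkernel_def)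

lemma vkernel_add:
  assumes K: "vkernel T C K" and L: "vkernel T D L"
  shows "vkernel T (2 * (C + D)) (\<lambda>s r. K s r + L s r)"
  unfolding vkernel_def
proof (intro conjI allI impI)
  note b = vkernelD(1)[OF K] vkernelD(1)[OF L]
  show "bdd_kernel T (2 * (C + D)) (\<lambda>s r. K s r + L s r)"
    by (intro bdd_kernel_add b)
  show "\<forall>t\<in>{0..T}. \<forall>s\<in>{0..T}. t \<le> s \<longrightarrow> K t s + L t s = 0"
    using assms by (auto simp: vkernel_def)
  fix f assume f: "sqint (tspace T) f"
  have "(\<integral>s. f s * kop T (\<lambda>s r. K s r + L s r) f s \<partial>tspace T)
      = (\<integral>s. f s * kop T K f s + f s * kop T L f s \<partial>tspace T)"
    by (intro Bochner_Integration.integral_cong) (auto simp: kop_kernel_add[OF b f] distrib_left)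
  also have "\<dots> = (\<integral>s. f s * kop T K f s \<partial>tspace T) + (\<integral>s. f s * kop T L f s \<partial>tspace T)"
    by (intro Bochner_Integration.integral_add sqint_mult f sqint_kop[OF b(1)] sqint_kop[OF b(2)])
  finally show "0 \<le> (\<integral>s. f s * kop T (\<lambda>s r. K s r + L s r) f s \<partial>tspace T)"
    using vkernelD(3)[OF K f] vkernelD(3)[OF L f] by simp
qed

lemma admissible_kernel_vkernel:
  assumes A: "admissible_kernel T G"
  obtains C where "vkernel T C G"
proof -
  obtain C where C: "\<And>t. t \<in> {0..T} \<Longrightarrow> (\<integral>\<^sup>+ s. ennreal ((G t s)\<^sup>2) \<partial>tspace T) \<le> ennreal C"
    "\<And>s. s \<in> {0..T} \<Longrightarrow> (\<integral>\<^sup>+ t. ennreal ((G t s)\<^sup>2) \<partial>tspace T) \<le> ennreal C"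
    using A unfolding admissible_kernel_def nn_integral_tspace by blast
  have "(\<lambda>(t, s). G t s) \<in> borel_measurable (restrict_space (lborel \<Otimes>\<^sub>M lborel) ({0..T} \<times> {0..T}))"
    using A unfolding admissible_kernel_def set_borel_measurable_def
    by (subst borel_measurable_restrict_space_iff) auto
  moreover have "(\<lambda>x. x) \<in> measurable (tspace T \<Otimes>\<^sub>M tspace T) (restrict_space (lborel \<Otimes>\<^sub>M lborel) ({0..T} \<times> {0..T}))"
  proof (rule measurable_restrict_space2)
    have [measurable]: "(\<lambda>x. x) \<in> measurable (tspace T) lborel"
      unfolding tspace_def by (intro measurable_restrict_space1) simp
    have "(\<lambda>x. (fst x, snd x)) \<in> measurable (tspace T \<Otimes>\<^sub>M tspace T) (lborel \<Otimes>\<^sub>M lborel)"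
      by (intro measurable_Pair measurable_compose[OF measurable_fst] measurable_compose[OF measurable_snd]) measurable
    then show "(\<lambda>x. x) \<in> measurable (tspace T \<Otimes>\<^sub>M tspace T) (lborel \<Otimes>\<^sub>M lborel)"
      by simp
  qed (auto simp: space_pair_measure)
  ultimately have meas[measurable]: "case_prod G \<in> borel_measurable (tspace T \<Otimes>\<^sub>M tspace T)"
    using measurable_compose[of "\<lambda>x. x"] by fastforce
  \<comment> \<open>The constant of the assumption may be zero or negative, whereas
    \<open>bdd_kernel\<close> wants a positive one.\<close>
  define D where "D = max C 1"
  have CD: "ennreal C \<le> ennreal D" and D: "D > 0"
    by (auto simp: D_def intro: ennreal_leI)
  have bd: "sqint (tspace T) f \<and> (\<integral>s. (f s)\<^sup>2 \<partial>tspace T) \<le> D"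
    if f: "f \<in> borel_measurable (tspace T)" and le: "(\<integral>\<^sup>+ s. ennreal ((f s)\<^sup>2) \<partial>tspace T) \<le> ennreal C" for f
  proof -
    have s: "sqint (tspace T) f"
      using f le by (auto simp: sqint_iff_nn intro: le_less_trans)
    moreover have "ennreal (\<integral>s. (f s)\<^sup>2 \<partial>tspace T) \<le> ennreal D"
      using order_trans[OF le CD] s by (subst (asm) nn_integral_eq_integral) (auto simp: sqint_def)
    ultimately show ?thesis using D by (subst (asm) ennreal_le_iff) auto
  qed
  have K: "bdd_kernel T D G"
    unfolding bdd_kernel_def using bd C D meas by auto
  have "vkernel T D G"
    unfolding vkernel_def
  proof (intro conjI allI impI)
    show "\<forall>t\<in>{0..T}. \<forall>s\<in>{0..T}. t \<le> s \<longrightarrow> G t s = 0"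
      using A by (simp add: admissible_kernel_def)
    fix f assume f: "sqint (tspace T) f"
    \<comment> \<open>The assumed form is split into the kernel and its transpose, which contribute
      equally by duality.\<close>
    have "0 \<le> (LINT t:{0..T}|lborel. LINT s:{0..T}|lborel. (G t s + G s t) * f s * f t)"
      using A f unfolding admissible_kernel_def L2on_iff_sqint by blast
    also have "\<dots> = (\<integral>t. f t * kop T G f t + f t * kop T (\<lambda>s r. G r s) f t \<partial>tspace T)"
      unfolding set_integral_tspace
    proof (intro Bochner_Integration.integral_cong refl)
      fix t assume "t \<in> space (tspace T)"
      then have t: "t \<in> {0..T}" by simp
      show "(\<integral>s. (G t s + G s t) * f s * f t \<partial>tspace T) = f t * kop T G f t + f t * kop T (\<lambda>s r. G r s) f t"
        using kop_kernel_add[OF K bdd_kernel_transpose[OF K] f t]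
        by (simp add: kop_eq distrib_left[symmetric] mult.commute)
    qed
    also have "\<dots> = (\<integral>t. f t * kop T G f t \<partial>tspace T) + (\<integral>t. f t * kop T (\<lambda>s r. G r s) f t \<partial>tspace T)"
      by (intro Bochner_Integration.integral_add sqint_mult f sqint_kop[OF K] sqint_kop[OF bdd_kernel_transpose[OF K]])
    also have "(\<integral>t. f t * kop T (\<lambda>s r. G r s) f t \<partial>tspace T) = (\<integral>t. f t * kop T G f t \<partial>tspace T)"
      using kop_duality[OF K f f] by (simp add: mult.commute)
    finally show "0 \<le> (\<integral>s. f s * kop T G f s \<partial>tspace T)" by simp
  qed (rule K)
  then show thesis by (rule that)
qed

section \<open>The operator frozen at time t and its inverse\<close>

definition Hker :: "(real \<Rightarrow> real \<Rightarrow> real) \<Rightarrow> real \<Rightarrow> real \<Rightarrow> real \<Rightarrow> real" where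
  "Hker K t s r = K s r * indicator {t..} r + K r s * indicator {t..} s"

lemma Hker_sym: "Hker K t r s = Hker K t s r"
  by (simp add: Hker_def)

lemma Dop_eq: "Dop T lam K t f s = 2 * lam * f s + kop T (Hker K t) f s"
  unfolding Dop_def Hker_def kop_eq set_integral_tspace by simp

lemma tspace_half_sets:
  "{(s, r). s \<in> {0..T} \<and> r \<in> {0..T} \<and> t \<le> r} \<in> sets (tspace T \<Otimes>\<^sub>M tspace T)"
proof -
  note [measurable] = measurable_tspace_id
  have "{x \<in> space (tspace T \<Otimes>\<^sub>M tspace T). t \<le> snd x} \<in> sets (tspace T \<Otimes>\<^sub>M tspace T)"
    by measurable
  then show ?thesis
    by (rule back_subst[of "\<lambda>A. A \<in> sets _"]) (auto simp: space_pair_measure)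
qed

text \<open>Kernels matter only on [0,T] x [0,T]; \<open>Hker\<close> agrees with its cut form only
  there.\<close>

lemma bdd_kernel_cong:
  assumes "bdd_kernel T C K" "\<And>s r. s \<in> {0..T} \<Longrightarrow> r \<in> {0..T} \<Longrightarrow> K s r = L s r"
  shows "bdd_kernel T C L"
proof -
  have eq: "sqint (tspace T) f \<longleftrightarrow> sqint (tspace T) g" if "\<And>x. x \<in> {0..T} \<Longrightarrow> f x = g x" for f g
    unfolding sqint_def using that measurable_cong[of "tspace T" f g]
      Bochner_Integration.integrable_cong[of "tspace T" "tspace T" "\<lambda>x. (f x)\<^sup>2" "\<lambda>x. (g x)\<^sup>2"]
    by simp
  have 1: "sqint (tspace T) (K s) = sqint (tspace T) (L s)"
    "sqint (tspace T) (\<lambda>r. K r s) = sqint (tspace T) (\<lambda>r. L r s)" if "s \<in> {0..T}" for s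
    using assms(2) that by (auto intro!: eq)
  have 2: "(\<integral>r. (K s r)\<^sup>2 \<partial>tspace T) = (\<integral>r. (L s r)\<^sup>2 \<partial>tspace T)"
    "(\<integral>r. (K r s)\<^sup>2 \<partial>tspace T) = (\<integral>r. (L r s)\<^sup>2 \<partial>tspace T)" if "s \<in> {0..T}" for s
    using assms(2) that by (auto intro!: Bochner_Integration.integral_cong)
  have "case_prod L \<in> borel_measurable (tspace T \<Otimes>\<^sub>M tspace T)"
    using assms(2) by (subst measurable_cong[of _ _ "case_prod K"]) (auto simp: space_pair_measure bdd_kernelD(1)[OF assms(1)])
  then show ?thesis
    using assms(1) 1 2 unfolding bdd_kernel_def by auto
qed

lemma bdd_kernel_Hker:
  assumes K: "bdd_kernel T C K"
  shows "bdd_kernel T (4 * C) (Hker K t)"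
proof -
  let ?S = "{(s, r). s \<in> {0..T} \<and> r \<in> {0..T} \<and> t \<le> r}"
  have c: "bdd_kernel T C (\<lambda>s r. K s r * indicator ?S (s, r))"
    by (rule bdd_kernel_cut[OF K tspace_half_sets])
  have "bdd_kernel T (2 * (C + C)) (\<lambda>s r. K s r * indicator ?S (s, r) + K r s * indicator ?S (r, s))"
    by (rule bdd_kernel_add[OF c bdd_kernel_transpose[OF c]])
  then have "bdd_kernel T (2 * (C + C)) (Hker K t)"
    by (rule bdd_kernel_cong) (auto simp: Hker_def indicator_def)
  then show ?thesis by simp
qed

lemma sqint_tail:
  assumes "sqint (tspace T) f"
  shows "sqint (tspace T) (\<lambda>s. indicator {t..} s * f s)"
proof -
  have [measurable]: "(indicator {t..} :: real \<Rightarrow> real) \<in> borel_measurable (tspace T)"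
    by (rule borel_measurable_tspace) simp
  note [measurable] = sqint_meas[OF assms]
  show ?thesis
    by (rule sqint_bounded[OF assms]) (measurable, auto simp: indicator_def)
qed

text \<open>By the Volterra property the two indicators in \<open>Hker\<close> amount to cutting K
  plus its transpose down to the square [t,T] x [t,T]. Its form at f is therefore the full
  symmetrised form at the tail of f, which is nonnegative.\<close>

lemma Hker_psd:
  assumes K: "vkernel T C K" and f: "sqint (tspace T) f"
  shows "0 \<le> (\<integral>s. f s * kop T (Hker K t) f s \<partial>tspace T)"
proof -
  let ?g = "\<lambda>s. indicator {t..} s * f s"
  have g: "sqint (tspace T) ?g" by (rule sqint_tail[OF f])
  note b = vkernelD(1)[OF K] and bt = bdd_kernel_transpose[OF vkernelD(1)[OF K]]
  have "(\<integral>s. f s * kop T (Hker K t) f s \<partial>tspace T)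
     = (\<integral>s. ?g s * kop T K ?g s + ?g s * kop T (\<lambda>s r. K r s) ?g s \<partial>tspace T)"
  proof (intro Bochner_Integration.integral_cong refl)
    fix s assume "s \<in> space (tspace T)"
    then have s: "s \<in> {0..T}" by simp
    have "kop T (Hker K t) f s = indicator {t..} s * kop T (\<lambda>s r. K s r + K r s) ?g s"
      unfolding kop_eq integral_mult_right_zero[symmetric]
    proof (intro Bochner_Integration.integral_cong refl)
      fix r assume "r \<in> space (tspace T)"
      then show "Hker K t s r * f r = indicator {t..} s * ((K s r + K r s) * (indicator {t..} r * f r))"
        using vkernelD(2)[OF K s, of r] vkernelD(2)[OF K _ s, of r]
        by (cases "s \<le> r") (auto simp: Hker_def indicator_def)
    qed
    then show "f s * kop T (Hker K t) f s = ?g s * kop T K ?g s + ?g s * kop T (\<lambda>s r. K r s) ?g s"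
      using kop_kernel_add[OF b bt g s] by (simp add: algebra_simps)
  qed
  also have "\<dots> = (\<integral>s. ?g s * kop T K ?g s \<partial>tspace T) + (\<integral>s. ?g s * kop T (\<lambda>s r. K r s) ?g s \<partial>tspace T)"
    by (intro Bochner_Integration.integral_add sqint_mult g sqint_kop[OF b] sqint_kop[OF bt])
  also have "(\<integral>s. ?g s * kop T (\<lambda>s r. K r s) ?g s \<partial>tspace T) = (\<integral>s. ?g s * kop T K ?g s \<partial>tspace T)"
    using kop_duality[OF b g g] by (simp add: mult.commute mult.left_commute)
  finally show ?thesis using vkernelD(3)[OF K g] by simp
qed

lemma sqint_Dop:
  assumes "bdd_kernel T C K" "sqint (tspace T) f"
  shows "sqint (tspace T) (Dop T lam K t f)"
  unfolding Dop_eq[abs_def] using assms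
  by (intro sqint_add sqint_cmult sqint_kop[OF bdd_kernel_Hker]) auto

lemma Dop_selfadjoint:
  assumes K: "bdd_kernel T C K" and f: "sqint (tspace T) f" and g: "sqint (tspace T) g"
  shows "(\<integral>s. f s * Dop T lam K t g s \<partial>tspace T) = (\<integral>s. Dop T lam K t f s * g s \<partial>tspace T)"
proof -
  note H = bdd_kernel_Hker[OF K, of t]
  have i: "integrable (tspace T) (\<lambda>s. f s * g s)" "integrable (tspace T) (\<lambda>s. f s * kop T (Hker K t) g s)"
    "integrable (tspace T) (\<lambda>s. kop T (Hker K t) f s * g s)"
    by (intro sqint_mult f g sqint_kop[OF H])+
  have "(\<integral>s. f s * Dop T lam K t g s \<partial>tspace T)
      = (\<integral>s. 2 * lam * (f s * g s) + f s * kop T (Hker K t) g s \<partial>tspace T)"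
    by (simp add: Dop_eq distrib_left mult_ac)
  also have "\<dots> = 2 * lam * (\<integral>s. f s * g s \<partial>tspace T) + (\<integral>s. f s * kop T (Hker K t) g s \<partial>tspace T)"
    using i by simp
  also have "(\<integral>s. f s * kop T (Hker K t) g s \<partial>tspace T) = (\<integral>s. kop T (Hker K t) f s * g s \<partial>tspace T)"
    using kop_duality[OF H f g] by (simp add: Hker_sym cong: kop_eq)
  also have "2 * lam * (\<integral>s. f s * g s \<partial>tspace T) + \<dots>
      = (\<integral>s. 2 * lam * (f s * g s) + kop T (Hker K t) f s * g s \<partial>tspace T)"
    using i by simp
  also have "\<dots> = (\<integral>s. Dop T lam K t f s * g s \<partial>tspace T)"
    by (simp add: Dop_eq algebra_simps)
  finally show ?thesis .
qed

lemma Dop_coercive: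
  assumes K: "vkernel T C K" and f: "sqint (tspace T) f"
  shows "2 * lam * (\<integral>s. (f s)\<^sup>2 \<partial>tspace T) \<le> (\<integral>s. f s * Dop T lam K t f s \<partial>tspace T)"
proof -
  note H = bdd_kernel_Hker[OF vkernelD(1)[OF K], of t]
  have i: "integrable (tspace T) (\<lambda>s. (f s)\<^sup>2)" "integrable (tspace T) (\<lambda>s. f s * kop T (Hker K t) f s)"
    using f sqint_mult[OF f sqint_kop[OF H f]] by (auto simp: sqint_def)
  have "(\<integral>s. f s * Dop T lam K t f s \<partial>tspace T)
      = (\<integral>s. 2 * lam * (f s)\<^sup>2 + f s * kop T (Hker K t) f s \<partial>tspace T)"
    by (simp add: Dop_eq algebra_simps power2_eq_square)
  also have "\<dots> = 2 * lam * (\<integral>s. (f s)\<^sup>2 \<partial>tspace T) + (\<integral>s. f s * kop T (Hker K t) f s \<partial>tspace T)"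
    using i by simp
  finally show ?thesis using Hker_psd[OF K f, of t] by simp
qed

lemma Dop_add:
  assumes "bdd_kernel T C K" "sqint (tspace T) f" "sqint (tspace T) g" "s \<in> {0..T}"
  shows "Dop T lam K t (\<lambda>r. f r + g r) s = Dop T lam K t f s + Dop T lam K t g s"
  unfolding Dop_eq using assms by (simp add: kop_add[OF bdd_kernel_Hker] algebra_simps)

lemma Dop_cmult: "Dop T lam K t (\<lambda>r. c * f r) s = c * Dop T lam K t f s"
  unfolding Dop_eq by (simp add: kop_cmult algebra_simps)

lemma sqint_zero_AE:
  assumes "sqint N f" "(\<integral>x. f x * f x \<partial>N) = 0"
  shows "AE x in N. f x = 0"
  using assms integral_nonneg_eq_0_iff_AE[of N "\<lambda>x. f x * f x"] sqint_mult[OF assms(1) assms(1)] by simp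

text \<open>Existence is variational, on the whole of L2. The weak equation becomes an almost
  everywhere identity by testing it with its own residual, which is again square integrable.\<close>

lemma Dop_solvable:
  assumes K: "vkernel T C K" and lam: "lam > 0" and g: "sqint (tspace T) g"
  shows "\<exists>f. sqint (tspace T) f \<and> (AE s in tspace T. Dop T lam K t f s = g s)"
proof -
  interpret finite_measure "tspace T" by (rule finite_measure_tspace)
  note b = vkernelD(1)[OF K]
  let ?V = "{f. sqint (tspace T) f}"
  let ?a = "\<lambda>u w. \<integral>s. Dop T lam K t u s * w s \<partial>tspace T"
  have D: "sqint (tspace T) (Dop T lam K t f)" if "sqint (tspace T) f" for f
    using b that by (rule sqint_Dop)
  have Dsq: "(\<integral>s. (Dop T lam K t u s)\<^sup>2 \<partial>tspace T)
      \<le> (2 * (4 * lam\<^sup>2 + 4 * C * measure (tspace T) (space (tspace T)))) * (\<integral>s. (u s)\<^sup>2 \<partial>tspace T)"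
    if u: "sqint (tspace T) u" for u
  proof -
    have "(\<integral>s. (kop T (Hker K t) u s)\<^sup>2 \<partial>tspace T) \<le> (\<integral>s. 4 * C * (\<integral>s. (u s)\<^sup>2 \<partial>tspace T) \<partial>tspace T)"
      using kop_power2_le[OF bdd_kernel_Hker[OF b] u] sqint_kop[OF bdd_kernel_Hker[OF b] u]
      by (intro integral_mono) (auto simp: sqint_def)
    then have "(\<integral>s. (kop T (Hker K t) u s)\<^sup>2 \<partial>tspace T)
        \<le> 4 * C * measure (tspace T) (space (tspace T)) * (\<integral>s. (u s)\<^sup>2 \<partial>tspace T)"
      by (simp add: mult_ac)
    moreover have "(\<integral>s. (2 * lam * u s)\<^sup>2 \<partial>tspace T) \<le> 4 * lam\<^sup>2 * (\<integral>s. (u s)\<^sup>2 \<partial>tspace T)"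
      by (simp add: power_mult_distrib)
    ultimately show ?thesis
      using sqint_add_bound[OF sqint_cmult[OF u, of "2 * lam"] _ sqint_kop[OF bdd_kernel_Hker[OF b] u]]
      unfolding Dop_eq by (fastforce simp: algebra_simps)
  qed
  have "\<exists>u\<in>?V. \<forall>w\<in>?V. ?a u w = (\<integral>s. g s * w s \<partial>tspace T)"
  proof (rule symmetric_lax_milgram[where \<alpha> = "2 * lam"])
    fix u v w assume u: "u \<in> ?V" and v: "v \<in> ?V" and w: "w \<in> ?V"
    have "?a (\<lambda>x. u x + v x) w = (\<integral>s. Dop T lam K t u s * w s + Dop T lam K t v s * w s \<partial>tspace T)"
      using u v by (intro Bochner_Integration.integral_cong) (auto simp: Dop_add[OF b] algebra_simps)
    also have "\<dots> = ?a u w + ?a v w"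
      using u v w by (intro Bochner_Integration.integral_add sqint_mult D) auto
    finally show "?a (\<lambda>x. u x + v x) w = ?a u w + ?a v w" .
  next
    fix c u w assume "u \<in> ?V" "w \<in> ?V"
    show "?a (\<lambda>x. c * u x) w = c * ?a u w"
      by (simp add: Dop_cmult mult.assoc)
  next
    fix u w assume u: "u \<in> ?V" and w: "w \<in> ?V"
    then show "?a u w = ?a w u"
      using Dop_selfadjoint[OF b, of u w] by (simp add: mult.commute)
    have "(?a u w)\<^sup>2 \<le> (\<integral>s. (Dop T lam K t u s)\<^sup>2 \<partial>tspace T) * (\<integral>s. (w s)\<^sup>2 \<partial>tspace T)"
      using u w D by (intro sqint_cauchy_schwarz) auto
    also have "\<dots> \<le> ((2 * (4 * lam\<^sup>2 + 4 * C * measure (tspace T) (space (tspace T)))) * (\<integral>s. (u s)\<^sup>2 \<partial>tspace T))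
        * (\<integral>s. (w s)\<^sup>2 \<partial>tspace T)"
      using u Dsq by (intro mult_right_mono) auto
    finally show "(?a u w)\<^sup>2 \<le> (2 * (4 * lam\<^sup>2 + 4 * C * measure (tspace T) (space (tspace T))))
        * (\<integral>s. (u s)\<^sup>2 \<partial>tspace T) * (\<integral>s. (w s)\<^sup>2 \<partial>tspace T)" .
  next
    fix u assume "u \<in> ?V"
    then show "2 * lam * (\<integral>s. (u s)\<^sup>2 \<partial>tspace T) \<le> ?a u u"
      using Dop_coercive[OF K, of u lam t] by (simp add: mult.commute)
  qed (use lam g in \<open>auto intro: sqint_add sqint_cmult sqint_zero\<close>)
  then obtain u where u: "sqint (tspace T) u"
    and eq: "\<And>w. sqint (tspace T) w \<Longrightarrow> ?a u w = (\<integral>s. g s * w s \<partial>tspace T)" by auto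
  let ?d = "\<lambda>s. Dop T lam K t u s - g s"
  have d: "sqint (tspace T) ?d" by (intro sqint_diff D u g)
  have "(\<integral>s. ?d s * ?d s \<partial>tspace T) = (\<integral>s. Dop T lam K t u s * ?d s - g s * ?d s \<partial>tspace T)"
    by (simp add: algebra_simps)
  also have "\<dots> = 0"
    using eq[OF d] by (subst Bochner_Integration.integral_diff) (auto intro!: sqint_mult D u g d)
  finally have "AE s in tspace T. ?d s = 0"
    by (rule sqint_zero_AE[OF d])
  then show ?thesis using u by auto
qed

text \<open>The inverse is defined by choice; these two properties are all that is used of
  it.\<close>

lemma Dinv_spec:
  assumes "vkernel T C K" "lam > 0" "sqint (tspace T) g"
  shows "sqint (tspace T) (Dinv T lam K t g)"
    "AE s in tspace T. Dop T lam K t (Dinv T lam K t g) s = g s"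
  using someI_ex[OF Dop_solvable[OF assms, of t]]
  unfolding Dinv_def L2on_iff_sqint AE_tspace by blast+

text \<open>Coercivity bounds 2 lam |f|^2 by the pairing of f and g, and Young's inequality with
  weight lam absorbs half of it. The bound does not involve t.\<close>

lemma Dinv_norm_le:
  assumes K: "vkernel T C K" and lam: "lam > 0" and g: "sqint (tspace T) g"
  shows "(\<integral>s. (Dinv T lam K t g s)\<^sup>2 \<partial>tspace T) \<le> (\<integral>s. (g s)\<^sup>2 \<partial>tspace T) / (4 * lam\<^sup>2)"
proof -
  define f where "f = Dinv T lam K t g"
  note f = Dinv_spec[OF assms, of t, folded f_def]
  have i: "integrable (tspace T) (\<lambda>s. (f s)\<^sup>2)" "integrable (tspace T) (\<lambda>s. (g s)\<^sup>2)"
    using f(1) g by (auto simp: sqint_def)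
  have "2 * lam * (\<integral>s. (f s)\<^sup>2 \<partial>tspace T) \<le> (\<integral>s. f s * Dop T lam K t f s \<partial>tspace T)"
    by (rule Dop_coercive[OF K f(1)])
  also have "\<dots> = (\<integral>s. f s * g s \<partial>tspace T)"
    using f(2) sqint_meas[OF f(1)] sqint_meas[OF g] sqint_meas[OF sqint_Dop[OF vkernelD(1)[OF K] f(1)]]
    by (intro integral_cong_AE) auto
  also have "\<dots> \<le> (\<integral>s. lam * (f s)\<^sup>2 + (1 / (4 * lam)) * (g s)\<^sup>2 \<partial>tspace T)"
  proof (rule integral_mono)
    show "integrable (tspace T) (\<lambda>s. f s * g s)" by (intro sqint_mult f g)
    show "integrable (tspace T) (\<lambda>s. lam * (f s)\<^sup>2 + (1 / (4 * lam)) * (g s)\<^sup>2)"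
      using i by (intro Bochner_Integration.integrable_add integrable_mult_right) auto
    fix s
    have "0 \<le> (2 * lam * f s - g s)\<^sup>2 / (4 * lam)" using lam by simp
    then show "f s * g s \<le> lam * (f s)\<^sup>2 + (1 / (4 * lam)) * (g s)\<^sup>2"
      using lam by (simp add: power2_eq_square field_simps)
  qed
  also have "\<dots> = lam * (\<integral>s. (f s)\<^sup>2 \<partial>tspace T) + (1 / (4 * lam)) * (\<integral>s. (g s)\<^sup>2 \<partial>tspace T)"
    using i by simp
  finally show ?thesis
    using lam by (simp add: f_def field_simps power2_eq_square)
qed

text \<open>Since the operator is self-adjoint, pairing with \<open>phi\<close> replaces the inverse applied to scenario-dependent
  data by a fixed function; in particular it yields measurability of \<open>Bker\<close> in its second argument.\<close>

definition phi :: "real \<Rightarrow> real \<Rightarrow> (real \<Rightarrow> real \<Rightarrow> real) \<Rightarrow> real \<Rightarrow> real \<Rightarrow> real" where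
  "phi T lam K t = Dinv T lam K t (\<lambda>r. indicator {t..} r * K r t)"

text \<open>\<open>Dop_phi\<close> moves the self-adjoint operator onto \<open>phi\<close>, where it
  returns the cut column of K; taking f to be the inverse of g gives \<open>ipT_Dinv\<close>. The
  bound on \<open>phi\<close> is uniform in t because the column bound of K is.\<close>

lemma
  assumes K: "vkernel T C K" and lam: "lam > 0" and t: "t \<in> {0..T}"
  shows sqint_phi: "sqint (tspace T) (phi T lam K t)"
    and phi_norm_le: "(\<integral>s. (phi T lam K t s)\<^sup>2 \<partial>tspace T) \<le> C / (4 * lam\<^sup>2)"
    and Dop_phi: "sqint (tspace T) f \<Longrightarrow>
      (\<integral>s. phi T lam K t s * Dop T lam K t f s \<partial>tspace T) = (\<integral>s. indicator {t..} s * K s t * f s \<partial>tspace T)"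
    and ipT_Dinv: "sqint (tspace T) g \<Longrightarrow>
      ipT T (\<lambda>r. indicator {t..} r * K r t) (Dinv T lam K t g) = (\<integral>s. phi T lam K t s * g s \<partial>tspace T)"
proof -
  note b = bdd_kernelD[OF vkernelD(1)[OF K]]
  let ?k = "\<lambda>r. indicator {t..} r * K r t"
  have k: "sqint (tspace T) ?k"
    by (rule sqint_tail[OF b(5)[OF t]])
  show p: "sqint (tspace T) (phi T lam K t)"
    unfolding phi_def by (rule Dinv_spec(1)[OF K lam k])
  have "(\<integral>s. (?k s)\<^sup>2 \<partial>tspace T) \<le> (\<integral>s. (K s t)\<^sup>2 \<partial>tspace T)"
    using k b(5)[OF t] by (intro integral_mono) (auto simp: sqint_def indicator_def)
  then have "(\<integral>s. (?k s)\<^sup>2 \<partial>tspace T) / (4 * lam\<^sup>2) \<le> C / (4 * lam\<^sup>2)"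
    using b(6)[OF t] by (intro divide_right_mono) auto
  then show "(\<integral>s. (phi T lam K t s)\<^sup>2 \<partial>tspace T) \<le> C / (4 * lam\<^sup>2)"
    unfolding phi_def using Dinv_norm_le[OF K lam k, of t] by linarith
  show D: "(\<integral>s. phi T lam K t s * Dop T lam K t f s \<partial>tspace T) = (\<integral>s. ?k s * f s \<partial>tspace T)"
    if f: "sqint (tspace T) f" for f
  proof -
    have "(\<integral>s. phi T lam K t s * Dop T lam K t f s \<partial>tspace T) = (\<integral>s. Dop T lam K t (phi T lam K t) s * f s \<partial>tspace T)"
      by (rule Dop_selfadjoint[OF vkernelD(1)[OF K] p f])
    also have "\<dots> = (\<integral>s. ?k s * f s \<partial>tspace T)"
      using Dinv_spec(2)[OF K lam k, of t, folded phi_def] sqint_meas[OF f] sqint_meas[OF k]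
        sqint_meas[OF sqint_Dop[OF vkernelD(1)[OF K] p]]
      by (intro integral_cong_AE) auto
    finally show ?thesis .
  qed
  show "ipT T ?k (Dinv T lam K t g) = (\<integral>s. phi T lam K t s * g s \<partial>tspace T)"
    if g: "sqint (tspace T) g" for g
  proof -
    note f = Dinv_spec[OF K lam g, of t]
    have "ipT T ?k (Dinv T lam K t g) = (\<integral>s. phi T lam K t s * Dop T lam K t (Dinv T lam K t g) s \<partial>tspace T)"
      unfolding ipT_eq by (rule D[OF f(1), symmetric])
    also have "\<dots> = (\<integral>s. phi T lam K t s * g s \<partial>tspace T)"
      using f(2) sqint_meas[OF p] sqint_meas[OF g] sqint_meas[OF sqint_Dop[OF vkernelD(1)[OF K] f(1)]]
      by (intro integral_cong_AE) auto
    finally show ?thesis .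
  qed
qed

section \<open>The resolvent kernel\<close>

lemma Bker_eq:
  assumes K: "vkernel T C K" and lam: "lam > 0" and t: "t \<in> {0..T}" and s: "s \<in> {0..T}" and st: "s \<le> t"
  shows "Bker T lam K t s =
    (1 / (2 * lam)) * ((\<integral>r. phi T lam K t r * (indicator {t..} r * K r s) \<partial>tspace T) - K t s)"
  unfolding Bker_def
  using st ipT_Dinv[OF K lam t sqint_tail[OF bdd_kernelD(5)[OF vkernelD(1)[OF K] s]], of t] by simp

text \<open>The row bound, uniform in t, is the input of the Gronwall argument. Its constant
  collects Cauchy-Schwarz for the pairing with \<open>phi\<close>, which gives C / (4 lam^2) times
  C, the inequality (x - y)^2 \<le> 2 x^2 + 2 y^2, and the prefactor 1 / (4 lam^2), integrated over
  [0,T].\<close>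

lemma
  assumes K: "vkernel T C K" and lam: "lam > 0" and t: "t \<in> {0..T}"
  shows sqint_Bker: "sqint (tspace T) (Bker T lam K t)"
    and Bker_norm_le: "(\<integral>s. (Bker T lam K t s)\<^sup>2 \<partial>tspace T) \<le> (C\<^sup>2 * T / (4 * lam\<^sup>2) + C) / (2 * lam\<^sup>2)"
proof -
  interpret finite_measure "tspace T" by (rule finite_measure_tspace)
  note b = bdd_kernelD[OF vkernelD(1)[OF K]]
  note p = sqint_phi[OF assms]
  note [measurable] = b(1) sqint_meas[OF p]
  let ?i = "\<lambda>s. \<integral>r. phi T lam K t r * (indicator {t..} r * K r s) \<partial>tspace T"
  let ?B = "\<lambda>s. (1 / (2 * lam)) * (?i s - K t s) * indicator {..t} s"
  have [measurable]: "(indicator {..t} :: real \<Rightarrow> real) \<in> borel_measurable (tspace T)"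
    "(indicator {t..} :: real \<Rightarrow> real) \<in> borel_measurable (tspace T)"
    by (auto intro: borel_measurable_tspace)
  have [measurable]: "K t \<in> borel_measurable (tspace T)"
    using b(3)[OF t] by (rule sqint_meas)
  have Bm: "?B \<in> borel_measurable (tspace T)"
    by measurable
  have eq: "Bker T lam K t s = ?B s" if "s \<in> {0..T}" for s
    using Bker_eq[OF K lam t that] by (cases "s \<le> t") (auto simp: Bker_def)
  have m: "Bker T lam K t \<in> borel_measurable (tspace T)"
    using Bm by (subst measurable_cong[where g = ?B]) (auto simp: eq)
  have isq: "(?i s)\<^sup>2 \<le> C / (4 * lam\<^sup>2) * C" if s: "s \<in> {0..T}" for s
  proof -
    have k: "sqint (tspace T) (\<lambda>r. indicator {t..} r * K r s)"
      by (rule sqint_tail[OF b(5)[OF s]])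
    have kle: "(\<integral>r. (indicator {t..} r * K r s)\<^sup>2 \<partial>tspace T) \<le> C"
      using k b(5)[OF s]
      by (intro order_trans[OF integral_mono b(6)[OF s]]) (auto simp: sqint_def indicator_def)
    have "(?i s)\<^sup>2 \<le> (\<integral>r. (phi T lam K t r)\<^sup>2 \<partial>tspace T) * (\<integral>r. (indicator {t..} r * K r s)\<^sup>2 \<partial>tspace T)"
      by (rule sqint_cauchy_schwarz[OF p k])
    also have "\<dots> \<le> C / (4 * lam\<^sup>2) * C"
      using phi_norm_le[OF assms] kle b(2) by (intro mult_mono) auto
    finally show ?thesis .
  qed
  have pt: "(Bker T lam K t s)\<^sup>2 \<le> (C\<^sup>2 / (4 * lam\<^sup>2) + (K t s)\<^sup>2) / (2 * lam\<^sup>2)" if s: "s \<in> {0..T}" for s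
  proof (cases "s \<le> t")
    case True
    have "(?i s - K t s)\<^sup>2 \<le> 2 * (?i s)\<^sup>2 + 2 * (K t s)\<^sup>2"
      using zero_le_power2[of "?i s + K t s"] by (simp add: power2_eq_square algebra_simps)
    also have "\<dots> \<le> 2 * (C\<^sup>2 / (4 * lam\<^sup>2) + (K t s)\<^sup>2)"
      using isq[OF s] by (simp add: power2_eq_square)
    finally have "(?i s - K t s)\<^sup>2 / (4 * lam\<^sup>2) \<le> 2 * (C\<^sup>2 / (4 * lam\<^sup>2) + (K t s)\<^sup>2) / (4 * lam\<^sup>2)"
      by (intro divide_right_mono) auto
    moreover have "2 * X / (4 * lam\<^sup>2) = X / (2 * lam\<^sup>2)" for X
      using lam by (simp add: field_simps)
    ultimately have "(?i s - K t s)\<^sup>2 / (4 * lam\<^sup>2) \<le> (C\<^sup>2 / (4 * lam\<^sup>2) + (K t s)\<^sup>2) / (2 * lam\<^sup>2)"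
      by (simp only:)
    then show ?thesis
      using Bker_eq[OF K lam t s True] by (simp add: power_mult_distrib power_divide)
  next
    case False
    then show ?thesis by (auto simp: Bker_def intro!: divide_nonneg_nonneg add_nonneg_nonneg)
  qed
  have i: "integrable (tspace T) (\<lambda>s. (C\<^sup>2 / (4 * lam\<^sup>2) + (K t s)\<^sup>2) / (2 * lam\<^sup>2))"
    using b(3)[OF t] by (auto simp: sqint_def)
  show s: "sqint (tspace T) (Bker T lam K t)"
    unfolding sqint_def
    using m pt by (auto intro!: Bochner_Integration.integrable_bound[OF i] AE_I2
        order_trans[OF pt abs_ge_self])
  have mT: "measure (tspace T) {0..T} = T"
    using t by (simp add: tspace_def measure_restrict_space)
  have "(\<integral>s. (Bker T lam K t s)\<^sup>2 \<partial>tspace T) \<le> (\<integral>s. (C\<^sup>2 / (4 * lam\<^sup>2) + (K t s)\<^sup>2) / (2 * lam\<^sup>2) \<partial>tspace T)"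
    using s i pt by (intro integral_mono) (auto simp: sqint_def)
  also have "\<dots> = (C\<^sup>2 * T / (4 * lam\<^sup>2) + (\<integral>s. (K t s)\<^sup>2 \<partial>tspace T)) / (2 * lam\<^sup>2)"
    using b(3)[OF t] mT by (simp add: sqint_def)
  also have "\<dots> \<le> (C\<^sup>2 * T / (4 * lam\<^sup>2) + C) / (2 * lam\<^sup>2)"
    using b(4)[OF t] by (intro divide_right_mono) auto
  finally show "(\<integral>s. (Bker T lam K t s)\<^sup>2 \<partial>tspace T) \<le> (C\<^sup>2 * T / (4 * lam\<^sup>2) + C) / (2 * lam\<^sup>2)" .
qed

section \<open>Conditional expectations of processes\<close>

text \<open>Completeness transfers measurability along almost sure equality: the input of a solution
  map is known only up to such equality with a progressive process.\<close>

lemma (in complete_measure) borel_measurable_AE_eq: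
  fixes f g :: "'a \<Rightarrow> real"
  assumes f: "f \<in> borel_measurable M" and eq: "AE x in M. f x = g x"
  shows "g \<in> borel_measurable M"
proof (rule measurableI)
  fix B :: "real set" assume "B \<in> sets borel"
  then have "f -` B \<inter> space M \<in> sets M"
    using f by (rule measurable_sets[rotated])
  then show "g -` B \<inter> space M \<in> sets M"
    by (rule in_sets_AE[rotated]) (use eq in auto)
qed simp

text \<open>Conditional Jensen for the square.\<close>

lemma (in finite_measure_subalgebra)
  assumes X: "sqint M X"
  shows sqint_cond_exp: "sqint M (real_cond_exp M F X)"
    and cond_exp_norm_le: "(\<integral>x. (real_cond_exp M F X x)\<^sup>2 \<partial>M) \<le> (\<integral>x. (X x)\<^sup>2 \<partial>M)"
proof -
  have i: "integrable M X" by (rule sqint_integrable[OF X])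
  have q: "integrable M (\<lambda>x. (X x)\<^sup>2)" "convex_on UNIV (\<lambda>x::real. x\<^sup>2)"
    using X convex_power2 by (auto simp: sqint_def)
  have i2: "integrable M (\<lambda>x. (real_cond_exp M F X x)\<^sup>2)"
    using integrable_convex_cond_exp[where I = UNIV and q = "\<lambda>x. x\<^sup>2", OF i _ _ q] by auto
  then show "sqint M (real_cond_exp M F X)" by (auto simp: sqint_def)
  have "AE x in M. (real_cond_exp M F X x)\<^sup>2 \<le> real_cond_exp M F (\<lambda>x. (X x)\<^sup>2) x"
    using real_cond_exp_jensens_inequality(2)[where I = UNIV and q = "\<lambda>x. x\<^sup>2", OF i _ _ q] by auto
  then have "(\<integral>x. (real_cond_exp M F X x)\<^sup>2 \<partial>M) \<le> (\<integral>x. real_cond_exp M F (\<lambda>x. (X x)\<^sup>2) x \<partial>M)"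
    by (intro integral_mono_AE i2 real_cond_exp_int(1)[OF q(1)])
  then show "(\<integral>x. (real_cond_exp M F X x)\<^sup>2 \<partial>M) \<le> (\<integral>x. (X x)\<^sup>2 \<partial>M)"
    using real_cond_exp_int(2)[OF q(1)] by simp
qed

text \<open>The gaps \<open>D n\<close> are conditional expectations of a decreasing nonnegative
  sequence, so almost surely they are nonnegative and decrease in n. Their integrals tend to 0 by
  dominated convergence, which forces the infimum to vanish.\<close>

lemma (in finite_measure_subalgebra) real_cond_exp_mono_convergence:
  fixes X :: "nat \<Rightarrow> 'a \<Rightarrow> real"
  assumes X: "\<And>n. integrable M (X n)" and Y: "integrable M Y"
    and mono: "\<And>n x. x \<in> space M \<Longrightarrow> X n x \<le> X (Suc n) x"
    and lim: "\<And>x. x \<in> space M \<Longrightarrow> (\<lambda>n. X n x) \<longlonglongrightarrow> Y x"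
  shows "AE x in M. (\<lambda>n. real_cond_exp M F (X n) x) \<longlonglongrightarrow> real_cond_exp M F Y x"
proof -
  define D where "D n x = real_cond_exp M F (\<lambda>x. Y x - X n x) x" for n x
  have le: "X n x \<le> Y x" if "x \<in> space M" for n x
    using lim[OF that] mono[OF that] by (intro incseq_le) (auto intro: incseq_SucI)
  have int: "integrable M (\<lambda>x. Y x - X n x)" for n using X Y by auto
  have Dm[measurable]: "D n \<in> borel_measurable M" for n unfolding D_def by auto
  have D_int: "integrable M (D n)" "(\<integral>x. D n x \<partial>M) = (\<integral>x. Y x - X n x \<partial>M)" for n
    unfolding D_def using real_cond_exp_int[OF int] by auto
  have 1: "AE x in M. \<forall>n. D n x = real_cond_exp M F Y x - real_cond_exp M F (X n) x"
    unfolding AE_all_countable D_def using real_cond_exp_diff[OF Y X] by auto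
  have 2: "AE x in M. \<forall>n. 0 \<le> D n x"
  proof (unfold AE_all_countable D_def, rule allI, rule real_cond_exp_pos)
    show "AE x in M. 0 \<le> Y x - X n x" for n using le by (intro AE_I2) simp
  qed (use int in auto)
  have 3: "AE x in M. \<forall>n. D (Suc n) x \<le> D n x"
  proof (unfold AE_all_countable D_def, rule allI, rule real_cond_exp_mono)
    show "AE x in M. Y x - X (Suc n) x \<le> Y x - X n x" for n using mono by (intro AE_I2) simp
  qed (use int in auto)
  have "(\<lambda>n. \<integral>x. Y x - X n x \<partial>M) \<longlonglongrightarrow> (\<integral>x. 0 \<partial>M)"
  proof (rule integral_dominated_convergence[where w = "\<lambda>x. Y x - X 0 x"])
    show "AE x in M. (\<lambda>n. Y x - X n x) \<longlonglongrightarrow> 0"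
    proof (rule AE_I2)
      fix x assume "x \<in> space M"
      then have "(\<lambda>n. Y x - X n x) \<longlonglongrightarrow> Y x - Y x" by (intro tendsto_intros lim)
      then show "(\<lambda>n. Y x - X n x) \<longlonglongrightarrow> 0" by simp
    qed
    show "AE x in M. norm (Y x - X n x) \<le> Y x - X 0 x" for n
    proof (rule AE_I2)
      fix x assume x: "x \<in> space M"
      have "X 0 x \<le> X n x" using lift_Suc_mono_le[of "\<lambda>n. X n x" 0 n] mono[OF x] by simp
      then show "norm (Y x - X n x) \<le> Y x - X 0 x" using le[OF x, of n] by simp
    qed
  qed (use int in auto)
  then have lim0: "(\<lambda>n. \<integral>x. D n x \<partial>M) \<longlonglongrightarrow> 0" by (simp add: D_int)
  define L where "L x = (INF n. ennreal (D n x))" for x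
  have [measurable]: "L \<in> borel_measurable M" unfolding L_def by measurable
  have "(\<integral>\<^sup>+x. L x \<partial>M) \<le> ennreal (\<integral>x. D n x \<partial>M)" for n
  proof -
    have "(\<integral>\<^sup>+x. L x \<partial>M) \<le> (\<integral>\<^sup>+x. ennreal (D n x) \<partial>M)"
      unfolding L_def by (intro nn_integral_mono INF_lower) auto
    also have "\<dots> = ennreal (\<integral>x. D n x \<partial>M)"
      using D_int 2 by (intro nn_integral_eq_integral) auto
    finally show ?thesis .
  qed
  then have "(\<integral>\<^sup>+x. L x \<partial>M) \<le> ennreal 0"
    using lim0 by (intro tendsto_lowerbound[OF tendsto_ennrealI[OF lim0]]) auto
  then have "AE x in M. L x = 0"
    by (subst (asm) ennreal_0) (simp add: nn_integral_0_iff_AE)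
  then show ?thesis
    using 1 2 3
  proof eventually_elim
    case (elim x)
    have "(\<lambda>n. ennreal (D n x)) \<longlonglongrightarrow> L x"
      unfolding L_def using elim by (intro LIMSEQ_INF decseq_SucI ennreal_leI) auto
    then have "(\<lambda>n. D n x) \<longlonglongrightarrow> 0"
      using elim by (simp add: tendsto_ennreal_iff[of _ _ 0] flip: ennreal_0)
    then have "(\<lambda>n. real_cond_exp M F Y x - D n x) \<longlonglongrightarrow> real_cond_exp M F Y x - 0"
      by (intro tendsto_intros)
    then show ?case using elim by simp
  qed
qed

text \<open>Monotone class argument: a jointly measurable process has a conditional expectation process
  in the class \<open>\<C>\<close> as soon as this holds for indicators of rectangles.\<close>

lemma (in prob_space) joint_cond_exp:
  fixes \<C> :: "(real \<Rightarrow> 'a \<Rightarrow> real) \<Rightarrow> bool" and G :: "real \<Rightarrow> 'a measure"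
  assumes C_add: "\<And>u v. \<C> u \<Longrightarrow> \<C> v \<Longrightarrow> \<C> (\<lambda>s \<omega>. u s \<omega> + v s \<omega>)"
    and C_cmult: "\<And>c u. \<C> u \<Longrightarrow> \<C> (\<lambda>s \<omega>. c * u s \<omega>)"
    and C_lim: "\<And>f. (\<And>n::nat. \<C> (f n)) \<Longrightarrow> \<C> (\<lambda>s \<omega>. lim (\<lambda>n. f n s \<omega>))"
    and G: "\<And>s. s \<in> {0..T} \<Longrightarrow> subalgebra M (G s)"
    and base: "\<And>A B. A \<in> sets M \<Longrightarrow> B \<in> sets (tspace T) \<Longrightarrow>
      \<exists>m. \<C> m \<and> (AE s in tspace T. AE \<omega> in M. m s \<omega> = indicator B s * real_cond_exp M (G s) (indicator A) \<omega>)"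
    and q: "case_prod q \<in> borel_measurable (tspace T \<Otimes>\<^sub>M M)" "AE s in tspace T. integrable M (q s)"
  shows "\<exists>p. \<C> p \<and> (AE s in tspace T. AE \<omega> in M. p s \<omega> = real_cond_exp M (G s) (q s) \<omega>)"
proof -
  \<comment> \<open>Integrability of the slices is kept out of \<open>good\<close> and demanded in
    the closure steps, since linearity of conditional expectations needs it and it is available for
    almost every s only.\<close>
  define good where "good q \<longleftrightarrow> (\<exists>p. \<C> p \<and> (AE s in tspace T. AE \<omega> in M. p s \<omega> = real_cond_exp M (G s) (\<lambda>\<omega>. q (s, \<omega>)) \<omega>))"
    for q :: "real \<times> 'a \<Rightarrow> real"
  have fs: "finite_measure_subalgebra M (G s)" if "s \<in> {0..T}" for s
    using G[OF that] by (simp add: finite_measure_subalgebra_def finite_measure_axioms finite_measure_subalgebra_axioms_def)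
  have slice: "(\<lambda>\<omega>. f (s, \<omega>)) \<in> borel_measurable M" if "f \<in> borel_measurable (tspace T \<Otimes>\<^sub>M M)" "s \<in> {0..T}"
    for f :: "real \<times> 'a \<Rightarrow> real" and s
    using measurable_compose[OF measurable_Pair1'[of s "tspace T" M] that(1)] that(2) by simp
  have int: "AE s in tspace T. s \<in> {0..T}" by (rule AE_I2) simp
  have good_add: "good (\<lambda>x. f x + g x)" if gf: "good f" and gg: "good g"
    and f: "AE s in tspace T. integrable M (\<lambda>\<omega>. f (s, \<omega>))"
    and g: "AE s in tspace T. integrable M (\<lambda>\<omega>. g (s, \<omega>))" for f g
  proof -
    obtain p p' where p: "\<C> p" "AE s in tspace T. AE \<omega> in M. p s \<omega> = real_cond_exp M (G s) (\<lambda>\<omega>. f (s, \<omega>)) \<omega>"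
      and p': "\<C> p'" "AE s in tspace T. AE \<omega> in M. p' s \<omega> = real_cond_exp M (G s) (\<lambda>\<omega>. g (s, \<omega>)) \<omega>"
      using gf gg by (auto simp: good_def)
    have "AE s in tspace T. AE \<omega> in M. p s \<omega> + p' s \<omega> = real_cond_exp M (G s) (\<lambda>\<omega>. f (s, \<omega>) + g (s, \<omega>)) \<omega>"
      using p(2) p'(2) f g int
    proof eventually_elim
      case (elim s)
      interpret finite_measure_subalgebra M "G s" using fs elim by blast
      show ?case using elim(1,2) real_cond_exp_add[OF elim(3,4)] by eventually_elim simp
    qed
    then show ?thesis
      unfolding good_def by (intro exI[of _ "\<lambda>s \<omega>. p s \<omega> + p' s \<omega>"] conjI C_add p(1) p'(1))
  qed
  have good_cmult: "good (\<lambda>x. c * f x)" if gf: "good f"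
    and f: "AE s in tspace T. integrable M (\<lambda>\<omega>. f (s, \<omega>))" for c f
  proof -
    obtain p where p: "\<C> p" "AE s in tspace T. AE \<omega> in M. p s \<omega> = real_cond_exp M (G s) (\<lambda>\<omega>. f (s, \<omega>)) \<omega>"
      using gf by (auto simp: good_def)
    have "AE s in tspace T. AE \<omega> in M. c * p s \<omega> = real_cond_exp M (G s) (\<lambda>\<omega>. c * f (s, \<omega>)) \<omega>"
      using p(2) f int
    proof eventually_elim
      case (elim s)
      interpret finite_measure_subalgebra M "G s" using fs elim by blast
      show ?case using elim(1) real_cond_exp_cmult[OF elim(2), of c] by eventually_elim simp
    qed
    then show ?thesis
      unfolding good_def by (intro exI[of _ "\<lambda>s \<omega>. c * p s \<omega>"] conjI C_cmult p(1))
  qed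
  have good_lim: "good f" if U: "\<And>n. good (U n)"
    and Ui: "AE s in tspace T. \<forall>n. integrable M (\<lambda>\<omega>. U n (s, \<omega>))"
    and fi: "AE s in tspace T. integrable M (\<lambda>\<omega>. f (s, \<omega>))"
    and mono: "\<And>n x. x \<in> space (tspace T \<Otimes>\<^sub>M M) \<Longrightarrow> U n x \<le> U (Suc n) x"
    and lim: "\<And>x. x \<in> space (tspace T \<Otimes>\<^sub>M M) \<Longrightarrow> (\<lambda>n. U n x) \<longlonglongrightarrow> f x" for U :: "nat \<Rightarrow> real \<times> 'a \<Rightarrow> real" and f
  proof -
    have "\<forall>n. \<exists>p. \<C> p \<and> (AE s in tspace T. AE \<omega> in M. p s \<omega> = real_cond_exp M (G s) (\<lambda>\<omega>. U n (s, \<omega>)) \<omega>)"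
      using U unfolding good_def by (rule allI)
    from choice[OF this] obtain p where pp:
      "\<forall>n. \<C> (p n) \<and> (AE s in tspace T. AE \<omega> in M. p n s \<omega> = real_cond_exp M (G s) (\<lambda>\<omega>. U n (s, \<omega>)) \<omega>)" ..
    then have p: "\<C> (p n)"
      and pe: "AE s in tspace T. AE \<omega> in M. p n s \<omega> = real_cond_exp M (G s) (\<lambda>\<omega>. U n (s, \<omega>)) \<omega>" for n
      by (auto dest: spec[of _ n])
    have pe': "AE s in tspace T. \<forall>n. AE \<omega> in M. p n s \<omega> = real_cond_exp M (G s) (\<lambda>\<omega>. U n (s, \<omega>)) \<omega>"
      unfolding AE_all_countable using pe by (rule allI)
    have "AE s in tspace T. AE \<omega> in M. lim (\<lambda>n. p n s \<omega>) = real_cond_exp M (G s) (\<lambda>\<omega>. f (s, \<omega>)) \<omega>"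
      using pe' Ui fi int
    proof eventually_elim
      case (elim s)
      interpret finite_measure_subalgebra M "G s" using fs elim by blast
      have a: "AE \<omega> in M. \<forall>n. p n s \<omega> = real_cond_exp M (G s) (\<lambda>\<omega>. U n (s, \<omega>)) \<omega>"
        unfolding AE_all_countable using elim(1) by auto
      have "AE \<omega> in M. (\<lambda>n. real_cond_exp M (G s) (\<lambda>\<omega>. U n (s, \<omega>)) \<omega>) \<longlonglongrightarrow> real_cond_exp M (G s) (\<lambda>\<omega>. f (s, \<omega>)) \<omega>"
        using elim by (intro real_cond_exp_mono_convergence mono lim) (auto simp: space_pair_measure)
      then show ?case using a
        by eventually_elim (auto intro: limI)
    qed
    then show ?thesis
      unfolding good_def by (intro exI[of _ "\<lambda>s \<omega>. lim (\<lambda>n. p n s \<omega>)"] conjI C_lim p)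
  qed
  have ind_int: "AE s in tspace T. integrable M (\<lambda>\<omega>. indicator A (s, \<omega>) :: real)"
    if A: "A \<in> sets (tspace T \<Otimes>\<^sub>M M)" for A
  proof (rule AE_I2)
    fix s assume "s \<in> space (tspace T)"
    then have "(\<lambda>\<omega>. indicator A (s, \<omega>) :: real) \<in> borel_measurable M"
      using slice[of "indicator A" s] A by simp
    then show "integrable M (\<lambda>\<omega>. indicator A (s, \<omega>) :: real)"
      by (intro integrable_const_bound[where B = 1]) (auto simp: indicator_def)
  qed
  have good_cong: "good g" if gf: "good f" and fg: "\<And>x. x \<in> space (tspace T \<Otimes>\<^sub>M M) \<Longrightarrow> f x = g x"
    and fm: "f \<in> borel_measurable (tspace T \<Otimes>\<^sub>M M)" for f g
  proof -
    obtain p where p: "\<C> p" "AE s in tspace T. AE \<omega> in M. p s \<omega> = real_cond_exp M (G s) (\<lambda>\<omega>. f (s, \<omega>)) \<omega>"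
      using gf by (auto simp: good_def)
    have gm: "g \<in> borel_measurable (tspace T \<Otimes>\<^sub>M M)"
      using fg fm measurable_cong[of "tspace T \<Otimes>\<^sub>M M" f g] by simp
    have "AE s in tspace T. AE \<omega> in M. p s \<omega> = real_cond_exp M (G s) (\<lambda>\<omega>. g (s, \<omega>)) \<omega>"
      using p(2) int
    proof eventually_elim
      case (elim s)
      interpret finite_measure_subalgebra M "G s" using fs elim by blast
      have "AE \<omega> in M. real_cond_exp M (G s) (\<lambda>\<omega>. f (s, \<omega>)) \<omega> = real_cond_exp M (G s) (\<lambda>\<omega>. g (s, \<omega>)) \<omega>"
        using fg fm gm elim by (intro real_cond_exp_cong slice) (auto simp: space_pair_measure)
      then show ?case using elim(1) by eventually_elim simp
    qed
    then show ?thesis using p(1) by (auto simp: good_def)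
  qed
  \<comment> \<open>Dynkin: rectangles are stable under intersection, and countable disjoint unions
    are monotone limits of finite ones, whose indicators are sums.\<close>
  have good_ind: "good (indicator A)" if "A \<in> sets (tspace T \<Otimes>\<^sub>M M)" for A
  proof -
    let ?Gen = "{a \<times> b |a b. a \<in> sets (tspace T) \<and> b \<in> sets M}"
    have sets: "sigma_sets (space (tspace T) \<times> space M) ?Gen = sets (tspace T \<Otimes>\<^sub>M M)"
      by (rule sets_pair_measure[symmetric])
    have "A \<in> sigma_sets (space (tspace T) \<times> space M) ?Gen" using that sets by simp
    then show ?thesis
    proof (induction A rule: sigma_sets_induct_disjoint[OF Int_stable_pair_measure_generator pair_measure_closed, consumes 1])
      case (1 A)
      then obtain a b where A: "A = a \<times> b" and a: "a \<in> sets (tspace T)" and b: "b \<in> sets M" by auto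
      obtain m where m: "\<C> m" "AE s in tspace T. AE \<omega> in M. m s \<omega> = indicator a s * real_cond_exp M (G s) (indicator b) \<omega>"
        using base[OF b a] by auto
      have "AE s in tspace T. AE \<omega> in M. m s \<omega> = real_cond_exp M (G s) (\<lambda>\<omega>. indicator A (s, \<omega>)) \<omega>"
        using m(2) int
      proof eventually_elim
        case (elim s)
        interpret finite_measure_subalgebra M "G s" using fs elim by blast
        have "(\<lambda>\<omega>. indicator a s * indicator b \<omega> :: real) = (\<lambda>\<omega>. indicator A (s, \<omega>))"
          by (auto simp: A indicator_def)
        moreover have "AE \<omega> in M. real_cond_exp M (G s) (\<lambda>\<omega>. indicator a s * indicator b \<omega>) \<omega> = indicator a s * real_cond_exp M (G s) (indicator b) \<omega>"
          using b by (intro real_cond_exp_cmult) (auto simp: less_top[symmetric])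
        ultimately have "AE \<omega> in M. real_cond_exp M (G s) (\<lambda>\<omega>. indicator A (s, \<omega>)) \<omega> = indicator a s * real_cond_exp M (G s) (indicator b) \<omega>"
          by simp
        then show ?case using elim(1) by eventually_elim simp
      qed
      then show ?case using m(1) by (auto simp: good_def)
    next
      case 2
      obtain m where "\<C> m" "AE s in tspace T. AE \<omega> in M. m s \<omega> = indicator {} s * real_cond_exp M (G s) (indicator {}) \<omega>"
        using base[of "{}" "{}"] by auto
      \<comment> \<open>\<open>\<C>\<close> is not assumed to contain the zero process; multiplying
        a member by 0 provides it.\<close>
      have "AE s in tspace T. AE \<omega> in M. 0 * m s \<omega> = real_cond_exp M (G s) (\<lambda>\<omega>. indicator {} (s, \<omega>)) \<omega>"
        using int
      proof eventually_elim
        case (elim s)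
        interpret finite_measure_subalgebra M "G s" using fs elim by blast
        show ?case using real_cond_exp_F_meas[of "\<lambda>_. 0"] by auto
      qed
      then show ?case unfolding good_def by (intro exI[of _ "\<lambda>s \<omega>. 0 * m s \<omega>"] conjI C_cmult \<open>\<C> m\<close>)
    next
      case (3 A)
      have A: "A \<in> sets (tspace T \<Otimes>\<^sub>M M)" using 3(1) sets by simp
      obtain m where m: "\<C> m" "AE s in tspace T. AE \<omega> in M. m s \<omega> = indicator (space (tspace T)) s * real_cond_exp M (G s) (indicator (space M)) \<omega>"
        using base[OF sets.top sets.top] by auto
      have "good (\<lambda>_. 1)"
      proof -
        have "AE s in tspace T. AE \<omega> in M. m s \<omega> = real_cond_exp M (G s) (\<lambda>\<omega>. 1) \<omega>"
          using m(2) int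
        proof eventually_elim
          case (elim s)
          interpret finite_measure_subalgebra M "G s" using fs elim by blast
          have "AE \<omega> in M. real_cond_exp M (G s) (indicator (space M)) \<omega> = real_cond_exp M (G s) (\<lambda>\<omega>. 1) \<omega>"
            by (intro real_cond_exp_cong AE_I2) auto
          then show ?case using elim(1) by eventually_elim (use elim(2) in simp)
        qed
        then show ?thesis using m(1) by (auto simp: good_def)
      qed
      moreover have "good (\<lambda>x. (-1) * indicator A x)"
        by (intro good_cmult 3(2) ind_int A)
      ultimately have "good (\<lambda>x. 1 + (-1) * indicator A x)"
        using ind_int[OF A] by (intro good_add) auto
      then show ?case
        by (rule good_cong) (use A in \<open>auto simp: indicator_def space_pair_measure\<close>)
    next
      case (4 A)
      have A: "A i \<in> sets (tspace T \<Otimes>\<^sub>M M)" for i using 4(2) sets by auto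
      have un: "(\<Union>i<n. A i) \<in> sets (tspace T \<Otimes>\<^sub>M M)" for n :: nat using A by auto
      have part: "good (indicator (\<Union>i<n. A i))" for n :: nat
      proof (induction n)
        case 0
        have "good (\<lambda>x. 0 * indicator (A 0) x)" by (intro good_cmult 4(3) ind_int A)
        then show ?case by (rule good_cong) auto
      next
        case (Suc n)
        have "good (\<lambda>x. indicator (\<Union>i<n. A i) x + indicator (A n) x)"
          by (intro good_add Suc 4(3) ind_int un A)
        then show ?case
        proof (rule good_cong)
          fix x
          have "A i \<inter> A n = {}" if "i < n" for i
            using 4(1) that by (simp add: disjoint_family_on_def)
          then have "x \<in> A n \<Longrightarrow> x \<notin> (\<Union>i<n. A i)" by blast
          then show "indicator (\<Union>i<n. A i) x + indicator (A n) x = (indicator (\<Union>i<Suc n. A i) x :: real)"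
            by (auto simp: indicator_def less_Suc_eq)
        qed (use un A in auto)
      qed
      show ?case
      proof (rule good_lim[of "\<lambda>n. indicator (\<Union>i<n. A i)"])
        show "AE s in tspace T. \<forall>n. integrable M (\<lambda>\<omega>. indicator (\<Union>i<n. A i) (s, \<omega>) :: real)"
          unfolding AE_all_countable using ind_int[OF un] by auto
        show "AE s in tspace T. integrable M (\<lambda>\<omega>. indicator (\<Union>i. A i) (s, \<omega>) :: real)"
          using A by (intro ind_int) auto
        show "(\<lambda>n. indicator (\<Union>i<n. A i) x) \<longlonglongrightarrow> (indicator (\<Union>i. A i) x :: real)" for x
          by (rule LIMSEQ_indicator_UN)
      qed (auto simp: indicator_def less_Suc_eq intro: part)
    qed
  qed
  have good_nonneg: "(AE s in tspace T. integrable M (\<lambda>\<omega>. f (s, \<omega>))) \<longrightarrow> good f"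
    if "f \<in> borel_measurable (tspace T \<Otimes>\<^sub>M M)" "\<And>x. 0 \<le> f x" for f
    using that
  proof (induction f rule: borel_measurable_induct_real)
    case (set A)
    then show ?case using good_ind by simp
  next
    case (mult u c)
    show ?case
    \<comment> \<open>For c = 0 integrability of c u says nothing about u, so the induction
      hypothesis cannot be applied; zero is obtained from the indicator of the empty set
      instead.\<close>
    proof (cases "c = 0")
      case True
      have "good (\<lambda>x. 0 * indicator {} x)" by (intro good_cmult good_ind ind_int) auto
      then show ?thesis using True by simp
    next
      case False
      then show ?thesis using mult by (auto intro!: good_cmult)
    qed
  next
    case (add u v)
    show ?case
    proof
      assume i: "AE s in tspace T. integrable M (\<lambda>\<omega>. v (s, \<omega>) + u (s, \<omega>))"
      have b: "integrable M (\<lambda>\<omega>. g (s, \<omega>))"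
        if "integrable M (\<lambda>\<omega>. v (s, \<omega>) + u (s, \<omega>))" "s \<in> {0..T}" "g \<in> borel_measurable (tspace T \<Otimes>\<^sub>M M)"
          "\<And>x. 0 \<le> g x" "\<And>x. g x \<le> v x + u x" for g s
        using that slice by (intro Bochner_Integration.integrable_bound[OF that(1)])
          (auto intro!: AE_I2 simp: abs_of_nonneg order_trans[OF that(4) that(5)])
      have "AE s in tspace T. integrable M (\<lambda>\<omega>. v (s, \<omega>))" "AE s in tspace T. integrable M (\<lambda>\<omega>. u (s, \<omega>))"
      proof -
        show "AE s in tspace T. integrable M (\<lambda>\<omega>. v (s, \<omega>))"
          using i int
        proof eventually_elim
          case (elim s)
          show ?case by (rule b[OF elim]) (use add in auto)
        qed
        show "AE s in tspace T. integrable M (\<lambda>\<omega>. u (s, \<omega>))"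
          using i int
        proof eventually_elim
          case (elim s)
          show ?case by (rule b[OF elim]) (use add in auto)
        qed
      qed
      then show "good (\<lambda>x. v x + u x)"
        using add by (intro good_add) auto
    qed
  next
    case (seq U)
    show ?case
    proof
      assume i: "AE s in tspace T. integrable M (\<lambda>\<omega>. f (s, \<omega>))"
      have mono: "U n x \<le> U (Suc n) x" for n x
        using incseq_SucD[OF seq(3), of n] by (rule le_funD)
      have le: "U n x \<le> f x" if "x \<in> space (tspace T \<Otimes>\<^sub>M M)" for n x
        by (rule incseq_le[OF incseq_SucI[of "\<lambda>n. U n x", OF mono] seq(4)[OF that]])
      have Ui: "AE s in tspace T. \<forall>n. integrable M (\<lambda>\<omega>. U n (s, \<omega>))"
        using i int
      proof eventually_elim
        case (elim s)
        have "norm (U n (s, \<omega>)) \<le> norm (f (s, \<omega>))" if "\<omega> \<in> space M" for n \<omega>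
          using le[of "(s, \<omega>)" n] seq(2)[of n "(s, \<omega>)"] elim(2) that by (simp add: space_pair_measure)
        then show ?case
          using elim slice[OF seq(1)] by (auto intro!: Bochner_Integration.integrable_bound[OF elim(1)] AE_I2)
      qed
      then have "AE s in tspace T. integrable M (\<lambda>\<omega>. U n (s, \<omega>))" for n by auto
      with seq(5) have gU: "good (U n)" for n by (rule mp)
      show "good f"
        by (rule good_lim[of U, OF gU Ui i mono seq(4)])
    qed
  qed
  define f where "f = case_prod q"
  have fm[measurable]: "f \<in> borel_measurable (tspace T \<Otimes>\<^sub>M M)" using q by (simp add: f_def)
  have fi: "AE s in tspace T. integrable M (\<lambda>\<omega>. f (s, \<omega>))" using q by (simp add: f_def)
  have pn: "AE s in tspace T. integrable M (\<lambda>\<omega>. max 0 (f (s, \<omega>)))"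
    using fi by eventually_elim auto
  have pm: "AE s in tspace T. integrable M (\<lambda>\<omega>. max 0 (- f (s, \<omega>)))"
    using fi by eventually_elim auto
  note pn = pn pm
  have "good (\<lambda>x. max 0 (f x))" "good (\<lambda>x. max 0 (- f x))"
    using good_nonneg[of "\<lambda>x. max 0 (f x)"] good_nonneg[of "\<lambda>x. max 0 (- f x)"] pn by auto
  moreover from this(2) have "good (\<lambda>x. (-1) * max 0 (- f x))"
    using pn by (intro good_cmult) auto
  ultimately have "good (\<lambda>x. max 0 (f x) + (-1) * max 0 (- f x))"
    using pn by (intro good_add) auto
  then have "good f" by (rule good_cong) auto
  then show ?thesis by (simp add: good_def f_def)
qed

text \<open>Shifting by d cancels everything except two strips of width d: the integral equals that
  of \<phi> over [T - d, T] minus that over [-d, 0], and \<phi> lies between 0 and c.\<close>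

lemma mono_shift_integral_le:
  fixes \<phi> :: "real \<Rightarrow> real"
  assumes mono: "mono \<phi>" and b: "\<And>t. 0 \<le> \<phi> t" "\<And>t. \<phi> t \<le> c" and d: "0 \<le> d" and T: "0 \<le> T"
  shows "(\<integral>t. \<phi> t - \<phi> (t - d) \<partial>tspace T) \<le> c * d"
proof -
  have [measurable]: "\<phi> \<in> borel_measurable borel" by (rule borel_measurable_mono[OF mono])
  have i: "integrable lborel (\<lambda>s. indicator {a..b} s * \<phi> (s + e))" for a b e
  proof (rule Bochner_Integration.integrable_bound[where f = "\<lambda>s. indicator {a..b} s * c"])
    show "integrable lborel (\<lambda>s. indicator {a..b} s * c)"
      by (intro integrable_mult_left) (auto simp: emeasure_lborel_Icc_eq)
    show "AE s in lborel. norm (indicator {a..b} s * \<phi> (s + e)) \<le> norm (indicator {a..b} s * c)"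
      using b order_trans[OF b(1) b(2)] by (auto simp: indicator_def abs_of_nonneg)
  qed measurable
  have "(\<integral>t. \<phi> t - \<phi> (t - d) \<partial>tspace T) = (\<integral>t. indicator {0..T} t * \<phi> t - indicator {0..T} t * \<phi> (t - d) \<partial>lborel)"
    unfolding tspace_def by (subst integral_restrict_space) (auto simp: algebra_simps)
  also have "\<dots> = (\<integral>t. indicator {0..T} t * \<phi> t \<partial>lborel) - (\<integral>t. indicator {0..T} t * \<phi> (t - d) \<partial>lborel)"
    using i[of 0 T 0] i[of 0 T "-d"] by (intro Bochner_Integration.integral_diff) auto
  also have "(\<integral>t. indicator {0..T} t * \<phi> (t - d) \<partial>lborel) = (\<integral>s. indicator {-d..T-d} s * \<phi> s \<partial>lborel)"
    by (subst lborel_integral_real_affine[where c = 1 and t = d])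
      (auto intro!: Bochner_Integration.integral_cong simp: indicator_def)
  also have "(\<integral>t. indicator {0..T} t * \<phi> t \<partial>lborel) - \<dots> = (\<integral>t. indicator {0..T} t * \<phi> t - indicator {-d..T-d} t * \<phi> t \<partial>lborel)"
    using i[of 0 T 0] i[of "-d" "T-d" 0] by (intro Bochner_Integration.integral_diff[symmetric]) auto
  also have "\<dots> \<le> (\<integral>t. indicator {T-d..T} t * c \<partial>lborel)"
  proof (rule integral_mono)
    show "integrable lborel (\<lambda>t. indicator {0..T} t * \<phi> t - indicator {-d..T-d} t * \<phi> t)"
      using i[of 0 T 0] i[of "-d" "T-d" 0] by auto
    show "integrable lborel (\<lambda>t. indicator {T-d..T} t * c)"
      by (intro integrable_mult_left) (auto simp: emeasure_lborel_Icc_eq)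
    show "indicator {0..T} t * \<phi> t - indicator {-d..T-d} t * \<phi> t \<le> indicator {T-d..T} t * c" for t
      using b[of t] T d by (auto simp: indicator_def)
  qed
  also have "\<dots> = c * d" using d by simp
  finally show ?thesis .
qed

lemma joint_measurable_subalgebra:
  assumes "subalgebra M' G" "f \<in> borel_measurable (L \<Otimes>\<^sub>M G)"
  shows "f \<in> borel_measurable (L \<Otimes>\<^sub>M M')"
proof -
  have "(\<lambda>x. x) \<in> measurable M' G"
    using assms(1) by (auto simp: measurable_def subalgebra_def)
  then have "(\<lambda>x. (fst x, snd x)) \<in> measurable (L \<Otimes>\<^sub>M M') (L \<Otimes>\<^sub>M G)"
    by (intro measurable_Pair measurable_fst measurable_compose[OF measurable_snd])
  from measurable_compose[OF this assms(2)] show ?thesis by simp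
qed

lemma slice_measurable:
  assumes "case_prod u \<in> borel_measurable (tspace T' \<Otimes>\<^sub>M G)" "s \<in> {0..T'}"
  shows "u s \<in> borel_measurable G"
  using measurable_compose[OF measurable_Pair1'[of s "tspace T'" G] assms(1)] assms(2) by simp

lemma path_measurable:
  assumes "case_prod u \<in> borel_measurable (tspace T' \<Otimes>\<^sub>M G)" "\<omega> \<in> space G"
  shows "(\<lambda>s. u s \<omega>) \<in> borel_measurable (tspace T')"
  using measurable_compose[OF measurable_Pair2'[of \<omega> G "tspace T'"] assms(1)] assms(2) by simp

section \<open>The filtered probability space and progressive processes\<close>

locale filtered_prob = prob_space M for M :: "'a measure" +
  fixes T :: real and F :: "real \<Rightarrow> 'a measure"
  assumes T_pos: "0 < T" and filt: "usual_filtration T M F"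
begin

sublocale P: pair_sigma_finite "tspace T" M
  by (intro pair_sigma_finite.intro sigma_finite_tspace sigma_finite_measure_axioms)

abbreviation N :: "(real \<times> 'a) measure" where "N \<equiv> tspace T \<Otimes>\<^sub>M M"

sublocale N: finite_measure N
  by (rule finite_measure_pair_measure[OF finite_measure_axioms finite_measure_tspace])

sublocale CM: complete_measure M
  using filt by (simp add: usual_filtration_def)

lemma subalg: "t \<in> {0..T} \<Longrightarrow> subalgebra M (F t)"
  using filt by (auto simp: usual_filtration_def)

lemma fms: "t \<in> {0..T} \<Longrightarrow> finite_measure_subalgebra M (F t)"
  using subalg by (simp add: finite_measure_subalgebra_def finite_measure_axioms finite_measure_subalgebra_axioms_def)

lemma space_F: "t \<in> {0..T} \<Longrightarrow> space (F t) = space M"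
  using subalg by (simp add: subalgebra_def)

lemma subalg_mono:
  assumes "0 \<le> s" "s \<le> t" "t \<le> T"
  shows "subalgebra (F t) (F s)"
  using assms filt space_F[of s] space_F[of t] by (auto simp: subalgebra_def usual_filtration_def)

lemma progressiveD:
  assumes "progressive T F u" "t \<in> {0..T}"
  shows "case_prod u \<in> borel_measurable (tspace t \<Otimes>\<^sub>M F t)"
  using assms by (simp add: progressive_def tspace_def)

lemma progressiveI:
  assumes "\<And>t. t \<in> {0..T} \<Longrightarrow> case_prod u \<in> borel_measurable (tspace t \<Otimes>\<^sub>M F t)"
  shows "progressive T F u"
  using assms by (simp add: progressive_def tspace_def)

lemma progressive_joint:
  assumes "progressive T F u"
  shows "case_prod u \<in> borel_measurable N"
  using joint_measurable_subalgebra[OF subalg progressiveD[OF assms], of T] T_pos by simp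

lemma progressive_adapted:
  assumes "progressive T F u" "t \<in> {0..T}"
  shows "u t \<in> borel_measurable (F t)"
  using slice_measurable[OF progressiveD[OF assms]] assms(2) by simp

lemma progressive_add:
  assumes "progressive T F u" "progressive T F v"
  shows "progressive T F (\<lambda>s \<omega>. u s \<omega> + v s \<omega>)"
proof (rule progressiveI)
  fix t assume "t \<in> {0..T}"
  note [measurable] = progressiveD[OF assms(1) this] progressiveD[OF assms(2) this]
  show "(\<lambda>(s, \<omega>). u s \<omega> + v s \<omega>) \<in> borel_measurable (tspace t \<Otimes>\<^sub>M F t)" by measurable
qed

lemma progressive_time_mult:
  assumes "progressive T F u" "g \<in> borel_measurable borel"
  shows "progressive T F (\<lambda>s \<omega>. g s * u s \<omega>)"
proof (rule progressiveI)
  fix t assume "t \<in> {0..T}"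
  note [measurable] = progressiveD[OF assms(1) this] borel_measurable_tspace[OF assms(2)]
  show "(\<lambda>(s, \<omega>). g s * u s \<omega>) \<in> borel_measurable (tspace t \<Otimes>\<^sub>M F t)" by measurable
qed

lemma progressive_cmult: "progressive T F u \<Longrightarrow> progressive T F (\<lambda>s \<omega>. c * u s \<omega>)"
  by (rule progressive_time_mult) auto

text \<open>No convergence is required: at points where the sequence diverges \<open>lim\<close> is
  still a measurable default. Closedness of the control space and the monotone class argument both
  rest on this.\<close>

lemma progressive_lim:
  fixes f :: "nat \<Rightarrow> real \<Rightarrow> 'a \<Rightarrow> real"
  assumes "\<And>n. progressive T F (f n)"
  shows "progressive T F (\<lambda>s \<omega>. lim (\<lambda>n. f n s \<omega>))"
proof (rule progressiveI)
  fix t assume "t \<in> {0..T}"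
  note [measurable] = progressiveD[OF assms this]
  show "(\<lambda>(s, \<omega>). lim (\<lambda>n. f n s \<omega>)) \<in> borel_measurable (tspace t \<Otimes>\<^sub>M F t)" by measurable
qed

lemma Uset_iff: "u \<in> Uset T M F \<longleftrightarrow> progressive T F u \<and> sqint N (case_prod u)"
proof -
  have "(\<integral>\<^sup>+ s. (\<integral>\<^sup>+ \<omega>. ennreal ((u s \<omega>)\<^sup>2) \<partial>M) * indicator {0..T} s \<partial>lborel) = (\<integral>\<^sup>+x. ennreal ((case_prod u x)\<^sup>2) \<partial>N)"
    if "progressive T F u"
  proof -
    note [measurable] = progressive_joint[OF that]
    show ?thesis
      unfolding nn_integral_tspace using nn_integral_fst[of "\<lambda>x. ennreal ((case_prod u x)\<^sup>2)" "tspace T"] by simp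
  qed
  then show ?thesis
    unfolding Uset_def sqint_iff_nn using progressive_joint by auto
qed

lemma AE_sqint_slice:
  assumes "sqint N (case_prod u)"
  shows "AE s in tspace T. sqint M (u s)"
proof -
  have "AE s in tspace T. integrable M (\<lambda>\<omega>. (u s \<omega>)\<^sup>2)"
    using P.AE_integrable_fst'[OF sqint_integrable_power2[OF assms]] by simp
  then show ?thesis
    using AE_space
  proof eventually_elim
    case (elim s)
    then show ?case using slice_measurable[OF sqint_meas[OF assms], of s] by (simp add: sqint_def)
  qed
qed

lemma AE_sqint_path:
  assumes "sqint N (case_prod u)"
  shows "AE \<omega> in M. sqint (tspace T) (\<lambda>s. u s \<omega>)"
proof -
  have "AE \<omega> in M. integrable (tspace T) (\<lambda>s. (u s \<omega>)\<^sup>2)"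
    using P.AE_integrable_snd[of "\<lambda>s \<omega>. (u s \<omega>)\<^sup>2"] sqint_integrable_power2[OF assms]
    by (simp add: case_prod_beta')
  then show ?thesis
    using AE_space
  proof eventually_elim
    case (elim \<omega>)
    then show ?case using path_measurable[OF sqint_meas[OF assms], of \<omega>] by (simp add: sqint_def)
  qed
qed

text \<open>Fubini for null sets. It passes from equations holding almost surely at almost every
  time to equations holding along almost every path, which is where the deterministic operators
  act.\<close>

lemma
  fixes u v :: "real \<Rightarrow> 'a \<Rightarrow> real"
  assumes [measurable]: "case_prod u \<in> borel_measurable N" "case_prod v \<in> borel_measurable N"
  shows AE_eq_iff: "(AE s in tspace T. AE \<omega> in M. u s \<omega> = v s \<omega>) \<longleftrightarrow> (AE x in N. case_prod u x = case_prod v x)"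
    and AE_eq_commute: "(AE s in tspace T. AE \<omega> in M. u s \<omega> = v s \<omega>) \<longleftrightarrow> (AE \<omega> in M. AE s in tspace T. u s \<omega> = v s \<omega>)"
proof -
  have "{x \<in> space N. f x = g x} \<in> sets N" if "f \<in> borel_measurable N" "g \<in> borel_measurable N" for f g :: "real \<times> 'a \<Rightarrow> real"
    using that by measurable
  from this[OF assms] have "{x \<in> space N. case_prod u x = case_prod v x} \<in> sets N" .
  then have m: "{x \<in> space N. u (fst x) (snd x) = v (fst x) (snd x)} \<in> sets N"
    by (simp add: case_prod_beta')
  show "(AE s in tspace T. AE \<omega> in M. u s \<omega> = v s \<omega>) \<longleftrightarrow> (AE x in N. case_prod u x = case_prod v x)"
    using P.AE_pair_iff[OF m] by (simp add: case_prod_beta')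
  show "(AE s in tspace T. AE \<omega> in M. u s \<omega> = v s \<omega>) \<longleftrightarrow> (AE \<omega> in M. AE s in tspace T. u s \<omega> = v s \<omega>)"
    by (rule P.AE_commute[OF m])
qed

text \<open>Pythagoras for the martingale of conditional expectations: by the tower property the
  increment is orthogonal to the value at s. Hence the second moment is nondecreasing in
  time.\<close>

lemma cond_exp_diff_norm:
  assumes X: "sqint M X" and st: "0 \<le> s" "s \<le> t" "t \<le> T"
  defines "Y \<equiv> \<lambda>t. real_cond_exp M (F t) X"
  shows "(\<integral>\<omega>. (Y t \<omega> - Y s \<omega>)\<^sup>2 \<partial>M) = (\<integral>\<omega>. (Y t \<omega>)\<^sup>2 \<partial>M) - (\<integral>\<omega>. (Y s \<omega>)\<^sup>2 \<partial>M)"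
proof -
  interpret s: finite_measure_subalgebra M "F s" using fms st by simp
  interpret t: finite_measure_subalgebra M "F t" using fms st by simp
  have sq: "sqint M (Y s)" "sqint M (Y t)"
    unfolding Y_def by (rule s.sqint_cond_exp[OF X] t.sqint_cond_exp[OF X])+
  have "(\<integral>\<omega>. Y s \<omega> * Y t \<omega> \<partial>M) = (\<integral>\<omega>. Y s \<omega> * real_cond_exp M (F s) (Y t) \<omega> \<partial>M)"
    using sqint_mult[OF sq] sqint_meas[OF sq(2)]
    by (intro s.real_cond_exp_intg(2)[symmetric]) (auto simp: Y_def)
  also have "\<dots> = (\<integral>\<omega>. Y s \<omega> * Y s \<omega> \<partial>M)"
  proof (rule integral_cong_AE)
    have "AE \<omega> in M. real_cond_exp M (F s) (Y t) \<omega> = Y s \<omega>"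
      unfolding Y_def using subalg[of t] subalg_mono[OF st] st sqint_integrable[OF X]
      by (intro s.real_cond_exp_nested_subalg) auto
    then show "AE \<omega> in M. Y s \<omega> * real_cond_exp M (F s) (Y t) \<omega> = Y s \<omega> * Y s \<omega>" by auto
  qed (use sqint_meas[OF sq(1)] in auto)
  finally have c: "(\<integral>\<omega>. Y s \<omega> * Y t \<omega> \<partial>M) = (\<integral>\<omega>. (Y s \<omega>)\<^sup>2 \<partial>M)" by (simp add: power2_eq_square)
  have "(\<integral>\<omega>. (Y t \<omega> - Y s \<omega>)\<^sup>2 \<partial>M) = (\<integral>\<omega>. (Y t \<omega>)\<^sup>2 + (Y s \<omega>)\<^sup>2 - 2 * (Y s \<omega> * Y t \<omega>) \<partial>M)"
    by (simp add: power2_eq_square algebra_simps)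
  also have "\<dots> = (\<integral>\<omega>. (Y t \<omega>)\<^sup>2 \<partial>M) + (\<integral>\<omega>. (Y s \<omega>)\<^sup>2 \<partial>M) - 2 * (\<integral>\<omega>. Y s \<omega> * Y t \<omega> \<partial>M)"
    using sq sqint_mult[OF sq] by (simp add: sqint_def)
  finally show ?thesis using c by simp
qed

text \<open>Along the dyadic grid the squared distances \<open>E (E_t X - E_{t_n} X)^2\<close> are increments of the
  monotone function \<open>t \<mapsto> E (E_t X)^2\<close>, hence summable in \<open>n\<close> for almost every \<open>t\<close>. This gives a
  progressive version without martingale convergence or path regularisation.\<close>

lemma progressive_cond_exp_rv:
  assumes X: "sqint M X"
  shows "\<exists>m. progressive T F m \<and> (AE s in tspace T. AE \<omega> in M. m s \<omega> = real_cond_exp M (F s) X \<omega>)"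
proof -
  define Y where "Y t = real_cond_exp M (F t) X" for t
  \<comment> \<open>Freezing time outside [0,T] makes \<phi> monotone on the whole line, so that the
    shifts t - (1/2)^n need no case distinction at 0.\<close>
  define clamp where "clamp t = max 0 (min T t)" for t
  define \<phi> where "\<phi> t = (\<integral>\<omega>. (Y (clamp t) \<omega>)\<^sup>2 \<partial>M)" for t
  define c where "c = (\<integral>\<omega>. (X \<omega>)\<^sup>2 \<partial>M)"
  have clamp: "clamp t \<in> {0..T}" for t using T_pos by (auto simp: clamp_def)
  have clamp_id: "clamp t = t" if "t \<in> {0..T}" for t using that by (auto simp: clamp_def)
  have Ysq: "sqint M (Y t)" if "t \<in> {0..T}" for t
    unfolding Y_def by (rule finite_measure_subalgebra.sqint_cond_exp[OF fms[OF that] X])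
  have diff: "(\<integral>\<omega>. (Y t \<omega> - Y s \<omega>)\<^sup>2 \<partial>M) = \<phi> t - \<phi> s" if "0 \<le> s" "s \<le> t" "t \<le> T" for s t
    using cond_exp_diff_norm[OF X that] that by (simp add: Y_def \<phi>_def clamp_id)
  have mono: "mono \<phi>"
  proof (rule monoI)
    fix s t :: real assume "s \<le> t"
    then have "(\<integral>\<omega>. (Y (clamp t) \<omega> - Y (clamp s) \<omega>)\<^sup>2 \<partial>M) = \<phi> (clamp t) - \<phi> (clamp s)"
      using clamp[of s] clamp[of t] by (intro diff) (auto simp: clamp_def)
    moreover have "0 \<le> (\<integral>\<omega>. (Y (clamp t) \<omega> - Y (clamp s) \<omega>)\<^sup>2 \<partial>M)" by simp
    ultimately have "0 \<le> \<phi> (clamp t) - \<phi> (clamp s)" by linarith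
    then show "\<phi> s \<le> \<phi> t" by (simp add: \<phi>_def clamp_id[OF clamp])
  qed
  have \<phi>0: "0 \<le> \<phi> t" for t by (simp add: \<phi>_def)
  have \<phi>c: "\<phi> t \<le> c" for t
    unfolding \<phi>_def c_def Y_def by (rule finite_measure_subalgebra.cond_exp_norm_le[OF fms[OF clamp] X])
  have [measurable]: "\<phi> \<in> borel_measurable borel" by (rule borel_measurable_mono[OF mono])
  \<comment> \<open>Rounding down to the dyadic grid: the sampled time never exceeds t, so the
    sampled variable is known at t, and it is within (1/2)^n of t.\<close>
  define \<pi> where "\<pi> n t = real (nat \<lfloor>t * 2 ^ n\<rfloor>) / 2 ^ n" for n :: nat and t :: real
  \<comment> \<open>Integrated over t, the increments are at most c (1/2)^n by
    \<open>mono_shift_integral_le\<close>, so they are summable at almost every t.\<close>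
  have "AE t in tspace T. summable (\<lambda>n. \<phi> t - \<phi> (t - (1/2)^n))"
  proof (rule AE_summable_of_integrals[where b = "\<lambda>n. c * (1/2)^n"])
    show "(\<lambda>t. \<phi> t - \<phi> (t - (1/2)^n)) \<in> borel_measurable (tspace T)" for n
      by (rule borel_measurable_tspace) measurable
    show nn: "0 \<le> \<phi> t - \<phi> (t - (1/2)^n)" for n t using monoD[OF mono, of "t - (1/2)^n" t] by simp
    fix n
    interpret R: finite_measure "tspace T" by (rule finite_measure_tspace)
    have "(\<lambda>t. \<phi> t - \<phi> (t - (1/2)^n)) \<in> borel_measurable (tspace T)"
      by (rule borel_measurable_tspace) measurable
    moreover have "\<phi> t - \<phi> (t - (1/2)^n) \<le> c" for t using \<phi>0[of "t - (1/2)^n"] \<phi>c[of t] by linarith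
    ultimately have "integrable (tspace T) (\<lambda>t. \<phi> t - \<phi> (t - (1/2)^n))"
      using nn by (intro R.integrable_const_bound[where B = c]) (auto simp: abs_of_nonneg)
    then have "(\<integral>\<^sup>+t. ennreal (\<phi> t - \<phi> (t - (1/2)^n)) \<partial>tspace T) = ennreal (\<integral>t. \<phi> t - \<phi> (t - (1/2)^n) \<partial>tspace T)"
      using nn by (intro nn_integral_eq_integral) auto
    also have "\<dots> \<le> ennreal (c * (1/2)^n)"
      using T_pos by (intro ennreal_leI mono_shift_integral_le mono \<phi>0 \<phi>c) auto
    finally show "(\<integral>\<^sup>+t. ennreal (\<phi> t - \<phi> (t - (1/2)^n)) \<partial>tspace T) \<le> ennreal (c * (1/2)^n)" .
    show "0 \<le> c * (1/2)^n" by (simp add: c_def)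
  qed (intro summable_mult summable_geometric, simp)
  moreover have "AE t in tspace T. t \<in> {0..T}" by (rule AE_I2) simp
  ultimately have conv: "AE t in tspace T. AE \<omega> in M. lim (\<lambda>n. Y (\<pi> n t) \<omega>) = Y t \<omega>"
  proof (eventually_elim)
    case (elim t)
    have pi: "0 \<le> \<pi> n t" "\<pi> n t \<le> t" "t - (1/2)^n \<le> \<pi> n t" for n
    proof -
      have nn: "0 \<le> t * 2^n" using elim by simp
      then have r: "real (nat \<lfloor>t * 2^n\<rfloor>) = of_int \<lfloor>t * 2^n\<rfloor>" by simp
      show "0 \<le> \<pi> n t" by (simp add: \<pi>_def)
      have "of_int \<lfloor>t * 2^n\<rfloor> \<le> t * 2^n" "t * 2^n - 1 \<le> of_int \<lfloor>t * 2^n\<rfloor>" by linarith+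
      then have "of_int \<lfloor>t * 2^n\<rfloor> / 2^n \<le> t * 2^n / 2^n" "(t * 2^n - 1) / 2^n \<le> of_int \<lfloor>t * 2^n\<rfloor> / 2^n"
        by (intro divide_right_mono; simp)+
      then show "\<pi> n t \<le> t" "t - (1/2)^n \<le> \<pi> n t"
        unfolding \<pi>_def r by (simp_all add: diff_divide_distrib power_one_over)
    qed
    have "AE \<omega> in M. summable (\<lambda>n. (Y t \<omega> - Y (\<pi> n t) \<omega>)\<^sup>2)"
    proof (rule AE_summable_of_integrals[where b = "\<lambda>n. \<phi> t - \<phi> (t - (1/2)^n)"])
      fix n
      have pT: "\<pi> n t \<in> {0..T}" using pi[of n] elim by auto
      have s: "sqint M (\<lambda>\<omega>. Y t \<omega> - Y (\<pi> n t) \<omega>)" using elim by (intro sqint_diff Ysq pT) auto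
      then show "(\<lambda>\<omega>. (Y t \<omega> - Y (\<pi> n t) \<omega>)\<^sup>2) \<in> borel_measurable M" by (auto simp: sqint_def)
      have "(\<integral>\<^sup>+\<omega>. ennreal ((Y t \<omega> - Y (\<pi> n t) \<omega>)\<^sup>2) \<partial>M) = ennreal (\<phi> t - \<phi> (\<pi> n t))"
        using s pi[of n] elim diff[of "\<pi> n t" t] by (subst nn_integral_eq_integral) (auto simp: sqint_def)
      also have "\<dots> \<le> ennreal (\<phi> t - \<phi> (t - (1/2)^n))"
        using monoD[OF mono pi(3)[of n]] by (intro ennreal_leI) simp
      finally show "(\<integral>\<^sup>+\<omega>. ennreal ((Y t \<omega> - Y (\<pi> n t) \<omega>)\<^sup>2) \<partial>M) \<le> ennreal (\<phi> t - \<phi> (t - (1/2)^n))" .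
      show "0 \<le> \<phi> t - \<phi> (t - (1/2)^n)" using monoD[OF mono, of "t - (1/2)^n" t] by simp
    qed (use elim in auto)
    then show ?case
    proof eventually_elim
      case (elim \<omega>)
      from summable_LIMSEQ_zero[OF this] have "(\<lambda>n. (Y t \<omega> - Y (\<pi> n t) \<omega>)\<^sup>2) \<longlonglongrightarrow> 0" .
      then have "(\<lambda>n. sqrt ((Y t \<omega> - Y (\<pi> n t) \<omega>)\<^sup>2)) \<longlonglongrightarrow> sqrt 0" by (rule tendsto_real_sqrt)
      then have "(\<lambda>n. Y t \<omega> - Y (\<pi> n t) \<omega>) \<longlonglongrightarrow> 0" by (simp add: tendsto_rabs_zero_iff)
      then have "(\<lambda>n. Y t \<omega> - (Y t \<omega> - Y (\<pi> n t) \<omega>)) \<longlonglongrightarrow> Y t \<omega> - 0" by (intro tendsto_intros)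
      then show ?case by (intro limI) simp
    qed
  qed
  have "progressive T F (\<lambda>s \<omega>. Y (\<pi> n s) \<omega>)" for n
  proof (rule progressiveI)
    fix t assume t: "t \<in> {0..T}"
    \<comment> \<open>The guard k / 2^n \<le> t keeps every branch measurable for
      \<open>F t\<close>. Nothing is lost on [0,t], where rounded times satisfy it.\<close>
    let ?Z = "\<lambda>k \<omega>. if real k / 2^n \<le> t then Y (real k / 2^n) \<omega> else 0"
    have Z: "?Z k \<in> borel_measurable (F t)" for k
    proof (cases "real k / 2^n \<le> t")
      case True
      then have "Y (real k / 2^n) \<in> borel_measurable (F t)"
        unfolding Y_def using t by (intro measurable_from_subalg[OF subalg_mono borel_measurable_cond_exp]) auto
      then show ?thesis using True by simp
    qed simp
    have "(\<lambda>x. ?Z (nat \<lfloor>fst x * 2^n\<rfloor>) (snd x)) \<in> borel_measurable (tspace t \<Otimes>\<^sub>M F t)"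
    proof (rule measurable_compose_countable[where f = "\<lambda>k x. ?Z k (snd x)" and g = "\<lambda>x. nat \<lfloor>fst x * 2^n\<rfloor>"])
      show "(\<lambda>x. ?Z k (snd x)) \<in> borel_measurable (tspace t \<Otimes>\<^sub>M F t)" for k
        by (rule measurable_compose[OF measurable_snd Z])
      have "(\<lambda>s::real. nat \<lfloor>s * 2^n\<rfloor>) \<in> measurable borel (count_space UNIV)" by measurable
      then have "(\<lambda>s::real. nat \<lfloor>s * 2^n\<rfloor>) \<in> measurable (tspace t) (count_space UNIV)"
        unfolding tspace_def by (intro measurable_restrict_space1) simp
      then show "(\<lambda>x. nat \<lfloor>fst x * 2^n\<rfloor>) \<in> measurable (tspace t \<Otimes>\<^sub>M F t) (count_space UNIV)"
        by (rule measurable_compose[OF measurable_fst])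
    qed
    moreover have "?Z (nat \<lfloor>fst x * 2^n\<rfloor>) (snd x) = (case x of (s, \<omega>) \<Rightarrow> Y (\<pi> n s) \<omega>)"
      if "x \<in> space (tspace t \<Otimes>\<^sub>M F t)" for x
    proof -
      have x: "0 \<le> fst x" "fst x \<le> t" using that by (auto simp: space_pair_measure)
      then have "real (nat \<lfloor>fst x * 2^n\<rfloor>) = of_int \<lfloor>fst x * 2^n\<rfloor>" by simp
      moreover have "of_int \<lfloor>fst x * 2^n\<rfloor> \<le> fst x * 2^n" by linarith
      ultimately have "real (nat \<lfloor>fst x * 2^n\<rfloor>) / 2^n \<le> fst x" by (simp add: field_simps)
      then show ?thesis using x by (auto simp: \<pi>_def split: prod.split)
    qed
    ultimately show "(\<lambda>(s, \<omega>). Y (\<pi> n s) \<omega>) \<in> borel_measurable (tspace t \<Otimes>\<^sub>M F t)"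
      using measurable_cong[of "tspace t \<Otimes>\<^sub>M F t" "\<lambda>x. ?Z (nat \<lfloor>fst x * 2^n\<rfloor>) (snd x)"] by blast
  qed
  then have "progressive T F (\<lambda>s \<omega>. lim (\<lambda>n. Y (\<pi> n s) \<omega>))" by (rule progressive_lim)
  then show ?thesis using conv unfolding Y_def by blast
qed

text \<open>A substitute for the optional projection, identified at almost every time only. A
  deterministic factor preserves progressiveness, so the case of a rectangle reduces to
  \<open>progressive_cond_exp_rv\<close>.\<close>

lemma progressive_projection:
  assumes q: "case_prod q \<in> borel_measurable N" "AE s in tspace T. integrable M (q s)"
  shows "\<exists>p. progressive T F p \<and> (AE s in tspace T. AE \<omega> in M. p s \<omega> = real_cond_exp M (F s) (q s) \<omega>)"
proof (rule joint_cond_exp[OF progressive_add progressive_cmult progressive_lim subalg _ q])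
  fix A B assume A: "A \<in> sets M" and B: "B \<in> sets (tspace T)"
  have "sqint M (indicator A)" using A by (auto simp: sqint_def indicator_def of_bool_def power2_eq_square
        intro!: integrable_const_bound[where B = 1])
  then obtain m where m: "progressive T F m" "AE s in tspace T. AE \<omega> in M. m s \<omega> = real_cond_exp M (F s) (indicator A) \<omega>"
    using progressive_cond_exp_rv by blast
  have "B \<in> sets borel" using B by (auto simp: tspace_def sets_restrict_space)
  then have "progressive T F (\<lambda>s \<omega>. indicator B s * m s \<omega>)"
    by (intro progressive_time_mult m) simp
  moreover have "AE s in tspace T. AE \<omega> in M. indicator B s * m s \<omega> = indicator B s * real_cond_exp M (F s) (indicator A) \<omega>"
    using m(2) by eventually_elim (auto elim: eventually_mono)
  ultimately show "\<exists>m. progressive T F m \<and>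
      (AE s in tspace T. AE \<omega> in M. m s \<omega> = indicator B s * real_cond_exp M (F s) (indicator A) \<omega>)"
    by (intro exI[of _ "\<lambda>s \<omega>. indicator B s * m s \<omega>"] conjI)
qed

text \<open>The same monotone class argument, now with a fixed sigma-algebra and joint measurability
  as the class. It supplies the witness behind \<open>ceproc\<close>, even measurable with respect
  to \<open>F t\<close>.\<close>

lemma cond_exp_process_exists:
  assumes t: "t \<in> {0..T}"
    and q: "case_prod q \<in> borel_measurable N" "AE s in tspace T. integrable M (q s)"
  shows "\<exists>y. case_prod y \<in> borel_measurable (tspace T \<Otimes>\<^sub>M F t) \<and>
    (AE s in tspace T. AE \<omega> in M. y s \<omega> = real_cond_exp M (F t) (q s) \<omega>)"
proof (rule joint_cond_exp[where G = "\<lambda>_. F t", OF _ _ _ subalg[OF t] _ q])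
  fix u v :: "real \<Rightarrow> 'a \<Rightarrow> real" and c :: real
  assume [measurable]: "case_prod u \<in> borel_measurable (tspace T \<Otimes>\<^sub>M F t)"
  show "(\<lambda>(s, \<omega>). c * u s \<omega>) \<in> borel_measurable (tspace T \<Otimes>\<^sub>M F t)" by measurable
  assume [measurable]: "case_prod v \<in> borel_measurable (tspace T \<Otimes>\<^sub>M F t)"
  show "(\<lambda>(s, \<omega>). u s \<omega> + v s \<omega>) \<in> borel_measurable (tspace T \<Otimes>\<^sub>M F t)" by measurable
next
  fix f :: "nat \<Rightarrow> real \<Rightarrow> 'a \<Rightarrow> real"
  assume [measurable]: "\<And>n. case_prod (f n) \<in> borel_measurable (tspace T \<Otimes>\<^sub>M F t)"
  show "(\<lambda>(s, \<omega>). lim (\<lambda>n. f n s \<omega>)) \<in> borel_measurable (tspace T \<Otimes>\<^sub>M F t)" by measurable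
next
  fix A B assume "A \<in> sets M" and [measurable]: "B \<in> sets (tspace T)"
  have "(\<lambda>(s, \<omega>). indicator B s * real_cond_exp M (F t) (indicator A) \<omega>) \<in> borel_measurable (tspace T \<Otimes>\<^sub>M F t)"
    by measurable
  then show "\<exists>m. case_prod m \<in> borel_measurable (tspace T \<Otimes>\<^sub>M F t) \<and>
      (AE s in tspace T. AE \<omega> in M. m s \<omega> = indicator B s * real_cond_exp M (F t) (indicator A) \<omega>)"
    by (intro exI[of _ "\<lambda>s \<omega>. indicator B s * real_cond_exp M (F t) (indicator A) \<omega>"]) simp
qed

text \<open>Conditional Jensen at almost every time, then Tonelli. The sigma-algebra may vary with
  time, which covers both progressive projections and conditioning at a fixed time.\<close>

lemma sqint_cond_exp_process:
  assumes q: "sqint N (case_prod q)" and p[measurable]: "case_prod p \<in> borel_measurable N"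
    and G: "\<And>s. s \<in> {0..T} \<Longrightarrow> subalgebra M (G s)"
    and eq: "AE s in tspace T. AE \<omega> in M. p s \<omega> = real_cond_exp M (G s) (q s) \<omega>"
  shows "sqint N (case_prod p)"
proof -
  note [measurable] = sqint_meas[OF q]
  have "(\<integral>\<^sup>+x. ennreal ((case_prod p x)\<^sup>2) \<partial>N) = (\<integral>\<^sup>+s. \<integral>\<^sup>+\<omega>. ennreal ((p s \<omega>)\<^sup>2) \<partial>M \<partial>tspace T)"
    using nn_integral_fst[of "\<lambda>x. ennreal ((case_prod p x)\<^sup>2)" "tspace T"] by simp
  also have "\<dots> \<le> (\<integral>\<^sup>+s. \<integral>\<^sup>+\<omega>. ennreal ((q s \<omega>)\<^sup>2) \<partial>M \<partial>tspace T)"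
  proof (rule nn_integral_mono_AE)
    have "AE s in tspace T. s \<in> {0..T}" by (rule AE_I2) simp
    with eq AE_sqint_slice[OF q]
    show "AE s in tspace T. (\<integral>\<^sup>+\<omega>. ennreal ((p s \<omega>)\<^sup>2) \<partial>M) \<le> (\<integral>\<^sup>+\<omega>. ennreal ((q s \<omega>)\<^sup>2) \<partial>M)"
    proof eventually_elim
      case (elim s)
      interpret G: finite_measure_subalgebra M "G s"
        using G[OF elim(3)] by (simp add: finite_measure_subalgebra_def finite_measure_axioms finite_measure_subalgebra_axioms_def)
      note c = G.sqint_cond_exp[OF elim(2)]
      have "(\<integral>\<^sup>+\<omega>. ennreal ((p s \<omega>)\<^sup>2) \<partial>M) = (\<integral>\<^sup>+\<omega>. ennreal ((real_cond_exp M (G s) (q s) \<omega>)\<^sup>2) \<partial>M)"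
        using elim(1) by (intro nn_integral_cong_AE) auto
      also have "\<dots> = ennreal (\<integral>\<omega>. (real_cond_exp M (G s) (q s) \<omega>)\<^sup>2 \<partial>M)"
        using c by (intro nn_integral_eq_integral) (auto simp: sqint_def)
      also have "\<dots> \<le> ennreal (\<integral>\<omega>. (q s \<omega>)\<^sup>2 \<partial>M)"
        by (intro ennreal_leI G.cond_exp_norm_le elim)
      also have "\<dots> = (\<integral>\<^sup>+\<omega>. ennreal ((q s \<omega>)\<^sup>2) \<partial>M)"
        using elim(2) by (intro nn_integral_eq_integral[symmetric]) (auto simp: sqint_def)
      finally show ?case .
    qed
  qed
  also have "\<dots> = (\<integral>\<^sup>+x. ennreal ((case_prod q x)\<^sup>2) \<partial>N)"
    using nn_integral_fst[of "\<lambda>x. ennreal ((case_prod q x)\<^sup>2)" "tspace T"] by simp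
  also have "\<dots> < \<infinity>" using q by (simp add: sqint_iff_nn)
  finally show ?thesis by (simp add: sqint_iff_nn p)
qed

text \<open>The progressive projection p of q is itself an admissible test. Conditioning at each
  time shows that p pairs with q as it does with itself, so p vanishes. This is the passage from the
  weak to the conditional first-order condition.\<close>

lemma orthogonal_Uset_cond_exp_zero:
  assumes q: "sqint N (case_prod q)"
    and orth: "\<And>w. w \<in> Uset T M F \<Longrightarrow> (\<integral>x. case_prod w x * case_prod q x \<partial>N) = 0"
  shows "AE s in tspace T. AE \<omega> in M. real_cond_exp M (F s) (q s) \<omega> = 0"
proof -
  note qm[measurable] = sqint_meas[OF q]
  have qs: "AE s in tspace T. sqint M (q s)" by (rule AE_sqint_slice[OF q])
  then have qi: "AE s in tspace T. integrable M (q s)" by eventually_elim (rule sqint_integrable)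
  obtain p where p: "progressive T F p"
    and pe: "AE s in tspace T. AE \<omega> in M. p s \<omega> = real_cond_exp M (F s) (q s) \<omega>"
    using progressive_projection[OF qm qi] by blast
  note pm[measurable] = progressive_joint[OF p]
  have psq: "sqint N (case_prod p)" by (rule sqint_cond_exp_process[OF q pm subalg pe])
  have "(\<integral>x. case_prod p x * case_prod p x \<partial>N) = (\<integral>s. \<integral>\<omega>. p s \<omega> * p s \<omega> \<partial>M \<partial>tspace T)"
    using P.integral_fst'[OF sqint_mult[OF psq psq]] by simp
  also have "\<dots> = (\<integral>s. \<integral>\<omega>. p s \<omega> * q s \<omega> \<partial>M \<partial>tspace T)"
  proof (rule integral_cong_AE)
    have "AE s in tspace T. s \<in> {0..T}" by (rule AE_I2) simp
    with pe qs AE_sqint_slice[OF psq]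
    show "AE s in tspace T. (\<integral>\<omega>. p s \<omega> * p s \<omega> \<partial>M) = (\<integral>\<omega>. p s \<omega> * q s \<omega> \<partial>M)"
    proof eventually_elim
      case (elim s)
      interpret S: finite_measure_subalgebra M "F s" by (rule fms[OF elim(4)])
      have "(\<integral>\<omega>. p s \<omega> * p s \<omega> \<partial>M) = (\<integral>\<omega>. p s \<omega> * real_cond_exp M (F s) (q s) \<omega> \<partial>M)"
        using elim(1) sqint_meas[OF elim(3)] by (intro integral_cong_AE) auto
      also have "\<dots> = (\<integral>\<omega>. p s \<omega> * q s \<omega> \<partial>M)"
        by (rule S.real_cond_exp_intg(2)[OF sqint_mult[OF elim(3,2)] progressive_adapted[OF p elim(4)] sqint_meas[OF elim(2)]])
      finally show ?case .
    qed
  qed measurable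
  also have "\<dots> = (\<integral>x. case_prod p x * case_prod q x \<partial>N)"
    using P.integral_fst'[OF sqint_mult[OF psq q]] by simp
  also have "\<dots> = 0" using p psq by (intro orth) (simp add: Uset_iff)
  finally have "AE x in N. case_prod p x = 0" by (rule sqint_zero_AE[OF psq])
  then have "AE s in tspace T. AE \<omega> in M. p s \<omega> = 0" by (auto dest: P.AE_pair)
  with pe show ?thesis
  proof eventually_elim
    case (elim s)
    then show ?case by eventually_elim simp
  qed
qed

end

section \<open>Quadratic control problems\<close>

context filtered_prob
begin

abbreviation sq :: "(real \<Rightarrow> 'a \<Rightarrow> real) \<Rightarrow> bool" where "sq u \<equiv> sqint N (case_prod u)"

definition ipN :: "(real \<Rightarrow> 'a \<Rightarrow> real) \<Rightarrow> (real \<Rightarrow> 'a \<Rightarrow> real) \<Rightarrow> real" where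
  "ipN u v = (\<integral>x. case_prod u x * case_prod v x \<partial>N)"

lemma sq_add: "sq u \<Longrightarrow> sq v \<Longrightarrow> sq (\<lambda>s \<omega>. u s \<omega> + v s \<omega>)"
  using sqint_add[of N "case_prod u" "case_prod v"] by (simp add: case_prod_beta')

lemma sq_diff: "sq u \<Longrightarrow> sq v \<Longrightarrow> sq (\<lambda>s \<omega>. u s \<omega> - v s \<omega>)"
  using sqint_diff[of N "case_prod u" "case_prod v"] by (simp add: case_prod_beta')

lemma sq_cmult: "sq u \<Longrightarrow> sq (\<lambda>s \<omega>. c * u s \<omega>)"
  using sqint_cmult[of N "case_prod u" c] by (simp add: case_prod_beta')

lemma ipN_commute: "ipN u v = ipN v u"
  unfolding ipN_def by (simp add: mult.commute)

lemma ipN_add: "sq u \<Longrightarrow> sq v \<Longrightarrow> sq w \<Longrightarrow> ipN w (\<lambda>s \<omega>. u s \<omega> + v s \<omega>) = ipN w u + ipN w v"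
  unfolding ipN_def using sqint_mult[of N "case_prod w" "case_prod u"] sqint_mult[of N "case_prod w" "case_prod v"]
  by (simp add: case_prod_beta' distrib_left)

lemma ipN_diff: "sq u \<Longrightarrow> sq v \<Longrightarrow> sq w \<Longrightarrow> ipN w (\<lambda>s \<omega>. u s \<omega> - v s \<omega>) = ipN w u - ipN w v"
  unfolding ipN_def using sqint_mult[of N "case_prod w" "case_prod u"] sqint_mult[of N "case_prod w" "case_prod v"]
  by (simp add: case_prod_beta' right_diff_distrib)

lemma ipN_cmult: "ipN w (\<lambda>s \<omega>. c * u s \<omega>) = c * ipN w u"
  unfolding ipN_def by (simp add: case_prod_beta' mult.left_commute[of _ c])

lemma ipN_add_left: "sq u \<Longrightarrow> sq v \<Longrightarrow> sq w \<Longrightarrow> ipN (\<lambda>s \<omega>. u s \<omega> + v s \<omega>) w = ipN u w + ipN v w"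
  using ipN_add[of u v w] by (simp add: ipN_commute[of _ w])

lemma ipN_diff_left: "sq u \<Longrightarrow> sq v \<Longrightarrow> sq w \<Longrightarrow> ipN (\<lambda>s \<omega>. u s \<omega> - v s \<omega>) w = ipN u w - ipN v w"
  using ipN_diff[of u v w] by (simp add: ipN_commute[of _ w])

lemma ipN_cmult_left: "ipN (\<lambda>s \<omega>. c * u s \<omega>) w = c * ipN u w"
  using ipN_cmult[of w c u] by (simp add: ipN_commute[of _ w])

lemma ipN_self: "ipN u u = (\<integral>x. (case_prod u x)\<^sup>2 \<partial>N)"
  unfolding ipN_def by (simp add: power2_eq_square)

lemma ipN_self_nonneg: "0 \<le> ipN u u"
  unfolding ipN_self by simp

lemma ipN_cauchy_schwarz: "sq u \<Longrightarrow> sq v \<Longrightarrow> (ipN u v)\<^sup>2 \<le> ipN u u * ipN v v"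
  unfolding ipN_self using sqint_cauchy_schwarz[of N "case_prod u" "case_prod v"] by (simp add: ipN_def)

lemma ipN_cong_AE:
  assumes "sq u" "sq v" "sq w" "AE x in N. case_prod u x = case_prod v x"
  shows "ipN w u = ipN w v"
  unfolding ipN_def using assms(4) assms(1-3)[THEN sqint_meas]
  by (intro integral_cong_AE) auto

lemma
  assumes "sq u" "sq v"
  shows integrable_ipT: "integrable M (\<lambda>\<omega>. ipT T (\<lambda>s. u s \<omega>) (\<lambda>s. v s \<omega>))"
    and ipN_eq_ipT: "(\<integral>\<omega>. ipT T (\<lambda>s. u s \<omega>) (\<lambda>s. v s \<omega>) \<partial>M) = ipN u v"
proof -
  have "integrable N (\<lambda>(s, \<omega>). u s \<omega> * v s \<omega>)"
    using sqint_mult[OF assms] by (simp add: case_prod_beta')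
  from P.integrable_snd[OF this] P.integral_snd[OF this]
  show "integrable M (\<lambda>\<omega>. ipT T (\<lambda>s. u s \<omega>) (\<lambda>s. v s \<omega>))"
    "(\<integral>\<omega>. ipT T (\<lambda>s. u s \<omega>) (\<lambda>s. v s \<omega>) \<partial>M) = ipN u v"
    by (simp_all add: ipT_eq ipN_def case_prod_beta')
qed

section \<open>Kernels acting on processes\<close>

definition kproc :: "(real \<Rightarrow> real \<Rightarrow> real) \<Rightarrow> (real \<Rightarrow> 'a \<Rightarrow> real) \<Rightarrow> real \<Rightarrow> 'a \<Rightarrow> real" where
  "kproc K u s \<omega> = kop T K (\<lambda>r. u r \<omega>) s"

text \<open>A kernel operator gains regularity in time: square integrability of the input over time
  and scenarios controls the output at every single time. This later bounds deviations slice by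
  slice.\<close>

lemma kproc_slice:
  assumes K: "bdd_kernel T C K" and u: "sq u" and s: "s \<in> {0..T}"
  shows "sqint M (kproc K u s)" "(\<integral>\<omega>. (kproc K u s \<omega>)\<^sup>2 \<partial>M) \<le> C * ipN u u"
proof -
  note um[measurable] = sqint_meas[OF u]
  have km: "case_prod (kproc K u) \<in> borel_measurable N"
    unfolding kproc_def using kop_measurable[OF bdd_kernelD(1)[OF K] um] by simp
  have m: "kproc K u s \<in> borel_measurable M"
    by (rule slice_measurable[OF km s])
  have "(\<integral>\<^sup>+\<omega>. ennreal ((kproc K u s \<omega>)\<^sup>2) \<partial>M) \<le> (\<integral>\<^sup>+\<omega>. ennreal C * (\<integral>\<^sup>+r. ennreal ((u r \<omega>)\<^sup>2) \<partial>tspace T) \<partial>M)"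
    unfolding kproc_def by (intro nn_integral_mono kop_power2_le_nn[OF K path_measurable[OF um] s]) auto
  also have "\<dots> = ennreal C * (\<integral>\<^sup>+\<omega>. (\<integral>\<^sup>+r. ennreal ((u r \<omega>)\<^sup>2) \<partial>tspace T) \<partial>M)"
    by (rule nn_integral_cmult) measurable
  also have "(\<integral>\<^sup>+\<omega>. (\<integral>\<^sup>+r. ennreal ((u r \<omega>)\<^sup>2) \<partial>tspace T) \<partial>M) = (\<integral>\<^sup>+x. ennreal ((case_prod u x)\<^sup>2) \<partial>N)"
    using P.nn_integral_snd[of "\<lambda>x. ennreal ((case_prod u x)\<^sup>2)"] by simp
  also have "\<dots> = ennreal (ipN u u)"
    unfolding ipN_self using sqint_integrable_power2[OF u] by (intro nn_integral_eq_integral) auto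
  also have "ennreal C * ennreal (ipN u u) = ennreal (C * ipN u u)"
    using bdd_kernelD(2)[OF K] ipN_self_nonneg by (simp add: ennreal_mult')
  finally have le: "(\<integral>\<^sup>+\<omega>. ennreal ((kproc K u s \<omega>)\<^sup>2) \<partial>M) \<le> ennreal (C * ipN u u)" .
  then show sqs: "sqint M (kproc K u s)"
    using m by (auto simp: sqint_iff_nn intro: le_less_trans)
  have "0 \<le> C * ipN u u"
    using bdd_kernelD(2)[OF K] ipN_self_nonneg[of u] by simp
  then show "(\<integral>\<omega>. (kproc K u s \<omega>)\<^sup>2 \<partial>M) \<le> C * ipN u u"
    using le sqint_integrable_power2[OF sqs] by (subst (asm) nn_integral_eq_integral) auto
qed

lemma
  assumes K: "bdd_kernel T C K" and u: "sq u"
  shows sq_kproc: "sq (kproc K u)"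
    and kproc_norm_le: "ipN (kproc K u) (kproc K u) \<le> C * T * ipN u u"
proof -
  note um[measurable] = sqint_meas[OF u]
  have km[measurable]: "case_prod (kproc K u) \<in> borel_measurable N"
    unfolding kproc_def using kop_measurable[OF bdd_kernelD(1)[OF K] um] by simp
  have C: "0 \<le> C * ipN u u"
    using bdd_kernelD(2)[OF K] ipN_self_nonneg[of u] by simp
  have mT: "emeasure (tspace T) {0..T} = ennreal T"
    using T_pos by (simp add: tspace_def emeasure_restrict_space)
  have "(\<integral>\<^sup>+x. ennreal ((case_prod (kproc K u) x)\<^sup>2) \<partial>N) = (\<integral>\<^sup>+s. \<integral>\<^sup>+\<omega>. ennreal ((kproc K u s \<omega>)\<^sup>2) \<partial>M \<partial>tspace T)"
    using nn_integral_fst[of "\<lambda>x. ennreal ((case_prod (kproc K u) x)\<^sup>2)" "tspace T"] by simp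
  also have "\<dots> \<le> (\<integral>\<^sup>+s. ennreal (C * ipN u u) \<partial>tspace T)"
  proof (rule nn_integral_mono)
    fix s assume "s \<in> space (tspace T)"
    then have s: "s \<in> {0..T}" by simp
    show "(\<integral>\<^sup>+\<omega>. ennreal ((kproc K u s \<omega>)\<^sup>2) \<partial>M) \<le> ennreal (C * ipN u u)"
      using kproc_slice[OF K u s] C
      by (subst nn_integral_eq_integral) (auto simp: sqint_def intro!: ennreal_leI)
  qed
  also have "\<dots> = ennreal (C * T * ipN u u)"
    using C T_pos by (simp add: mT mult_ac flip: ennreal_mult')
  finally have le: "(\<integral>\<^sup>+x. ennreal ((case_prod (kproc K u) x)\<^sup>2) \<partial>N) \<le> ennreal (C * T * ipN u u)" .
  then show sqk: "sq (kproc K u)"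
    using km by (auto simp: sqint_iff_nn intro: le_less_trans)
  have "0 \<le> C * T * ipN u u" using bdd_kernelD(2)[OF K] ipN_self_nonneg[of u] T_pos by simp
  then show "ipN (kproc K u) (kproc K u) \<le> C * T * ipN u u"
    unfolding ipN_self[of "kproc K u"]
    using le sqint_integrable_power2[OF sqk] by (subst (asm) nn_integral_eq_integral) auto
qed

text \<open>Only almost everywhere: along an exceptional path that is not square integrable the
  integrals may take default values and additivity may fail.\<close>

lemma kproc_add:
  assumes K: "bdd_kernel T C K" and u: "sq u" and v: "sq v"
  shows "AE x in N. case_prod (kproc K (\<lambda>s \<omega>. u s \<omega> + v s \<omega>)) x = case_prod (kproc K u) x + case_prod (kproc K v) x"
proof -
  have uv: "sq (\<lambda>s \<omega>. u s \<omega> + v s \<omega>)" by (rule sq_add[OF u v])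
  have s: "sq (\<lambda>s \<omega>. kproc K u s \<omega> + kproc K v s \<omega>)"
    by (intro sq_add sq_kproc[OF K] u v)
  have "AE \<omega> in M. AE s in tspace T. kproc K (\<lambda>s \<omega>. u s \<omega> + v s \<omega>) s \<omega> = kproc K u s \<omega> + kproc K v s \<omega>"
    using AE_sqint_path[OF u] AE_sqint_path[OF v]
    by eventually_elim (auto intro!: AE_I2 simp: kproc_def kop_add[OF K])
  then have "AE x in N. case_prod (kproc K (\<lambda>s \<omega>. u s \<omega> + v s \<omega>)) x = case_prod (\<lambda>s \<omega>. kproc K u s \<omega> + kproc K v s \<omega>) x"
    using AE_eq_iff AE_eq_commute sqint_meas[OF sq_kproc[OF K uv]] sqint_meas[OF s] by blast
  then show ?thesis by (simp add: case_prod_beta')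
qed

lemma kproc_cmult: "kproc K (\<lambda>s \<omega>. c * u s \<omega>) = (\<lambda>s \<omega>. c * kproc K u s \<omega>)"
  unfolding kproc_def by (simp add: kop_cmult fun_eq_iff)

lemma kproc_duality:
  assumes K: "bdd_kernel T C K" and u: "sq u" and v: "sq v"
  shows "ipN u (kproc K v) = ipN v (kproc (\<lambda>s r. K r s) u)"
proof -
  note k = sq_kproc[OF K v] sq_kproc[OF bdd_kernel_transpose[OF K] u]
  have "ipN u (kproc K v) = (\<integral>\<omega>. ipT T (\<lambda>s. u s \<omega>) (\<lambda>s. kproc K v s \<omega>) \<partial>M)"
    by (rule ipN_eq_ipT[OF u k(1), symmetric])
  also have "\<dots> = (\<integral>\<omega>. ipT T (\<lambda>s. v s \<omega>) (\<lambda>s. kproc (\<lambda>s r. K r s) u s \<omega>) \<partial>M)"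
  proof (rule integral_cong_AE)
    show "AE \<omega> in M. ipT T (\<lambda>s. u s \<omega>) (\<lambda>s. kproc K v s \<omega>) = ipT T (\<lambda>s. v s \<omega>) (\<lambda>s. kproc (\<lambda>s r. K r s) u s \<omega>)"
      using AE_sqint_path[OF u] AE_sqint_path[OF v]
    proof eventually_elim
      case (elim \<omega>)
      then show ?case
        using kop_duality[OF K elim] by (simp add: ipT_eq kproc_def mult.commute)
    qed
  qed (use integrable_ipT[OF u k(1)] integrable_ipT[OF v k(2)] in auto)
  also have "\<dots> = ipN v (kproc (\<lambda>s r. K r s) u)"
    by (rule ipN_eq_ipT[OF v k(2)])
  finally show ?thesis .
qed

lemma kproc_psd:
  assumes K: "vkernel T C K" and u: "sq u"
  shows "0 \<le> ipN u (kproc K u)"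
proof -
  note b = vkernelD(1)[OF K]
  have "0 \<le> (\<integral>\<omega>. ipT T (\<lambda>s. u s \<omega>) (\<lambda>s. kproc K u s \<omega>) \<partial>M)"
    using AE_sqint_path[OF u]
    by (intro integral_nonneg_AE, eventually_elim) (simp add: ipT_eq kproc_def vkernelD(3)[OF K])
  then show ?thesis using ipN_eq_ipT[OF u sq_kproc[OF b u]] by simp
qed

text \<open>Twice the symmetric part of \<open>lam\<close> id + K, that is, the gradient of the
  quadratic cost before conditioning. No conditional expectation appears because testing against
  \<open>Uset\<close> supplies it.\<close>

definition Lop :: "real \<Rightarrow> (real \<Rightarrow> real \<Rightarrow> real) \<Rightarrow> (real \<Rightarrow> 'a \<Rightarrow> real) \<Rightarrow> real \<Rightarrow> 'a \<Rightarrow> real" where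
  "Lop lam K u s \<omega> = 2 * lam * u s \<omega> + kproc K u s \<omega> + kproc (\<lambda>s r. K r s) u s \<omega>"

lemma sq_Lop:
  assumes K: "bdd_kernel T C K" and u: "sq u"
  shows "sq (Lop lam K u)"
  unfolding Lop_def[abs_def]
  by (intro sq_add sq_cmult u sq_kproc[OF K] sq_kproc[OF bdd_kernel_transpose[OF K]])

lemma ipN_Lop:
  assumes K: "bdd_kernel T C K" and u: "sq u" and w: "sq w"
  shows "ipN w (Lop lam K u) = 2 * lam * ipN w u + ipN w (kproc K u) + ipN w (kproc (\<lambda>s r. K r s) u)"
proof -
  note k = sq_kproc[OF K u] sq_kproc[OF bdd_kernel_transpose[OF K] u]
  show ?thesis
    unfolding Lop_def[abs_def]
    by (simp add: ipN_add ipN_cmult sq_add sq_cmult k u w)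
qed

lemma ipN_kproc_add:
  assumes K: "bdd_kernel T C K" and u: "sq u" and v: "sq v" and w: "sq w"
  shows "ipN w (kproc K (\<lambda>s \<omega>. u s \<omega> + v s \<omega>)) = ipN w (kproc K u) + ipN w (kproc K v)"
proof -
  have "ipN w (kproc K (\<lambda>s \<omega>. u s \<omega> + v s \<omega>)) = ipN w (\<lambda>s \<omega>. kproc K u s \<omega> + kproc K v s \<omega>)"
    using kproc_add[OF K u v] by (intro ipN_cong_AE sq_add sq_kproc[OF K] u v w) (simp add: case_prod_beta')
  also have "\<dots> = ipN w (kproc K u) + ipN w (kproc K v)"
    by (intro ipN_add sq_kproc[OF K] u v w)
  finally show ?thesis .
qed

lemma ipN_Lop_add:
  assumes K: "bdd_kernel T C K" and u: "sq u" and v: "sq v" and w: "sq w"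
  shows "ipN w (Lop lam K (\<lambda>s \<omega>. u s \<omega> + v s \<omega>)) = ipN w (Lop lam K u) + ipN w (Lop lam K v)"
  using ipN_kproc_add[OF K u v w] ipN_kproc_add[OF bdd_kernel_transpose[OF K] u v w]
  by (simp add: ipN_Lop[OF K] sq_add u v w ipN_add distrib_left)

lemma Lop_cmult: "Lop lam K (\<lambda>s \<omega>. c * u s \<omega>) = (\<lambda>s \<omega>. c * Lop lam K u s \<omega>)"
  unfolding Lop_def kproc_cmult by (simp add: fun_eq_iff algebra_simps)

lemma ipN_Lop_sym:
  assumes K: "bdd_kernel T C K" and u: "sq u" and w: "sq w"
  shows "ipN w (Lop lam K u) = ipN u (Lop lam K w)"
  using kproc_duality[OF K w u] kproc_duality[OF K u w]
  by (simp add: ipN_Lop[OF K] u w ipN_commute[of w u])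

lemma ipN_Lop_coercive:
  assumes K: "vkernel T C K" and u: "sq u"
  shows "2 * lam * ipN u u \<le> ipN u (Lop lam K u)"
  using kproc_psd[OF K u] kproc_duality[OF vkernelD(1)[OF K] u u]
  by (simp add: ipN_Lop[OF vkernelD(1)[OF K]] u)

lemma ipN_Lop_nonneg:
  assumes "vkernel T C K" "sq u" "lam > 0"
  shows "0 \<le> ipN u (Lop lam K u)"
proof -
  have "0 \<le> 2 * lam * ipN u u" using assms(3) ipN_self_nonneg[of u] by simp
  then show ?thesis using ipN_Lop_coercive[OF assms(1,2), of lam] by (rule order_trans)
qed

lemma ipN_add_self_le:
  assumes "sq u" "sq v"
  shows "ipN (\<lambda>s \<omega>. u s \<omega> + v s \<omega>) (\<lambda>s \<omega>. u s \<omega> + v s \<omega>) \<le> 2 * ipN u u + 2 * ipN v v"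
  unfolding ipN_self using sqint_add_bound[OF assms(1) order_refl assms(2) order_refl]
  by (simp add: case_prod_beta')

text \<open>Two uses of (x + y)^2 \<le> 2 x^2 + 2 y^2 give the weights 4, 4 and 2 for the three
  summands, hence 16 lam^2 + 4 C T + 2 C T.\<close>

lemma ipN_Lop_norm_le:
  assumes K: "bdd_kernel T C K" and u: "sq u"
  shows "ipN (Lop lam K u) (Lop lam K u) \<le> (16 * lam\<^sup>2 + 6 * (C * T)) * ipN u u"
proof -
  note k = sq_kproc[OF K u] sq_kproc[OF bdd_kernel_transpose[OF K] u]
  have "ipN (Lop lam K u) (Lop lam K u) \<le> 2 * ipN (\<lambda>s \<omega>. 2 * lam * u s \<omega> + kproc K u s \<omega>) (\<lambda>s \<omega>. 2 * lam * u s \<omega> + kproc K u s \<omega>)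
      + 2 * ipN (kproc (\<lambda>s r. K r s) u) (kproc (\<lambda>s r. K r s) u)"
    unfolding Lop_def[abs_def] by (intro ipN_add_self_le sq_add sq_cmult u k)
  also have "\<dots> \<le> 2 * (2 * ipN (\<lambda>s \<omega>. 2 * lam * u s \<omega>) (\<lambda>s \<omega>. 2 * lam * u s \<omega>) + 2 * ipN (kproc K u) (kproc K u))
      + 2 * ipN (kproc (\<lambda>s r. K r s) u) (kproc (\<lambda>s r. K r s) u)"
    by (intro add_right_mono mult_left_mono ipN_add_self_le sq_cmult u k) simp
  also have "ipN (\<lambda>s \<omega>. 2 * lam * u s \<omega>) (\<lambda>s \<omega>. 2 * lam * u s \<omega>) = 4 * lam\<^sup>2 * ipN u u"
    by (simp add: ipN_cmult ipN_cmult_left power2_eq_square)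
  finally have "ipN (Lop lam K u) (Lop lam K u)
      \<le> 2 * (2 * (4 * lam\<^sup>2 * ipN u u) + 2 * ipN (kproc K u) (kproc K u)) + 2 * ipN (kproc (\<lambda>s r. K r s) u) (kproc (\<lambda>s r. K r s) u)" .
  moreover have "(16 * lam\<^sup>2 + 6 * (C * T)) * ipN u u = 16 * (lam\<^sup>2 * ipN u u) + 6 * (C * T * ipN u u)"
    by (simp add: algebra_simps)
  moreover have "2 * (2 * (4 * lam\<^sup>2 * ipN u u) + 2 * ipN (kproc K u) (kproc K u)) + 2 * ipN (kproc (\<lambda>s r. K r s) u) (kproc (\<lambda>s r. K r s) u)
      = 16 * (lam\<^sup>2 * ipN u u) + 4 * ipN (kproc K u) (kproc K u) + 2 * ipN (kproc (\<lambda>s r. K r s) u) (kproc (\<lambda>s r. K r s) u)"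
    by simp
  ultimately show ?thesis
    using kproc_norm_le[OF K u] kproc_norm_le[OF bdd_kernel_transpose[OF K] u] by linarith
qed

text \<open>Euler-Lagrange equation in weak form. The datum y may be non-adapted, since only its
  pairing with adapted processes matters; this lets \<open>target\<close> keep future values of the
  mean field.\<close>

definition weak_FOC :: "real \<Rightarrow> (real \<Rightarrow> real \<Rightarrow> real) \<Rightarrow> (real \<Rightarrow> 'a \<Rightarrow> real) \<Rightarrow> (real \<Rightarrow> 'a \<Rightarrow> real) \<Rightarrow> bool" where
  "weak_FOC lam K y u \<longleftrightarrow> u \<in> Uset T M F \<and> (\<forall>w\<in>Uset T M F. ipN w (Lop lam K u) = ipN w y)"

section \<open>Solvability of the weak condition\<close>

lemma Uset_sq: "u \<in> Uset T M F \<Longrightarrow> sq u"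
  by (simp add: Uset_iff)

lemma Uset_add: "u \<in> Uset T M F \<Longrightarrow> v \<in> Uset T M F \<Longrightarrow> (\<lambda>s \<omega>. u s \<omega> + v s \<omega>) \<in> Uset T M F"
  by (simp add: Uset_iff progressive_add sq_add)

lemma Uset_cmult: "u \<in> Uset T M F \<Longrightarrow> (\<lambda>s \<omega>. c * u s \<omega>) \<in> Uset T M F"
  by (simp add: Uset_iff progressive_cmult sq_cmult)

lemma Uset_diff: "u \<in> Uset T M F \<Longrightarrow> v \<in> Uset T M F \<Longrightarrow> (\<lambda>s \<omega>. u s \<omega> - v s \<omega>) \<in> Uset T M F"
  using Uset_add[of u "\<lambda>s \<omega>. (-1) * v s \<omega>"] Uset_cmult[of v "-1"] by simp

lemma Uset_zero: "(\<lambda>s \<omega>. 0) \<in> Uset T M F"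
proof -
  have "progressive T F (\<lambda>s \<omega>. 0)" by (rule progressiveI) simp
  then show ?thesis by (simp add: Uset_iff sqint_def)
qed

lemma Uset_sum: "(\<And>i. i \<in> I \<Longrightarrow> u i \<in> Uset T M F) \<Longrightarrow> (\<lambda>s \<omega>. \<Sum>i\<in>I. u i s \<omega>) \<in> Uset T M F"
  by (induction I rule: infinite_finite_induct) (auto intro: Uset_zero Uset_add)

text \<open>The direct method on the subspace of progressive square integrable processes, which is
  closed by \<open>progressive_lim\<close>. Coercivity comes from positivity of the kernel rather
  than from smallness.\<close>

lemma weak_FOC_exists:
  assumes K: "vkernel T C K" and lam: "lam > 0" and y: "sq y"
  shows "\<exists>u. weak_FOC lam K y u"
proof -
  note b = vkernelD(1)[OF K]
  let ?V = "case_prod ` Uset T M F"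
  \<comment> \<open>\<open>symmetric_lax_milgram\<close> speaks of functions on the product space,
    \<open>Lop\<close> of processes; \<open>curry\<close> translates between the two.\<close>
  let ?a = "\<lambda>f g. ipN (curry g) (Lop lam K (curry f))"
  have c: "case_prod (curry f) = f" for f :: "real \<times> 'a \<Rightarrow> real" by (rule case_prod_curry)
  have VU: "f \<in> ?V \<longleftrightarrow> curry f \<in> Uset T M F" for f
    by (auto simp: image_iff) (metis case_prod_curry)
  have Vs: "sq (curry f)" "sqint N f" if "f \<in> ?V" for f
    using that Uset_sq[of "curry f"] by (auto simp: VU)
  have cadd: "curry (\<lambda>x. f x + g x) = (\<lambda>s \<omega>. curry f s \<omega> + curry g s \<omega>)" for f g :: "real \<times> 'a \<Rightarrow> real"
    by (simp add: fun_eq_iff)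
  have cmul: "curry (\<lambda>x. k * f x) = (\<lambda>s \<omega>. k * curry f s \<omega>)" for k and f :: "real \<times> 'a \<Rightarrow> real"
    by (simp add: fun_eq_iff)
  have nrm: "(\<integral>x. (f x)\<^sup>2 \<partial>N) = ipN (curry f) (curry f)" for f
    by (simp add: ipN_self)
  have "\<exists>u\<in>?V. \<forall>w\<in>?V. ?a u w = (\<integral>x. case_prod y x * w x \<partial>N)"
  proof (rule N.symmetric_lax_milgram[where \<alpha> = "2 * lam" and A = "16 * lam\<^sup>2 + 6 * (C * T)"])
    show "(\<lambda>x. 0) \<in> ?V" using Uset_zero by (simp add: VU curry_def)
    show "(\<lambda>x. v x + w x) \<in> ?V" if "v \<in> ?V" "w \<in> ?V" for v w
      using that unfolding VU cadd by (rule Uset_add)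
    show "(\<lambda>x. k * v x) \<in> ?V" if "v \<in> ?V" for k v
      using that unfolding VU cmul by (rule Uset_cmult)
    show "(\<lambda>x. lim (\<lambda>n. f n x)) \<in> ?V" if f: "\<And>n. f n \<in> ?V" and l: "sqint N (\<lambda>x. lim (\<lambda>n. f n x))" for f :: "nat \<Rightarrow> _"
    proof -
      have "progressive T F (curry (f n))" for n using f[of n] unfolding VU Uset_iff by simp
      from progressive_lim[OF this] have "progressive T F (curry (\<lambda>x. lim (\<lambda>n. f n x)))" by (simp add: curry_def)
      then show ?thesis using l unfolding VU Uset_iff by simp
    qed
    show "?a (\<lambda>x. u x + v x) w = ?a u w + ?a v w" if "u \<in> ?V" "v \<in> ?V" "w \<in> ?V" for u v w
      unfolding cadd by (rule ipN_Lop_add[OF b Vs(1) Vs(1) Vs(1)]) fact+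
    show "?a (\<lambda>x. k * u x) w = k * ?a u w" for k u w
      unfolding cmul Lop_cmult by (rule ipN_cmult)
    show "?a u w = ?a w u" if "u \<in> ?V" "w \<in> ?V" for u w
      by (rule ipN_Lop_sym[OF b Vs(1) Vs(1)]) fact+
    show "(?a u w)\<^sup>2 \<le> (16 * lam\<^sup>2 + 6 * (C * T)) * (\<integral>x. (u x)\<^sup>2 \<partial>N) * (\<integral>x. (w x)\<^sup>2 \<partial>N)"
      if u: "u \<in> ?V" and w: "w \<in> ?V" for u w
    proof -
      have "(?a u w)\<^sup>2 \<le> ipN (curry w) (curry w) * ipN (Lop lam K (curry u)) (Lop lam K (curry u))"
        by (intro ipN_cauchy_schwarz sq_Lop[OF b] Vs(1) u w)
      also have "\<dots> \<le> ipN (curry w) (curry w) * ((16 * lam\<^sup>2 + 6 * (C * T)) * ipN (curry u) (curry u))"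
        by (intro mult_left_mono ipN_Lop_norm_le[OF b] Vs(1) u ipN_self_nonneg)
      finally show ?thesis by (simp add: nrm mult_ac)
    qed
    show "2 * lam * (\<integral>x. (u x)\<^sup>2 \<partial>N) \<le> ?a u u" if "u \<in> ?V" for u
      unfolding nrm by (rule ipN_Lop_coercive[OF K Vs(1)[OF that]])
  qed (use lam y Vs in auto)
  then obtain u where u: "u \<in> ?V" and eq: "\<And>w. w \<in> ?V \<Longrightarrow> ?a u w = (\<integral>x. case_prod y x * w x \<partial>N)" by blast
  have "weak_FOC lam K y (curry u)"
    unfolding weak_FOC_def
  proof (intro conjI ballI)
    show "curry u \<in> Uset T M F" using u by (simp add: VU)
    fix w assume w: "w \<in> Uset T M F"
    show "ipN w (Lop lam K (curry u)) = ipN w y"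
      using eq[of "case_prod w"] w by (simp add: ipN_def mult.commute)
  qed
  then show ?thesis by (rule exI[of _ "curry u"])
qed

section \<open>Best responses\<close>

definition target :: "(real \<Rightarrow> real \<Rightarrow> real) \<Rightarrow> (real \<Rightarrow> 'a \<Rightarrow> real) \<Rightarrow> (real \<Rightarrow> 'a \<Rightarrow> real) \<Rightarrow> real \<Rightarrow> 'a \<Rightarrow> real" where
  "target A3 \<nu> \<beta> s \<omega> = \<beta> s \<omega> - kproc (\<lambda>s r. A3 s r + A3 r s) \<nu> s \<omega>"

lemma sq_target:
  assumes "bdd_kernel T C A3" "sq \<nu>" "sq \<beta>"
  shows "sq (target A3 \<nu> \<beta>)"
  unfolding target_def[abs_def]
  by (intro sq_diff assms sq_kproc[OF bdd_kernel_add[OF assms(1) bdd_kernel_transpose[OF assms(1)]]])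

text \<open>The player's own control enters through one quadratic and one linear term; k collects
  the rest and is quantified before v, so that it cancels when strategies are compared.\<close>

lemma Jinf_eq:
  assumes A1: "bdd_kernel T C1 A1" and A2: "bdd_kernel T C2 A2" and A3: "bdd_kernel T C3 A3"
    and b: "sq (b i)" "sq (b 0)" and c: "integrable M (c i)" and \<nu>: "sq \<nu>"
  shows "\<exists>k. \<forall>v. sq v \<longrightarrow>
    Jinf T M A1 lam A2 A3 b c i v \<nu> = k - ipN v (Lop lam A2 v) / 2 + ipN v (target A3 \<nu> (b i))"
proof (rule exI, intro allI impI)
  fix v assume v: "sq v"
  let ?H = "\<lambda>s r. A3 s r + A3 r s"
  note H = bdd_kernel_add[OF A3 bdd_kernel_transpose[OF A3]]
  have l: "sq (\<lambda>s \<omega>. lam * v s \<omega> + kproc A2 v s \<omega>)" by (intro sq_add sq_cmult v sq_kproc[OF A2])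
  note int = integrable_ipT[OF \<nu> sq_kproc[OF A1 \<nu>]] integrable_ipT[OF v l]
    integrable_ipT[OF v sq_kproc[OF H \<nu>]] integrable_ipT[OF b(1) v] integrable_ipT[OF b(2) \<nu>]
  note eqs = ipN_eq_ipT[OF \<nu> sq_kproc[OF A1 \<nu>]] ipN_eq_ipT[OF v l]
    ipN_eq_ipT[OF v sq_kproc[OF H \<nu>]] ipN_eq_ipT[OF b(1) v] ipN_eq_ipT[OF b(2) \<nu>]
  have e: "kop T A1 (\<lambda>s. \<nu> s \<omega>) = (\<lambda>s. kproc A1 \<nu> s \<omega>)" "kop T A2 (\<lambda>s. v s \<omega>) = (\<lambda>s. kproc A2 v s \<omega>)"
    "kop T ?H (\<lambda>s. \<nu> s \<omega>) = (\<lambda>s. kproc ?H \<nu> s \<omega>)" for \<omega>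
    by (auto simp: kproc_def)
  have "Jinf T M A1 lam A2 A3 b c i v \<nu> = - ipN \<nu> (kproc A1 \<nu>) - ipN v (\<lambda>s \<omega>. lam * v s \<omega> + kproc A2 v s \<omega>)
      - ipN v (kproc ?H \<nu>) + ipN (b i) v + ipN (b 0) \<nu> + (\<integral>\<omega>. c i \<omega> \<partial>M)"
    unfolding Jinf_def e using int c by (simp add: eqs)
  \<comment> \<open>By duality the one-sided form is half the symmetrised one.\<close>
  also have "ipN v (\<lambda>s \<omega>. lam * v s \<omega> + kproc A2 v s \<omega>) = ipN v (Lop lam A2 v) / 2"
    using kproc_duality[OF A2 v v]
    by (simp add: ipN_Lop[OF A2 v v] ipN_add ipN_cmult sq_cmult sq_kproc[OF A2 v] v)
  also have "ipN (b i) v = ipN v (target A3 \<nu> (b i)) + ipN v (kproc ?H \<nu>)"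
    unfolding target_def[abs_def] using b v sq_kproc[OF H \<nu>]
    by (simp add: ipN_diff ipN_commute)
  finally show "Jinf T M A1 lam A2 A3 b c i v \<nu> = (- ipN \<nu> (kproc A1 \<nu>) + ipN (b 0) \<nu> + (\<integral>\<omega>. c i \<omega> \<partial>M))
      - ipN v (Lop lam A2 v) / 2 + ipN v (target A3 \<nu> (b i))"
    by simp
qed

text \<open>The objective is exactly quadratic: moving from v by d changes it by a linear residual
  minus half the nonnegative form at d. A vanishing residual is thus sufficient, and it is necessary
  by \<open>quadratic_perturbation\<close> along multiples of w.\<close>

lemma best_response_iff:
  assumes A1: "bdd_kernel T C1 A1" and A2: "vkernel T C2 A2" and lam: "lam > 0" and A3: "bdd_kernel T C3 A3"
    and b: "sq (b i)" "sq (b 0)" and c: "integrable M (c i)" and \<nu>: "sq \<nu>" and v: "v \<in> Uset T M F"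
  shows "(\<forall>w\<in>Uset T M F. Jinf T M A1 lam A2 A3 b c i w \<nu> \<le> Jinf T M A1 lam A2 A3 b c i v \<nu>)
    \<longleftrightarrow> weak_FOC lam A2 (target A3 \<nu> (b i)) v"
proof -
  note A2b = vkernelD(1)[OF A2]
  let ?J = "\<lambda>w. Jinf T M A1 lam A2 A3 b c i w \<nu>" and ?y = "target A3 \<nu> (b i)"
  obtain k where J: "\<And>v. sq v \<Longrightarrow> ?J v = k - ipN v (Lop lam A2 v) / 2 + ipN v ?y"
    using Jinf_eq[OF A1 A2b A3, of b i c \<nu> lam, OF b c \<nu>] by blast
  have y: "sq ?y" by (rule sq_target[OF A3 \<nu> b(1)])
  have expand: "?J (\<lambda>s \<omega>. v s \<omega> + d s \<omega>) = ?J v - ipN d (Lop lam A2 d) / 2 + (ipN d ?y - ipN d (Lop lam A2 v))"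
    if d: "sq d" for d
  proof -
    note v' = Uset_sq[OF v]
    have "ipN (\<lambda>s \<omega>. v s \<omega> + d s \<omega>) (Lop lam A2 (\<lambda>s \<omega>. v s \<omega> + d s \<omega>))
        = ipN v (Lop lam A2 v) + ipN v (Lop lam A2 d) + (ipN d (Lop lam A2 v) + ipN d (Lop lam A2 d))"
      by (simp add: ipN_add_left ipN_Lop_add[OF A2b] sq_Lop[OF A2b] sq_add v' d)
    also have "ipN v (Lop lam A2 d) = ipN d (Lop lam A2 v)" by (rule ipN_Lop_sym[OF A2b d v'])
    finally show ?thesis
      by (simp add: J sq_add v' d ipN_add_left y add_divide_distrib)
  qed
  show ?thesis
  proof
    assume max: "\<forall>w\<in>Uset T M F. ?J w \<le> ?J v"
    have "ipN w (Lop lam A2 v) = ipN w ?y" if w: "w \<in> Uset T M F" for w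
    proof -
      have "ipN w ?y - ipN w (Lop lam A2 v) = 0"
      proof (rule quadratic_perturbation)
        show "0 \<le> ipN w (Lop lam A2 w) / 2"
          using ipN_Lop_nonneg[OF A2 Uset_sq[OF w]] lam by simp
        fix e
        have "?J (\<lambda>s \<omega>. v s \<omega> + e * w s \<omega>) \<le> ?J v"
          using max Uset_add[OF v Uset_cmult[OF w]] by blast
        then have "ipN (\<lambda>s \<omega>. e * w s \<omega>) ?y - ipN (\<lambda>s \<omega>. e * w s \<omega>) (Lop lam A2 v)
            \<le> ipN (\<lambda>s \<omega>. e * w s \<omega>) (Lop lam A2 (\<lambda>s \<omega>. e * w s \<omega>)) / 2"
          unfolding expand[OF sq_cmult[OF Uset_sq[OF w]]] by simp
        then show "e * (ipN w ?y - ipN w (Lop lam A2 v)) \<le> e\<^sup>2 * (ipN w (Lop lam A2 w) / 2)"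
          unfolding ipN_cmult_left Lop_cmult ipN_cmult by (simp add: power2_eq_square right_diff_distrib)
      qed
      then show ?thesis by simp
    qed
    then show "weak_FOC lam A2 ?y v" using v by (simp add: weak_FOC_def)
  next
    assume foc: "weak_FOC lam A2 ?y v"
    show "\<forall>w\<in>Uset T M F. ?J w \<le> ?J v"
    proof
      fix w assume w: "w \<in> Uset T M F"
      let ?d = "\<lambda>s \<omega>. w s \<omega> - v s \<omega>"
      have d: "?d \<in> Uset T M F" by (rule Uset_diff[OF w v])
      have "?J w = ?J (\<lambda>s \<omega>. v s \<omega> + ?d s \<omega>)" by simp
      also have "\<dots> = ?J v - ipN ?d (Lop lam A2 ?d) / 2 + (ipN ?d ?y - ipN ?d (Lop lam A2 v))"
        by (rule expand[OF Uset_sq[OF d]])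
      also have "ipN ?d ?y = ipN ?d (Lop lam A2 v)"
        using foc d by (simp add: weak_FOC_def)
      finally show "?J w \<le> ?J v"
        using ipN_Lop_nonneg[OF A2 Uset_sq[OF d], of lam] lam by simp
    qed
  qed
qed

end

section \<open>The resolvent equation\<close>

lemma sqint_before:
  assumes "sqint (tspace T) f"
  shows "sqint (tspace T) (\<lambda>s. indicator {..<t} s * f s)"
proof -
  have [measurable]: "(indicator {..<t} :: real \<Rightarrow> real) \<in> borel_measurable (tspace T)"
    by (rule borel_measurable_tspace) simp
  note [measurable] = sqint_meas[OF assms]
  show ?thesis
    by (rule sqint_bounded[OF assms]) (measurable, auto simp: indicator_def)
qed

lemma AE_tspace_neq: "AE s in tspace T. s \<noteq> t"
  by (subst AE_tspace[symmetric]) (use AE_lborel_singleton[of t] in \<open>auto elim: eventually_mono\<close>)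

text \<open>Freezing time \<open>t\<close> and the scenario, the first-order condition at later times is a linear equation
  for the conditional expectations \<open>m\<close> of the control; pairing it with \<open>phi\<close> eliminates \<open>m\<close>.\<close>

lemma pathwise_resolvent_equation:
  assumes K: "vkernel T C K" and lam: "lam > 0" and t: "t \<in> {0..T}"
    and m: "sqint (tspace T) m" and u: "sqint (tspace T) u" and X: "sqint (tspace T) X"
    and after: "AE s in tspace T. t \<le> s \<longrightarrow> 2 * lam * m s + kop T K m s + kop T (\<lambda>s r. K r s) m s = X s"
    and before: "AE r in tspace T. r \<le> t \<longrightarrow> m r = u r"
    and now: "2 * lam * ut + kop T K m t + kop T (\<lambda>s r. K r s) m t = xt"
  shows "ut - (\<integral>s. Bker T lam K t s * u s \<partial>tspace T) =
    (1 / (2 * lam)) * (xt - ipT T (\<lambda>r. indicator {t..} r * K r t) (Dinv T lam K t (\<lambda>s. indicator {t..} s * X s)))"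
proof -
  note b = vkernelD(1)[OF K] and bt = bdd_kernel_transpose[OF vkernelD(1)[OF K]]
  note V = vkernelD(2)[OF K]
  note p = sqint_phi[OF K lam t]
  define \<phi> where "\<phi> = phi T lam K t"
  \<comment> \<open>g is the future of the conditional expectations, which is to be eliminated; h is
    the strict past of the control, which stays.\<close>
  define g where "g s = indicator {t..} s * m s" for s
  define h where "h s = indicator {..<t} s * u s" for s
  have g: "sqint (tspace T) g" unfolding g_def by (rule sqint_tail[OF m])
  have h: "sqint (tspace T) h" unfolding h_def by (rule sqint_before[OF u])
  have \<phi>: "sqint (tspace T) \<phi>" unfolding \<phi>_def by (rule p)
  have i\<phi>: "sqint (tspace T) (\<lambda>s. indicator {t..} s * \<phi> s)" by (rule sqint_tail[OF \<phi>])
  have mgh: "AE r in tspace T. m r = g r + h r"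
    using before by eventually_elim (auto simp: g_def h_def indicator_def)
  have kop_gh: "kop T K m s = kop T K g s + kop T K h s" if s: "s \<in> {0..T}" for s
  proof -
    have [measurable]: "K s \<in> borel_measurable (tspace T)" using bdd_kernelD(3)[OF b s] by (rule sqint_meas)
    note [measurable] = sqint_meas[OF m] sqint_meas[OF g] sqint_meas[OF h]
    have "kop T K m s = kop T K (\<lambda>r. g r + h r) s"
      unfolding kop_eq using mgh by (intro integral_cong_AE) auto
    then show ?thesis using kop_add[OF b g h s] by simp
  qed
  have kopt: "kop T (\<lambda>s r. K r s) m s = kop T (\<lambda>s r. K r s) g s" if s: "s \<in> {0..T}" "t \<le> s" for s
    unfolding kop_eq using V[OF _ s(1)] s(2)
    by (intro Bochner_Integration.integral_cong) (auto simp: g_def indicator_def)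
  \<comment> \<open>For s \<ge> t the transposed operator sees only times after s and acts on g
    alone, while K sees g + h; the past term moves to the right. For s < t both sides are zero by
    the Volterra property.\<close>
  have Dg: "AE s in tspace T. Dop T lam K t g s = indicator {t..} s * (X s - kop T K h s)"
    using after AE_space
  proof eventually_elim
    case (elim s)
    then have s: "s \<in> {0..T}" by simp
    show ?case
    proof (cases "t \<le> s")
      case True
      have "kop T (Hker K t) g s = kop T (\<lambda>s r. K s r + K r s) g s"
        unfolding kop_eq using True
        by (intro Bochner_Integration.integral_cong) (auto simp: Hker_def g_def indicator_def)
      also have "\<dots> = kop T K g s + kop T (\<lambda>s r. K r s) g s" by (rule kop_kernel_add[OF b bt g s])
      finally show ?thesis
        using elim(1) True kop_gh[OF s] kopt[OF s True] by (simp add: Dop_eq g_def[of s])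
    next
      case False
      have "kop T (Hker K t) g s = (\<integral>r. 0 \<partial>tspace T)"
        unfolding kop_eq using False V[OF s]
        by (intro Bochner_Integration.integral_cong) (auto simp: Hker_def g_def indicator_def)
      then show ?thesis using False by (simp add: Dop_eq g_def[of s])
    qed
  qed
  have ints: "integrable (tspace T) (\<lambda>s. \<phi> s * (indicator {t..} s * X s))"
    "integrable (tspace T) (\<lambda>s. indicator {t..} s * \<phi> s * kop T K h s)"
    by (intro sqint_mult \<phi> sqint_tail[OF X] i\<phi> sqint_kop[OF b h])+
  have "(\<integral>s. indicator {t..} s * K s t * g s \<partial>tspace T) = (\<integral>s. \<phi> s * Dop T lam K t g s \<partial>tspace T)"
    unfolding \<phi>_def by (rule Dop_phi[OF K lam t g, symmetric])
  also have "\<dots> = (\<integral>s. \<phi> s * (indicator {t..} s * X s) - indicator {t..} s * \<phi> s * kop T K h s \<partial>tspace T)"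
  proof (rule integral_cong_AE)
    show "AE s in tspace T. \<phi> s * Dop T lam K t g s = \<phi> s * (indicator {t..} s * X s) - indicator {t..} s * \<phi> s * kop T K h s"
      using Dg by eventually_elim (simp add: right_diff_distrib mult_ac)
  qed (use sqint_mult[OF \<phi> sqint_Dop[OF b g]] ints in auto)
  also have "\<dots> = (\<integral>s. \<phi> s * (indicator {t..} s * X s) \<partial>tspace T) - (\<integral>s. indicator {t..} s * \<phi> s * kop T K h s \<partial>tspace T)"
    using ints by simp
  also have "(\<integral>s. \<phi> s * (indicator {t..} s * X s) \<partial>tspace T) =
      ipT T (\<lambda>r. indicator {t..} r * K r t) (Dinv T lam K t (\<lambda>s. indicator {t..} s * X s))"
    unfolding \<phi>_def by (rule ipT_Dinv[OF K lam t sqint_tail[OF X], symmetric])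
  finally have A: "(\<integral>s. indicator {t..} s * K s t * g s \<partial>tspace T) =
      ipT T (\<lambda>r. indicator {t..} r * K r t) (Dinv T lam K t (\<lambda>s. indicator {t..} s * X s))
      - (\<integral>s. indicator {t..} s * \<phi> s * kop T K h s \<partial>tspace T)" .
  have "kop T K g t = (\<integral>r. 0 \<partial>tspace T)"
    unfolding kop_eq using V[OF t] by (intro Bochner_Integration.integral_cong) (auto simp: g_def indicator_def)
  moreover have "kop T (\<lambda>s r. K r s) g t = (\<integral>s. indicator {t..} s * K s t * g s \<partial>tspace T)"
    unfolding kop_eq by (intro Bochner_Integration.integral_cong) (auto simp: g_def indicator_def)
  ultimately have B: "2 * lam * ut + kop T K h t + (\<integral>s. indicator {t..} s * K s t * g s \<partial>tspace T) = xt"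
    using now kop_gh[OF t] kopt[OF t] by simp
  have D: "(\<integral>s. indicator {t..} s * \<phi> s * kop T K h s \<partial>tspace T) = (\<integral>s. kop T (\<lambda>s r. K r s) (\<lambda>s. indicator {t..} s * \<phi> s) s * h s \<partial>tspace T)"
    by (rule kop_duality[OF b i\<phi> h])
  have ints2: "integrable (tspace T) (\<lambda>s. kop T (\<lambda>s r. K r s) (\<lambda>s. indicator {t..} s * \<phi> s) s * h s)"
    "integrable (tspace T) (\<lambda>s. K t s * h s)"
    by (intro sqint_mult h sqint_kop[OF bt i\<phi>] bdd_kernelD(3)[OF b t])+
  have "(\<integral>s. Bker T lam K t s * u s \<partial>tspace T)
      = (\<integral>s. (1 / (2 * lam)) * (kop T (\<lambda>s r. K r s) (\<lambda>s. indicator {t..} s * \<phi> s) s * h s - K t s * h s) \<partial>tspace T)"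
  proof (rule integral_cong_AE)
    show "AE s in tspace T. Bker T lam K t s * u s =
        (1 / (2 * lam)) * (kop T (\<lambda>s r. K r s) (\<lambda>s. indicator {t..} s * \<phi> s) s * h s - K t s * h s)"
      \<comment> \<open>\<open>Bker\<close> keeps s = t whereas h stops strictly before t; the
        single point is null.\<close>
      using AE_tspace_neq[of t T] AE_space
    proof eventually_elim
      case (elim s)
      then have s: "s \<in> {0..T}" by simp
      show ?case
      proof (cases "s < t")
        case True
        have "kop T (\<lambda>s r. K r s) (\<lambda>s. indicator {t..} s * \<phi> s) s = (\<integral>r. \<phi> r * (indicator {t..} r * K r s) \<partial>tspace T)"
          unfolding kop_eq by (simp add: mult_ac)
        then have B: "Bker T lam K t s = (1 / (2 * lam)) * (kop T (\<lambda>s r. K r s) (\<lambda>s. indicator {t..} s * \<phi> s) s - K t s)"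
          using Bker_eq[OF K lam t s] True by (simp add: \<phi>_def)
        have "h s = u s" using True by (simp add: h_def)
        then show ?thesis unfolding B by (simp only: left_diff_distrib mult.assoc)
      next
        case False
        then show ?thesis using elim by (simp add: Bker_def h_def)
      qed
    qed
    show "(\<lambda>s. Bker T lam K t s * u s) \<in> borel_measurable (tspace T)"
      using sqint_mult[OF sqint_Bker[OF K lam t] u] by auto
    show "(\<lambda>s. (1 / (2 * lam)) * (kop T (\<lambda>s r. K r s) (\<lambda>s. indicator {t..} s * \<phi> s) s * h s - K t s * h s)) \<in> borel_measurable (tspace T)"
      using ints2 by (intro borel_measurable_times borel_measurable_diff borel_measurable_integrable) auto
  qed
  also have "\<dots> = (1 / (2 * lam)) * ((\<integral>s. indicator {t..} s * \<phi> s * kop T K h s \<partial>tspace T) - kop T K h t)"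
    using ints2 by (simp add: D) (simp add: kop_eq)
  finally have E: "(\<integral>s. Bker T lam K t s * u s \<partial>tspace T) = (1 / (2 * lam)) * ((\<integral>s. indicator {t..} s * \<phi> s * kop T K h s \<partial>tspace T) - kop T K h t)" .
  have "ut = (1 / (2 * lam)) * (2 * lam * ut)" using lam by simp
  also have "2 * lam * ut = xt - kop T K h t - ipT T (\<lambda>r. indicator {t..} r * K r t) (Dinv T lam K t (\<lambda>s. indicator {t..} s * X s))
      + (\<integral>s. indicator {t..} s * \<phi> s * kop T K h s \<partial>tspace T)"
    using A B by linarith
  finally show ?thesis unfolding E by (simp only: right_diff_distrib distrib_left)
qed

section \<open>Gronwall's inequality in integrated form\<close>

lemma nn_integral_exp_tail:
  assumes "\<beta> > 0"
  shows "(\<integral>\<^sup>+t. ennreal (exp (- \<beta> * t)) * indicator {s..} t \<partial>tspace T) \<le> ennreal (exp (- \<beta> * s) / \<beta>)"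
proof -
  have "(\<integral>\<^sup>+t. ennreal (exp (- \<beta> * t)) * indicator {s..} t \<partial>tspace T)
      = (\<integral>\<^sup>+t. ennreal (exp (- \<beta> * t)) * indicator {s..} t * indicator {0..T} t \<partial>lborel)"
    by (rule nn_integral_tspace[symmetric])
  also have "\<dots> \<le> (\<integral>\<^sup>+t. ennreal (exp (- \<beta> * t)) * indicator {s..} t \<partial>lborel)"
    by (intro nn_integral_mono) (auto simp: indicator_def)
  also have "\<dots> = ennreal (0 - (- exp (- \<beta> * s) / \<beta>))"
  proof (rule nn_integral_FTC_atLeast)
    show "((\<lambda>t. - exp (- \<beta> * t) / \<beta>) has_real_derivative exp (- \<beta> * x)) (at x)" for x
      using assms by (auto intro!: derivative_eq_intros)
    have "((\<lambda>t. exp (- (\<beta> * t))) \<longlongrightarrow> 0) at_top"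
      using assms by (intro filterlim_compose[OF exp_at_bot]) 
        (auto simp: filterlim_uminus_at_bot intro!: filterlim_tendsto_pos_mult_at_top[OF tendsto_const] filterlim_ident)
    then have "((\<lambda>t. - exp (- (\<beta> * t)) / \<beta>) \<longlongrightarrow> - 0 / \<beta>) at_top"
      using assms by (intro tendsto_divide tendsto_minus tendsto_const) auto
    then show "((\<lambda>t. - exp (- \<beta> * t) / \<beta>) \<longlongrightarrow> 0) at_top" by simp
  qed auto
  finally show ?thesis by simp
qed

text \<open>With the weight exp(-2 C t) the Volterra bound shrinks the integral by the factor 1/2,
  and a finite quantity that is at most half of itself is zero. Values in \<open>ennreal\<close> let
  Tonelli be used freely.\<close>

lemma gronwall_zero:
  fixes G :: "real \<Rightarrow> ennreal"
  assumes G[measurable]: "G \<in> borel_measurable (tspace T)" and fin: "(\<integral>\<^sup>+t. G t \<partial>tspace T) < \<infinity>"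
    and C: "C > 0"
    and le: "AE t in tspace T. G t \<le> ennreal C * (\<integral>\<^sup>+s. G s * indicator {..t} s \<partial>tspace T)"
  shows "AE t in tspace T. G t = 0"
proof -
  interpret R: sigma_finite_measure "tspace T" by (rule sigma_finite_tspace)
  interpret RR: pair_sigma_finite "tspace T" "tspace T" ..
  define \<beta> where "\<beta> = 2 * C"
  have \<beta>: "\<beta> > 0" using C by (simp add: \<beta>_def)
  note [measurable] = measurable_tspace_id
  let ?I = "\<integral>\<^sup>+t. ennreal (exp (- \<beta> * t)) * G t \<partial>tspace T"
  have "?I \<le> (\<integral>\<^sup>+t. ennreal (exp (- \<beta> * t)) * (ennreal C * (\<integral>\<^sup>+s. G s * indicator {..t} s \<partial>tspace T)) \<partial>tspace T)"
    using le by (intro nn_integral_mono_AE) (auto elim!: eventually_mono intro: mult_left_mono)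
  also have "\<dots> = (\<integral>\<^sup>+t. \<integral>\<^sup>+s. ennreal C * (ennreal (exp (- \<beta> * t)) * G s * indicator {(s, t). s \<le> t} (s, t)) \<partial>tspace T \<partial>tspace T)"
  proof (rule nn_integral_cong)
    fix t assume "t \<in> space (tspace T)"
    have [measurable]: "(\<lambda>s. indicator {..t} s :: ennreal) \<in> borel_measurable (tspace T)"
      unfolding tspace_def by (intro measurable_restrict_space1) simp
    have "ennreal (exp (- \<beta> * t)) * (ennreal C * (\<integral>\<^sup>+s. G s * indicator {..t} s \<partial>tspace T))
        = (\<integral>\<^sup>+s. ennreal (exp (- \<beta> * t)) * (ennreal C * (G s * indicator {..t} s)) \<partial>tspace T)"
      by (subst nn_integral_cmult[symmetric], measurable, subst nn_integral_cmult[symmetric], measurable)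
    also have "\<dots> = (\<integral>\<^sup>+s. ennreal C * (ennreal (exp (- \<beta> * t)) * G s * indicator {(s, t). s \<le> t} (s, t)) \<partial>tspace T)"
      by (intro nn_integral_cong) (auto simp: indicator_def mult_ac)
    finally show "ennreal (exp (- \<beta> * t)) * (ennreal C * (\<integral>\<^sup>+s. G s * indicator {..t} s \<partial>tspace T)) = \<dots>" .
  qed
  also have "\<dots> = (\<integral>\<^sup>+s. \<integral>\<^sup>+t. ennreal C * (ennreal (exp (- \<beta> * t)) * G s * indicator {(s, t). s \<le> t} (s, t)) \<partial>tspace T \<partial>tspace T)"
    by (rule RR.Fubini') measurable
  also have "\<dots> \<le> (\<integral>\<^sup>+s. ennreal (1/2) * (ennreal (exp (- \<beta> * s)) * G s) \<partial>tspace T)"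
  proof (rule nn_integral_mono)
    fix s
    have [measurable]: "(\<lambda>t. indicator {s..} t :: ennreal) \<in> borel_measurable (tspace T)"
      unfolding tspace_def by (intro measurable_restrict_space1) simp
    have "(\<integral>\<^sup>+t. ennreal C * (ennreal (exp (- \<beta> * t)) * G s * indicator {(s, t). s \<le> t} (s, t)) \<partial>tspace T)
        = (\<integral>\<^sup>+t. (ennreal C * G s) * (ennreal (exp (- \<beta> * t)) * indicator {s..} t) \<partial>tspace T)"
      by (intro nn_integral_cong) (auto simp: indicator_def mult_ac)
    also have "\<dots> = ennreal C * G s * (\<integral>\<^sup>+t. ennreal (exp (- \<beta> * t)) * indicator {s..} t \<partial>tspace T)"
      by (rule nn_integral_cmult) measurable
    also have "\<dots> \<le> ennreal C * G s * ennreal (exp (- \<beta> * s) / \<beta>)"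
      by (intro mult_left_mono nn_integral_exp_tail \<beta>) simp
    also have "\<dots> = ennreal (C * (exp (- \<beta> * s) / \<beta>)) * G s"
      using C \<beta> by (subst ennreal_mult) (auto simp: mult_ac)
    also have "C * (exp (- \<beta> * s) / \<beta>) = (1/2) * exp (- \<beta> * s)" using C by (simp add: \<beta>_def)
    also have "ennreal ((1/2) * exp (- \<beta> * s)) * G s = ennreal (1/2) * (ennreal (exp (- \<beta> * s)) * G s)"
      by (subst ennreal_mult) (simp_all only: mult.assoc, simp_all)
    finally show "(\<integral>\<^sup>+t. ennreal C * (ennreal (exp (- \<beta> * t)) * G s * indicator {(s, t). s \<le> t} (s, t)) \<partial>tspace T)
        \<le> ennreal (1/2) * (ennreal (exp (- \<beta> * s)) * G s)" .
  qed
  also have "\<dots> = ennreal (1/2) * ?I" by (rule nn_integral_cmult) measurable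
  finally have half: "?I \<le> ennreal (1/2) * ?I" .
  have "?I \<le> (\<integral>\<^sup>+t. G t \<partial>tspace T)"
  proof (rule nn_integral_mono)
    fix t assume "t \<in> space (tspace T)"
    then have "exp (- \<beta> * t) \<le> 1" using \<beta> by simp
    then have "ennreal (exp (- \<beta> * t)) * G t \<le> 1 * G t" by (intro mult_right_mono) auto
    then show "ennreal (exp (- \<beta> * t)) * G t \<le> G t" by simp
  qed
  then have "?I < \<infinity>" using fin by (rule le_less_trans)
  then obtain r where r: "?I = ennreal r" "0 \<le> r" by (cases ?I) auto
  have "ennreal r \<le> ennreal (1/2 * r)"
    using half unfolding r(1) using r(2) by (simp only: ennreal_mult[of "1/2" r])
  then have "r = 0" using r(2) by (subst (asm) ennreal_le_iff) auto
  then have "AE t in tspace T. ennreal (exp (- \<beta> * t)) * G t = 0"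
    using r by (subst nn_integral_0_iff_AE[symmetric]) auto
  then show ?thesis by (auto elim: eventually_mono)
qed

context filtered_prob
begin

section \<open>From the weak condition to the Volterra equation\<close>

lemma sqint_slice_integrable:
  assumes "sq q"
  shows "AE s in tspace T. integrable M (q s)"
  using AE_sqint_slice[OF assms] by eventually_elim (rule sqint_integrable)

text \<open>Conditional Fubini, verified by integrating over sets of \<open>F t\<close>. The proof
  first passes from m, which is only jointly measurable with respect to M, to a version y measurable
  with respect to \<open>F t\<close>, as the candidate must be.\<close>

lemma cond_exp_kernel_integral:
  assumes t: "t \<in> {0..T}" and q: "sq q" and k: "sqint (tspace T) k"
    and m: "case_prod m \<in> borel_measurable N"
    and meq: "AE s in tspace T. AE \<omega> in M. m s \<omega> = real_cond_exp M (F t) (q s) \<omega>"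
  shows "AE \<omega> in M. real_cond_exp M (F t) (\<lambda>\<omega>. \<integral>r. k r * q r \<omega> \<partial>tspace T) \<omega> = (\<integral>r. k r * m r \<omega> \<partial>tspace T)"
proof -
  interpret S: finite_measure_subalgebra M "F t" by (rule fms[OF t])
  interpret R: sigma_finite_measure "tspace T" by (rule sigma_finite_tspace)
  note qs = AE_sqint_slice[OF q]
  obtain y where y: "case_prod y \<in> borel_measurable (tspace T \<Otimes>\<^sub>M F t)"
    and yeq: "AE s in tspace T. AE \<omega> in M. y s \<omega> = real_cond_exp M (F t) (q s) \<omega>"
    using cond_exp_process_exists[OF t sqint_meas[OF q] sqint_slice_integrable[OF q]] by blast
  have yN: "case_prod y \<in> borel_measurable N"
    by (rule joint_measurable_subalgebra[OF subalg[OF t] y])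
  have ysq: "sq y" by (rule sqint_cond_exp_process[OF q yN subalg[OF t] yeq])
  have "AE s in tspace T. AE \<omega> in M. m s \<omega> = y s \<omega>"
    using meq yeq
  proof eventually_elim
    case (elim s)
    then show ?case by eventually_elim simp
  qed
  then have my: "AE \<omega> in M. AE s in tspace T. m s \<omega> = y s \<omega>"
    using AE_eq_commute[OF m yN] by simp
  \<comment> \<open>Attaching the indicator of A to the kernel row turns an integral over A into an
    inner product on the product space.\<close>
  have ksq: "sq (\<lambda>s \<omega>. indicator A \<omega> * k s)" if A: "A \<in> sets M" for A
  proof -
    note [measurable] = sqint_meas[OF k]
    have km: "(\<lambda>(s, \<omega>). indicator A \<omega> * k s) \<in> borel_measurable N" using A by measurable
    have "(\<integral>\<^sup>+x. ennreal ((case x of (s, \<omega>) \<Rightarrow> indicator A \<omega> * k s)\<^sup>2) \<partial>N) = (\<integral>\<^sup>+s. \<integral>\<^sup>+\<omega>. ennreal ((indicator A \<omega> * k s)\<^sup>2) \<partial>M \<partial>tspace T)"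
      using nn_integral_fst[of "\<lambda>x. ennreal ((case x of (s, \<omega>) \<Rightarrow> indicator A \<omega> * k s)\<^sup>2)" "tspace T"] km by simp
    also have "\<dots> \<le> (\<integral>\<^sup>+s. \<integral>\<^sup>+\<omega>. ennreal ((k s)\<^sup>2) \<partial>M \<partial>tspace T)"
      by (intro nn_integral_mono) (auto simp: indicator_def)
    also have "\<dots> = (\<integral>\<^sup>+s. ennreal ((k s)\<^sup>2) \<partial>tspace T)" by (simp add: emeasure_space_1)
    also have "\<dots> < \<infinity>" using k by (simp add: sqint_iff_nn)
    finally show ?thesis using km by (simp add: sqint_iff_nn)
  qed
  have ip: "(\<integral>\<omega>. indicator A \<omega> * (\<integral>r. k r * f r \<omega> \<partial>tspace T) \<partial>M) = ipN (\<lambda>s \<omega>. indicator A \<omega> * k s) f"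
    if "sq f" "A \<in> sets M" for f A
    using ipN_eq_ipT[OF ksq[OF that(2)] that(1)] by (simp add: ipT_eq mult.assoc)
  have int: "integrable M (\<lambda>\<omega>. \<integral>r. k r * f r \<omega> \<partial>tspace T)" if "sq f" for f
  proof -
    have "integrable M (\<lambda>\<omega>. indicator (space M) \<omega> * (\<integral>r. k r * f r \<omega> \<partial>tspace T))"
      using integrable_ipT[OF ksq[OF sets.top] that] by (simp add: ipT_eq mult.assoc)
    then show ?thesis by (rule Bochner_Integration.integrable_cong[THEN iffD1, rotated 2]) auto
  qed
  have "AE \<omega> in M. real_cond_exp M (F t) (\<lambda>\<omega>. \<integral>r. k r * q r \<omega> \<partial>tspace T) \<omega> = (\<integral>r. k r * y r \<omega> \<partial>tspace T)"
  proof (rule S.real_cond_exp_charact)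
    fix A assume AF: "A \<in> sets (F t)"
    then have A: "A \<in> sets M" using subalg[OF t] by (auto simp: subalgebra_def)
    have "ipN (\<lambda>s \<omega>. indicator A \<omega> * k s) q = (\<integral>s. \<integral>\<omega>. indicator A \<omega> * k s * q s \<omega> \<partial>M \<partial>tspace T)"
      unfolding ipN_def using P.integral_fst'[OF sqint_mult[OF ksq[OF A] q]] by simp
    also have "\<dots> = (\<integral>s. \<integral>\<omega>. indicator A \<omega> * k s * y s \<omega> \<partial>M \<partial>tspace T)"
    proof (rule integral_cong_AE)
      show "AE s in tspace T. (\<integral>\<omega>. indicator A \<omega> * k s * q s \<omega> \<partial>M) = (\<integral>\<omega>. indicator A \<omega> * k s * y s \<omega> \<partial>M)"
        using qs yeq AE_sqint_slice[OF ysq]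
      proof eventually_elim
        case (elim s)
        have "(\<integral>\<omega>. indicator A \<omega> * q s \<omega> \<partial>M) = (\<integral>\<omega>. indicator A \<omega> * real_cond_exp M (F t) (q s) \<omega> \<partial>M)"
          using S.real_cond_exp_intA[OF sqint_integrable[OF elim(1)] AF] by (simp add: set_lebesgue_integral_def)
        also have "\<dots> = (\<integral>\<omega>. indicator A \<omega> * y s \<omega> \<partial>M)"
          using elim(2) A sqint_meas[OF elim(3)] by (intro integral_cong_AE) auto
        finally show ?case by (simp add: mult.commute[of _ "k s"] mult.assoc)
      qed
    qed (use P.integrable_fst'[OF sqint_mult[OF ksq[OF A] q]] P.integrable_fst'[OF sqint_mult[OF ksq[OF A] ysq]] in auto)
    also have "\<dots> = ipN (\<lambda>s \<omega>. indicator A \<omega> * k s) y"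
      unfolding ipN_def using P.integral_fst'[OF sqint_mult[OF ksq[OF A] ysq]] by simp
    finally show "(\<integral>\<omega>\<in>A. (\<integral>r. k r * q r \<omega> \<partial>tspace T) \<partial>M) = (\<integral>\<omega>\<in>A. (\<integral>r. k r * y r \<omega> \<partial>tspace T) \<partial>M)"
      using ip[OF q A] ip[OF ysq A] by (simp add: set_lebesgue_integral_def)
  next
    note [measurable] = y sqint_meas[OF k]
    show "(\<lambda>\<omega>. \<integral>r. k r * y r \<omega> \<partial>tspace T) \<in> borel_measurable (F t)" by measurable
  qed (intro int q ysq)+
  then show ?thesis
    using my AE_space
  proof eventually_elim
    case (elim \<omega>)
    have "(\<integral>r. k r * m r \<omega> \<partial>tspace T) = (\<integral>r. k r * y r \<omega> \<partial>tspace T)"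
      using elim(2) sqint_meas[OF k] path_measurable[OF m elim(3)] path_measurable[OF yN elim(3)]
      by (intro integral_cong_AE) (auto elim: eventually_mono)
    then show ?case using elim(1) by simp
  qed
qed

lemma cond_exp_kproc:
  assumes t: "t \<in> {0..T}" and q: "sq q" and K: "bdd_kernel T C K" and s: "s \<in> {0..T}"
    and m: "case_prod m \<in> borel_measurable N"
    and meq: "AE s in tspace T. AE \<omega> in M. m s \<omega> = real_cond_exp M (F t) (q s) \<omega>"
  shows "AE \<omega> in M. real_cond_exp M (F t) (kproc K q s) \<omega> = kproc K m s \<omega>"
  using cond_exp_kernel_integral[OF t q bdd_kernelD(3)[OF K s] m meq]
  by (simp add: kproc_def[abs_def] kop_eq)

text \<open>A choice again, so a witness is needed. The process x is tied to a measurable x' by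
  almost everywhere equality: for \<open>xproc\<close>, which selects a new \<open>ceproc\<close> at
  each time, joint measurability is not at hand.\<close>

lemma ceproc_spec:
  assumes t: "t \<in> {0..T}" and x': "sq x'" and eq: "AE s in tspace T. AE \<omega> in M. x s \<omega> = x' s \<omega>"
  shows "case_prod (ceproc T M F t x) \<in> borel_measurable N"
    "AE s in tspace T. AE \<omega> in M. ceproc T M F t x s \<omega> = real_cond_exp M (F t) (x' s) \<omega>"
proof -
  interpret S: finite_measure_subalgebra M "F t" by (rule fms[OF t])
  have ce: "AE s in tspace T. AE \<omega> in M. real_cond_exp M (F t) (x s) \<omega> = real_cond_exp M (F t) (x' s) \<omega>"
    using eq AE_sqint_slice[OF x']
  proof eventually_elim
    case (elim s)
    have eq': "AE \<omega> in M. x' s \<omega> = x s \<omega>" using elim(1) by (auto elim: eventually_mono)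
    have "x s \<in> borel_measurable M"
      by (rule CM.borel_measurable_AE_eq[OF sqint_meas[OF elim(2)] eq'])
    then show ?case
      using elim(1) sqint_meas[OF elim(2)] by (intro S.real_cond_exp_cong)
  qed
  obtain y where y: "case_prod y \<in> borel_measurable (tspace T \<Otimes>\<^sub>M F t)"
    and yeq: "AE s in tspace T. AE \<omega> in M. y s \<omega> = real_cond_exp M (F t) (x' s) \<omega>"
    using cond_exp_process_exists[OF t sqint_meas[OF x'] sqint_slice_integrable[OF x']] by blast
  have "AE s in tspace T. AE \<omega> in M. y s \<omega> = real_cond_exp M (F t) (x s) \<omega>"
    using yeq ce
  proof eventually_elim
    case (elim s)
    then show ?case by eventually_elim simp
  qed
  then have "\<exists>y. case_prod y \<in> borel_measurable N \<and> (AE s in tspace T. AE \<omega> in M. y s \<omega> = real_cond_exp M (F t) (x s) \<omega>)"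
    using joint_measurable_subalgebra[OF subalg[OF t] y] by blast
  from someI_ex[OF this]
  have c: "case_prod (ceproc T M F t x) \<in> borel_measurable N"
    "AE s in tspace T. AE \<omega> in M. ceproc T M F t x s \<omega> = real_cond_exp M (F t) (x s) \<omega>"
    unfolding ceproc_def AE_tspace tspace_def[symmetric] by simp_all
  show "case_prod (ceproc T M F t x) \<in> borel_measurable N" by (rule c(1))
  show "AE s in tspace T. AE \<omega> in M. ceproc T M F t x s \<omega> = real_cond_exp M (F t) (x' s) \<omega>"
    using c(2) ce
  proof eventually_elim
    case (elim s)
    then show ?case by eventually_elim simp
  qed
qed

lemma weak_FOC_cond_exp_zero:
  assumes K: "bdd_kernel T C K" and y: "sq y" and foc: "weak_FOC lam K y u"
  shows "AE s in tspace T. AE \<omega> in M. real_cond_exp M (F s) (\<lambda>\<omega>. Lop lam K u s \<omega> - y s \<omega>) \<omega> = 0"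
proof (rule orthogonal_Uset_cond_exp_zero)
  have u: "sq u" using foc by (simp add: weak_FOC_def Uset_sq)
  show "sq (\<lambda>s \<omega>. Lop lam K u s \<omega> - y s \<omega>)" by (intro sq_diff sq_Lop[OF K] u y)
  fix w assume w: "w \<in> Uset T M F"
  have "ipN w (\<lambda>s \<omega>. Lop lam K u s \<omega> - y s \<omega>) = ipN w (Lop lam K u) - ipN w y"
    by (intro ipN_diff sq_Lop[OF K] u y Uset_sq[OF w])
  also have "\<dots> = 0" using foc w by (simp add: weak_FOC_def)
  finally show "(\<integral>x. case_prod w x * case_prod (\<lambda>s \<omega>. Lop lam K u s \<omega> - y s \<omega>) x \<partial>N) = 0"
    by (simp add: ipN_def)
qed

lemma cond_exp_Lop_diff:
  assumes t: "t \<in> {0..T}" and s: "s \<in> {0..T}" and K: "bdd_kernel T C K" and u: "sq u"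
    and us: "sqint M (u s)" and ys: "sqint M (y s)"
    and m: "case_prod m \<in> borel_measurable N"
    and meq: "AE s in tspace T. AE \<omega> in M. m s \<omega> = real_cond_exp M (F t) (u s) \<omega>"
  shows "AE \<omega> in M. real_cond_exp M (F t) (\<lambda>\<omega>. Lop lam K u s \<omega> - y s \<omega>) \<omega> =
    2 * lam * real_cond_exp M (F t) (u s) \<omega> + kproc K m s \<omega> + kproc (\<lambda>s r. K r s) m s \<omega>
    - real_cond_exp M (F t) (y s) \<omega>"
proof -
  interpret S: finite_measure_subalgebra M "F t" by (rule fms[OF t])
  note Kt = bdd_kernel_transpose[OF K]
  have i: "integrable M (u s)" "integrable M (y s)" "integrable M (kproc K u s)" "integrable M (kproc (\<lambda>s r. K r s) u s)"
    using us ys kproc_slice(1)[OF K u s] kproc_slice(1)[OF Kt u s] by (auto intro: sqint_integrable)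
  have 1: "AE \<omega> in M. real_cond_exp M (F t) (\<lambda>\<omega>. Lop lam K u s \<omega> - y s \<omega>) \<omega>
      = real_cond_exp M (F t) (Lop lam K u s) \<omega> - real_cond_exp M (F t) (y s) \<omega>"
    using i by (intro S.real_cond_exp_diff) (auto simp: Lop_def[abs_def])
  have 2: "AE \<omega> in M. real_cond_exp M (F t) (\<lambda>\<omega>. 2 * lam * u s \<omega> + kproc K u s \<omega> + kproc (\<lambda>s r. K r s) u s \<omega>) \<omega>
      = real_cond_exp M (F t) (\<lambda>\<omega>. 2 * lam * u s \<omega> + kproc K u s \<omega>) \<omega> + real_cond_exp M (F t) (kproc (\<lambda>s r. K r s) u s) \<omega>"
    using i by (intro S.real_cond_exp_add) auto
  have 3: "AE \<omega> in M. real_cond_exp M (F t) (\<lambda>\<omega>. 2 * lam * u s \<omega> + kproc K u s \<omega>) \<omega>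
      = real_cond_exp M (F t) (\<lambda>\<omega>. 2 * lam * u s \<omega>) \<omega> + real_cond_exp M (F t) (kproc K u s) \<omega>"
    using i by (intro S.real_cond_exp_add) auto
  have 4: "AE \<omega> in M. real_cond_exp M (F t) (\<lambda>\<omega>. 2 * lam * u s \<omega>) \<omega> = 2 * lam * real_cond_exp M (F t) (u s) \<omega>"
    using i by (intro S.real_cond_exp_cmult)
  have L: "Lop lam K u s = (\<lambda>\<omega>. 2 * lam * u s \<omega> + kproc K u s \<omega> + kproc (\<lambda>s r. K r s) u s \<omega>)"
    by (simp add: Lop_def fun_eq_iff)
  show ?thesis
    using 1 2 3 4 cond_exp_kproc[OF t u K s m meq] cond_exp_kproc[OF t u Kt s m meq]
    by eventually_elim (simp add: L)
qed

lemma cond_exp_adapted: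
  assumes "progressive T F u" "sq u" "0 \<le> r" "r \<le> t" "t \<le> T" "sqint M (u r)"
  shows "AE \<omega> in M. real_cond_exp M (F t) (u r) \<omega> = u r \<omega>"
proof -
  interpret S: finite_measure_subalgebra M "F t" using assms fms by simp
  have "u r \<in> borel_measurable (F r)" using assms by (intro progressive_adapted) auto
  then have "u r \<in> borel_measurable (F t)"
    by (rule measurable_from_subalg[OF subalg_mono[OF assms(3-5)]])
  then show ?thesis using assms by (intro S.real_cond_exp_F_meas sqint_integrable)
qed

text \<open>The tower property carries the conditional equation at each later time s down to
  \<open>F t\<close>. Swapping the two almost everywhere quantifiers then gives the deterministic
  equation along almost every path, to which \<open>pathwise_resolvent_equation\<close>
  applies.\<close>

lemma weak_FOC_resolvent_equation:
  assumes K: "vkernel T C K" and lam: "lam > 0" and y: "sq y" and foc: "weak_FOC lam K y u"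
    and x: "AE t in tspace T. AE \<omega> in M. x t \<omega> = real_cond_exp M (F t) (y t) \<omega>"
  shows "AE t in tspace T. AE \<omega> in M.
    u t \<omega> - (\<integral>s. Bker T lam K t s * u s \<omega> \<partial>tspace T) = aproc T lam K M F x t \<omega>"
proof -
  note b = vkernelD(1)[OF K] and bt = bdd_kernel_transpose[OF vkernelD(1)[OF K]]
  have up: "progressive T F u" and u: "sq u" using foc by (auto simp: weak_FOC_def Uset_iff)
  note zero = weak_FOC_cond_exp_zero[OF b y foc]
  obtain x' where x'p: "progressive T F x'"
    and x'e: "AE s in tspace T. AE \<omega> in M. x' s \<omega> = real_cond_exp M (F s) (y s) \<omega>"
    using progressive_projection[OF sqint_meas[OF y] sqint_slice_integrable[OF y]] by blast
  have x': "sq x'" by (rule sqint_cond_exp_process[OF y progressive_joint[OF x'p] subalg x'e])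
  have xx': "AE s in tspace T. AE \<omega> in M. x s \<omega> = x' s \<omega>"
    using x x'e
  proof eventually_elim
    case (elim s)
    then show ?case by eventually_elim simp
  qed
  show ?thesis
    using zero AE_sqint_slice[OF u] AE_sqint_slice[OF y] x AE_space
  proof eventually_elim
    case (elim t)
    then have t: "t \<in> {0..T}" by simp
    interpret S: finite_measure_subalgebra M "F t" by (rule fms[OF t])
    obtain m' where m': "case_prod m' \<in> borel_measurable (tspace T \<Otimes>\<^sub>M F t)"
      and meq: "AE s in tspace T. AE \<omega> in M. m' s \<omega> = real_cond_exp M (F t) (u s) \<omega>"
      using cond_exp_process_exists[OF t sqint_meas[OF u] sqint_slice_integrable[OF u]] by blast
    have m'm: "case_prod m' \<in> borel_measurable N"
      by (rule joint_measurable_subalgebra[OF subalg[OF t] m'])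
    have m'sq: "sq m'" by (rule sqint_cond_exp_process[OF u m'm subalg[OF t] meq])
    define X where "X = ceproc T M F t x"
    have Xm: "case_prod X \<in> borel_measurable N"
      and Xe: "AE s in tspace T. AE \<omega> in M. X s \<omega> = real_cond_exp M (F t) (x' s) \<omega>"
      unfolding X_def using ceproc_spec[OF t x' xx'] by auto
    have Xsq: "sq X" by (rule sqint_cond_exp_process[OF x' Xm subalg[OF t] Xe])
    have ind: "(\<lambda>(s, \<omega>). indicator {t..} s * f s \<omega>) \<in> borel_measurable N" "(\<lambda>(s, \<omega>). indicator {..t} s * f s \<omega>) \<in> borel_measurable N"
      if [measurable]: "case_prod f \<in> borel_measurable N" for f :: "real \<Rightarrow> 'a \<Rightarrow> real"
    proof -
      have [measurable]: "(indicator {t..} :: real \<Rightarrow> real) \<in> borel_measurable (tspace T)"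
        "(indicator {..t} :: real \<Rightarrow> real) \<in> borel_measurable (tspace T)"
        by (auto intro: borel_measurable_tspace)
      show "(\<lambda>(s, \<omega>). indicator {t..} s * f s \<omega>) \<in> borel_measurable N" "(\<lambda>(s, \<omega>). indicator {..t} s * f s \<omega>) \<in> borel_measurable N"
        by measurable
    qed
    \<comment> \<open>The indicator encodes the restriction s \<ge> t inside an equation of jointly
      measurable processes, as the quantifier swap requires.\<close>
    have "AE s in tspace T. AE \<omega> in M. indicator {t..} s * Lop lam K m' s \<omega> = indicator {t..} s * X s \<omega>"
      using zero AE_sqint_slice[OF u] AE_sqint_slice[OF y] AE_space meq Xe x'e AE_sqint_slice[OF x']
    proof eventually_elim
      case (elim s)
      then have s: "s \<in> {0..T}" by simp
      interpret Ss: finite_measure_subalgebra M "F s" by (rule fms[OF s])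
      show ?case
      proof (cases "t \<le> s")
        case True
        have sub: "subalgebra (F s) (F t)" using t s True by (intro subalg_mono) auto
        have Lsq: "sqint M (\<lambda>\<omega>. Lop lam K u s \<omega> - y s \<omega>)"
          unfolding Lop_def using elim kproc_slice(1)[OF b u s] kproc_slice(1)[OF bt u s]
          by (intro sqint_diff sqint_add sqint_cmult) auto
        have n1: "AE \<omega> in M. real_cond_exp M (F t) (real_cond_exp M (F s) (\<lambda>\<omega>. Lop lam K u s \<omega> - y s \<omega>)) \<omega>
            = real_cond_exp M (F t) (\<lambda>\<omega>. Lop lam K u s \<omega> - y s \<omega>) \<omega>"
          by (rule S.real_cond_exp_nested_subalg[OF subalg[OF s] sub sqint_integrable[OF Lsq]])
        have n2: "AE \<omega> in M. real_cond_exp M (F t) (real_cond_exp M (F s) (\<lambda>\<omega>. Lop lam K u s \<omega> - y s \<omega>)) \<omega>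
            = real_cond_exp M (F t) (\<lambda>\<omega>. 0) \<omega>"
          using elim(1) by (intro S.real_cond_exp_cong) auto
        have n3: "AE \<omega> in M. real_cond_exp M (F t) (\<lambda>\<omega>. 0) \<omega> = 0"
          by (rule S.real_cond_exp_F_meas) auto
        have n4: "AE \<omega> in M. real_cond_exp M (F t) (real_cond_exp M (F s) (y s)) \<omega> = real_cond_exp M (F t) (y s) \<omega>"
          by (rule S.real_cond_exp_nested_subalg[OF subalg[OF s] sub sqint_integrable[OF elim(3)]])
        have n5: "AE \<omega> in M. real_cond_exp M (F t) (x' s) \<omega> = real_cond_exp M (F t) (real_cond_exp M (F s) (y s)) \<omega>"
          using elim(7) sqint_meas[OF elim(8)] by (intro S.real_cond_exp_cong) auto
        show ?thesis
          using n1 n2 n3 n4 n5 elim(5,6) cond_exp_Lop_diff[where y = y and u = u and lam = lam, OF t s b u elim(2,3) m'm meq]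
          by eventually_elim (simp add: Lop_def)
      next
        case False
        then show ?thesis by simp
      qed
    qed
    then have after: "AE \<omega> in M. AE s in tspace T. indicator {t..} s * Lop lam K m' s \<omega> = indicator {t..} s * X s \<omega>"
      using AE_eq_commute[OF ind(1)[OF sqint_meas[OF sq_Lop[OF b m'sq]]] ind(1)[OF Xm]] by blast
    have "AE s in tspace T. AE \<omega> in M. indicator {..t} s * m' s \<omega> = indicator {..t} s * u s \<omega>"
      using meq AE_space AE_sqint_slice[OF u]
    proof eventually_elim
      case (elim s)
      show ?case
      proof (cases "s \<le> t")
        case True
        have "AE \<omega> in M. real_cond_exp M (F t) (u s) \<omega> = u s \<omega>"
          using elim t True by (intro cond_exp_adapted up u) auto
        then show ?thesis using elim(1) by eventually_elim simp
      qed simp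
    qed
    then have before: "AE \<omega> in M. AE s in tspace T. indicator {..t} s * m' s \<omega> = indicator {..t} s * u s \<omega>"
      using AE_eq_commute[OF ind(2)[OF m'm] ind(2)[OF sqint_meas[OF u]]] by blast
    \<comment> \<open>The equation at s = t does not follow from \<open>after\<close>, which ignores
      single times; it holds because t itself was taken outside the exceptional null set.\<close>
    have "AE \<omega> in M. real_cond_exp M (F t) (u t) \<omega> = u t \<omega>"
      using elim t by (intro cond_exp_adapted up u) auto
    then have now: "AE \<omega> in M. 2 * lam * u t \<omega> + kproc K m' t \<omega> + kproc (\<lambda>s r. K r s) m' t \<omega> = x t \<omega>"
      using cond_exp_Lop_diff[where y = y and u = u and lam = lam, OF t t b u elim(2,3) m'm meq] elim(1,4)
      by eventually_elim simp
    show ?case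
      using after before now AE_sqint_path[OF m'sq] AE_sqint_path[OF u] AE_sqint_path[OF Xsq]
    proof eventually_elim
      case (elim \<omega>)
      have a: "AE s in tspace T. t \<le> s \<longrightarrow> 2 * lam * m' s \<omega> + kop T K (\<lambda>r. m' r \<omega>) s + kop T (\<lambda>s r. K r s) (\<lambda>r. m' r \<omega>) s = X s \<omega>"
        using elim(1) by eventually_elim (auto simp: Lop_def kproc_def)
      have bb: "AE s in tspace T. s \<le> t \<longrightarrow> m' s \<omega> = u s \<omega>"
        using elim(2) by eventually_elim auto
      show ?case
        using pathwise_resolvent_equation[OF K lam t elim(4,5,6) a bb elim(3)[unfolded kproc_def]]
        unfolding aproc_def X_def by simp
    qed
  qed
qed

text \<open>The right-hand side cancels in the difference. The second moment of the difference at t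
  is bounded by a multiple of its integral over [0,t], since \<open>Bker\<close> vanishes beyond t
  and its rows are uniformly square integrable; then \<open>gronwall_zero\<close> applies.\<close>

lemma resolvent_equation_unique:
  assumes K: "vkernel T C K" and lam: "lam > 0" and z: "sq z" and z': "sq z'"
    and e: "AE t in tspace T. AE \<omega> in M. z t \<omega> - (\<integral>s. Bker T lam K t s * z s \<omega> \<partial>tspace T) = a t \<omega>"
    and e': "AE t in tspace T. AE \<omega> in M. z' t \<omega> - (\<integral>s. Bker T lam K t s * z' s \<omega> \<partial>tspace T) = a t \<omega>"
  shows "AE t in tspace T. AE \<omega> in M. z t \<omega> = z' t \<omega>"
proof -
  define CB where "CB = (C\<^sup>2 * T / (4 * lam\<^sup>2) + C) / (2 * lam\<^sup>2)"
  have C: "C > 0" using K by (auto dest: vkernelD bdd_kernelD)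
  have CB: "CB > 0" unfolding CB_def using C lam T_pos by (intro divide_pos_pos add_pos_pos mult_pos_pos) auto
  define d where "d s \<omega> = z s \<omega> - z' s \<omega>" for s \<omega>
  have d: "sq d" unfolding d_def by (rule sq_diff[OF z z'])
  note dm[measurable] = sqint_meas[OF d]
  define G where "G t = (\<integral>\<^sup>+\<omega>. ennreal ((d t \<omega>)\<^sup>2) \<partial>M)" for t
  have Gm[measurable]: "G \<in> borel_measurable (tspace T)" unfolding G_def by measurable
  have "AE t in tspace T. G t = 0"
  proof (rule gronwall_zero[OF Gm _ CB])
    have "(\<integral>\<^sup>+t. G t \<partial>tspace T) = (\<integral>\<^sup>+x. ennreal ((case_prod d x)\<^sup>2) \<partial>N)"
      unfolding G_def using nn_integral_fst[of "\<lambda>x. ennreal ((case_prod d x)\<^sup>2)" "tspace T"] by simp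
    then show "(\<integral>\<^sup>+t. G t \<partial>tspace T) < \<infinity>" using d by (simp add: sqint_iff_nn)
    show "AE t in tspace T. G t \<le> ennreal CB * (\<integral>\<^sup>+s. G s * indicator {..t} s \<partial>tspace T)"
      using e e' AE_space
    proof eventually_elim
      case (elim t)
      then have t: "t \<in> {0..T}" by simp
      note B = sqint_Bker[OF K lam t]
      have [measurable]: "(indicator {..t} :: real \<Rightarrow> real) \<in> borel_measurable (tspace T)"
        by (rule borel_measurable_tspace) simp
      have "G t \<le> (\<integral>\<^sup>+\<omega>. ennreal CB * (\<integral>\<^sup>+s. ennreal ((d s \<omega>)\<^sup>2) * indicator {..t} s \<partial>tspace T) \<partial>M)"
        unfolding G_def
      proof (rule nn_integral_mono_AE)
        show "AE \<omega> in M. ennreal ((d t \<omega>)\<^sup>2) \<le> ennreal CB * (\<integral>\<^sup>+s. ennreal ((d s \<omega>)\<^sup>2) * indicator {..t} s \<partial>tspace T)"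
          using elim(1,2) AE_sqint_path[OF z] AE_sqint_path[OF z'] AE_sqint_path[OF d]
        proof eventually_elim
          case (elim \<omega>)
          \<comment> \<open>Cutting the path at t does not change the integral against
            \<open>Bker\<close>, but keeps the future out of the Cauchy-Schwarz bound.\<close>
          let ?f = "\<lambda>s. indicator {..t} s * d s \<omega>"
          have f: "sqint (tspace T) ?f"
            by (rule sqint_bounded[OF elim(5)]) (use sqint_meas[OF elim(5)] in \<open>measurable, auto simp: indicator_def\<close>)
          have "d t \<omega> = (\<integral>s. Bker T lam K t s * z s \<omega> \<partial>tspace T) - (\<integral>s. Bker T lam K t s * z' s \<omega> \<partial>tspace T)"
            using elim(1,2) by (simp add: d_def)
          also have "\<dots> = (\<integral>s. Bker T lam K t s * z s \<omega> - Bker T lam K t s * z' s \<omega> \<partial>tspace T)"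
            by (intro Bochner_Integration.integral_diff[symmetric] sqint_mult B elim)
          also have "\<dots> = (\<integral>s. Bker T lam K t s * ?f s \<partial>tspace T)"
            by (intro Bochner_Integration.integral_cong) (auto simp: d_def Bker_def indicator_def algebra_simps)
          finally have "(d t \<omega>)\<^sup>2 \<le> (\<integral>s. (Bker T lam K t s)\<^sup>2 \<partial>tspace T) * (\<integral>s. (?f s)\<^sup>2 \<partial>tspace T)"
            using sqint_cauchy_schwarz[OF B f] by simp
          also have "\<dots> \<le> CB * (\<integral>s. (?f s)\<^sup>2 \<partial>tspace T)"
            unfolding CB_def by (intro mult_right_mono Bker_norm_le[OF K lam t]) simp
          finally have "ennreal ((d t \<omega>)\<^sup>2) \<le> ennreal (CB * (\<integral>s. (?f s)\<^sup>2 \<partial>tspace T))" by (rule ennreal_leI)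
          also have "\<dots> = ennreal CB * (\<integral>\<^sup>+s. ennreal ((?f s)\<^sup>2) \<partial>tspace T)"
            using CB sqint_integrable_power2[OF f] by (subst nn_integral_eq_integral) (auto simp: ennreal_mult')
          also have "(\<integral>\<^sup>+s. ennreal ((?f s)\<^sup>2) \<partial>tspace T) = (\<integral>\<^sup>+s. ennreal ((d s \<omega>)\<^sup>2) * indicator {..t} s \<partial>tspace T)"
            by (intro nn_integral_cong) (auto simp: indicator_def)
          finally show ?case .
        qed
      qed
      also have "\<dots> = (\<integral>\<^sup>+\<omega>. ennreal CB * (\<integral>\<^sup>+s. ennreal ((d s \<omega>)\<^sup>2 * indicator {..t} s) \<partial>tspace T) \<partial>M)"
        by (intro nn_integral_cong arg_cong2[where f = "(*)"] refl) (auto simp: indicator_def)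
      also have "\<dots> = ennreal CB * (\<integral>\<^sup>+\<omega>. (\<integral>\<^sup>+s. ennreal ((d s \<omega>)\<^sup>2 * indicator {..t} s) \<partial>tspace T) \<partial>M)"
        by (rule nn_integral_cmult) measurable
      also have "(\<integral>\<^sup>+\<omega>. (\<integral>\<^sup>+s. ennreal ((d s \<omega>)\<^sup>2 * indicator {..t} s) \<partial>tspace T) \<partial>M)
          = (\<integral>\<^sup>+s. (\<integral>\<^sup>+\<omega>. ennreal ((d s \<omega>)\<^sup>2 * indicator {..t} s) \<partial>M) \<partial>tspace T)"
        by (rule P.Fubini') measurable
      also have "\<dots> = (\<integral>\<^sup>+s. G s * indicator {..t} s \<partial>tspace T)"
        by (intro nn_integral_cong) (auto simp: G_def indicator_def)
      finally show ?case .
    qed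
  qed
  then show ?thesis
    using AE_sqint_slice[OF d]
  proof eventually_elim
    case (elim t)
    then have "AE \<omega> in M. ennreal ((d t \<omega>)\<^sup>2) = 0"
      unfolding G_def by (subst (asm) nn_integral_0_iff_AE) (auto dest: sqint_meas)
    then show ?case by (auto elim!: eventually_mono simp: d_def)
  qed
qed

text \<open>The control u is a witness for the choice in \<open>resolv\<close>, so the chosen
  process does solve the Volterra equation, and uniqueness identifies it with u.\<close>

lemma weak_FOC_eq_solmap:
  assumes K: "vkernel T C K" and lam: "lam > 0" and y: "sq y" and foc: "weak_FOC lam K y u"
    and x: "AE t in tspace T. AE \<omega> in M. x t \<omega> = real_cond_exp M (F t) (y t) \<omega>"
  shows "ae_eq_proc T M u (solmap T lam K M F x)"
proof -
  have u: "sq u" using foc by (simp add: weak_FOC_def Uset_sq)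
  define P where "P z \<longleftrightarrow> (\<lambda>(t,\<omega>). z t \<omega>) \<in> borel_measurable (restrict_space lborel {0..T} \<Otimes>\<^sub>M M) \<and>
     (\<integral>\<^sup>+ t. (\<integral>\<^sup>+ \<omega>. ennreal ((z t \<omega>)\<^sup>2) \<partial>M) * indicator {0..T} t \<partial>lborel) < \<infinity> \<and>
     (AE t in lborel. t \<in> {0..T} \<longrightarrow>
        (AE \<omega> in M. z t \<omega> - (LINT s:{0..T}|lborel. Bker T lam K t s * z s \<omega>) = aproc T lam K M F x t \<omega>))" for z
  have P: "P z \<longleftrightarrow> sq z \<and> (AE t in tspace T. AE \<omega> in M.
      z t \<omega> - (\<integral>s. Bker T lam K t s * z s \<omega> \<partial>tspace T) = aproc T lam K M F x t \<omega>)" for z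
  proof -
    have "(\<integral>\<^sup>+s. (\<integral>\<^sup>+\<omega>. ennreal ((z s \<omega>)\<^sup>2) \<partial>M) \<partial>tspace T) = (\<integral>\<^sup>+v. ennreal ((case_prod z v)\<^sup>2) \<partial>N)"
      if [measurable]: "case_prod z \<in> borel_measurable N"
      using nn_integral_fst[of "\<lambda>x. ennreal ((case_prod z x)\<^sup>2)" "tspace T"] by simp
    then show ?thesis
      unfolding P_def AE_tspace set_integral_tspace nn_integral_tspace tspace_def[symmetric] sqint_iff_nn by auto
  qed
  have "P u" unfolding P using u weak_FOC_resolvent_equation[OF K lam y foc x] by simp
  then have "P (solmap T lam K M F x)"
    unfolding solmap_def resolv_def P_def[symmetric] by (rule someI[of P u])
  with \<open>P u\<close> show ?thesis
    unfolding P ae_eq_proc_def AE_tspace using resolvent_equation_unique[OF K lam, of u "solmap T lam K M F x"] by blast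
qed

end

section \<open>The mean-field equilibrium\<close>

context filtered_prob
begin

lemma Uset_adapted_cond_exp:
  assumes "u \<in> Uset T M F"
  shows "AE t in tspace T. AE \<omega> in M. u t \<omega> = real_cond_exp M (F t) (u t) \<omega>"
  using AE_sqint_slice[OF Uset_sq[OF assms]] AE_space
proof eventually_elim
  case (elim t)
  have "AE \<omega> in M. real_cond_exp M (F t) (u t) \<omega> = u t \<omega>"
    using assms elim by (intro cond_exp_adapted) (auto simp: Uset_iff)
  then show ?case by eventually_elim simp
qed

lemma set_integral_before: "s \<in> {0..T} \<Longrightarrow> (LINT r:{0..s}|lborel. f r) = (\<integral>r. indicator {..s} r * f r \<partial>tspace T)"
  for f :: "real \<Rightarrow> real"
  unfolding set_integral_tspace[symmetric] set_lebesgue_integral_def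
  by (intro Bochner_Integration.integral_cong) (auto simp: indicator_def)

lemma set_integral_after: "s \<in> {0..T} \<Longrightarrow> (LINT r:{s..T}|lborel. f r) = (\<integral>r. indicator {s..} r * f r \<partial>tspace T)"
  for f :: "real \<Rightarrow> real"
  unfolding set_integral_tspace[symmetric] set_lebesgue_integral_def
  by (intro Bochner_Integration.integral_cong) (auto simp: indicator_def)

text \<open>The Volterra property splits the interaction at t: the \<open>A3\<close> half integrates
  over the past, where conditioning changes nothing, and the transposed half over the future, where
  it produces the \<open>ceproc\<close> term.\<close>

lemma xproc_eq_cond_exp:
  assumes A: "vkernel T C A3" and \<nu>: "\<nu> \<in> Uset T M F" and \<beta>: "\<beta> \<in> Uset T M F"
  shows "AE t in tspace T. AE \<omega> in M. xproc T M F A3 \<nu> \<beta> t \<omega> = real_cond_exp M (F t) (target A3 \<nu> \<beta> t) \<omega>"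
  using Uset_adapted_cond_exp[OF \<beta>] AE_sqint_slice[OF Uset_sq[OF \<beta>]] AE_space
proof eventually_elim
  case (elim t)
  then have t: "t \<in> {0..T}" by simp
  interpret S: finite_measure_subalgebra M "F t" by (rule fms[OF t])
  let ?H = "\<lambda>s r. A3 s r + A3 r s"
  note b = vkernelD(1)[OF A]
  note H = bdd_kernel_add[OF b bdd_kernel_transpose[OF b]]
  note \<nu>s = Uset_sq[OF \<nu>]
  define m where "m = ceproc T M F t \<nu>"
  have mm: "case_prod m \<in> borel_measurable N"
    and meq: "AE s in tspace T. AE \<omega> in M. m s \<omega> = real_cond_exp M (F t) (\<nu> s) \<omega>"
    unfolding m_def using ceproc_spec[OF t \<nu>s, of \<nu>] by auto
  have msq: "sq m" by (rule sqint_cond_exp_process[OF \<nu>s mm subalg[OF t] meq])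
  have 1: "AE \<omega> in M. real_cond_exp M (F t) (\<lambda>\<omega>. \<beta> t \<omega> - kproc ?H \<nu> t \<omega>) \<omega>
      = real_cond_exp M (F t) (\<beta> t) \<omega> - real_cond_exp M (F t) (kproc ?H \<nu> t) \<omega>"
    using sqint_integrable[OF elim(2)] sqint_integrable[OF kproc_slice(1)[OF H \<nu>s t]]
    by (rule S.real_cond_exp_diff)
  have tg: "target A3 \<nu> \<beta> t = (\<lambda>\<omega>. \<beta> t \<omega> - kproc ?H \<nu> t \<omega>)"
    by (simp add: target_def fun_eq_iff)
  have "AE s in tspace T. AE \<omega> in M. indicator {..t} s * m s \<omega> = indicator {..t} s * \<nu> s \<omega>"
    using meq AE_space AE_sqint_slice[OF \<nu>s]
  proof eventually_elim
    case (elim s)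
    show ?case
    proof (cases "s \<le> t")
      case True
      have "AE \<omega> in M. real_cond_exp M (F t) (\<nu> s) \<omega> = \<nu> s \<omega>"
        using elim t True \<nu> by (intro cond_exp_adapted) (auto simp: Uset_iff)
      then show ?thesis using elim(1) by eventually_elim simp
    qed simp
  qed
  moreover have "(\<lambda>(s, \<omega>). indicator {..t} s * f s \<omega>) \<in> borel_measurable N"
    if [measurable]: "case_prod f \<in> borel_measurable N" for f :: "real \<Rightarrow> 'a \<Rightarrow> real"
  proof -
    have [measurable]: "(indicator {..t} :: real \<Rightarrow> real) \<in> borel_measurable (tspace T)"
      by (auto intro: borel_measurable_tspace)
    show ?thesis by measurable
  qed
  ultimately have before: "AE \<omega> in M. AE s in tspace T. indicator {..t} s * m s \<omega> = indicator {..t} s * \<nu> s \<omega>"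
    using AE_eq_commute mm sqint_meas[OF \<nu>s] by blast
  show ?case
    using 1 elim(1) cond_exp_kproc[OF t \<nu>s H t mm meq] before AE_sqint_path[OF msq] AE_sqint_path[OF \<nu>s]
  proof eventually_elim
    case (elim \<omega>)
    note V = vkernelD(2)[OF A]
    have [measurable]: "A3 t \<in> borel_measurable (tspace T)" "(\<lambda>r. A3 r t) \<in> borel_measurable (tspace T)"
      using bdd_kernelD(3,5)[OF b t] by (auto dest: sqint_meas)
    have [measurable]: "(indicator {..t} :: real \<Rightarrow> real) \<in> borel_measurable (tspace T)"
      "(indicator {t..} :: real \<Rightarrow> real) \<in> borel_measurable (tspace T)"
      by (auto intro: borel_measurable_tspace)
    note [measurable] = sqint_meas[OF elim(5)] sqint_meas[OF elim(6)]
    have "kproc ?H m t \<omega> = kop T A3 (\<lambda>r. m r \<omega>) t + kop T (\<lambda>s r. A3 r s) (\<lambda>r. m r \<omega>) t"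
      unfolding kproc_def by (rule kop_kernel_add[OF b bdd_kernel_transpose[OF b] elim(5) t])
    also have "kop T A3 (\<lambda>r. m r \<omega>) t = (\<integral>r. A3 t r * (indicator {..t} r * m r \<omega>) \<partial>tspace T)"
      unfolding kop_eq using V[OF t] by (intro Bochner_Integration.integral_cong) (auto simp: indicator_def)
    also have "\<dots> = (\<integral>r. A3 t r * (indicator {..t} r * \<nu> r \<omega>) \<partial>tspace T)"
    proof (rule integral_cong_AE)
      show "AE r in tspace T. A3 t r * (indicator {..t} r * m r \<omega>) = A3 t r * (indicator {..t} r * \<nu> r \<omega>)"
        using elim(4) by eventually_elim simp
    qed measurable
    also have "\<dots> = (LINT r:{0..t}|lborel. A3 t r * \<nu> r \<omega>)"
      unfolding set_integral_before[OF t] by (simp add: mult.left_commute)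
    also have "kop T (\<lambda>s r. A3 r s) (\<lambda>r. m r \<omega>) t = (LINT r:{t..T}|lborel. A3 r t * m r \<omega>)"
      unfolding set_integral_after[OF t] kop_eq using V[OF _ t]
      by (intro Bochner_Integration.integral_cong) (auto simp: indicator_def)
    finally show ?case
      using elim(1-3) by (simp add: xproc_def tg m_def)
  qed
qed

section \<open>Averaging and the mean-field limit\<close>

lemma ipN_kproc_kernel_add:
  assumes K: "bdd_kernel T C K" and L: "bdd_kernel T D L" and u: "sq u" and w: "sq w"
  shows "ipN w (kproc (\<lambda>s r. K s r + L s r) u) = ipN w (kproc K u) + ipN w (kproc L u)"
proof -
  note KL = bdd_kernel_add[OF K L]
  have s: "sq (\<lambda>s \<omega>. kproc K u s \<omega> + kproc L u s \<omega>)"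
    by (intro sq_add sq_kproc[OF K] sq_kproc[OF L] u)
  have "AE \<omega> in M. AE s in tspace T. kproc (\<lambda>s r. K s r + L s r) u s \<omega> = kproc K u s \<omega> + kproc L u s \<omega>"
    using AE_sqint_path[OF u]
    by eventually_elim (auto intro!: AE_I2 simp: kproc_def kop_kernel_add[OF K L])
  then have "AE x in N. case_prod (kproc (\<lambda>s r. K s r + L s r) u) x = case_prod (\<lambda>s \<omega>. kproc K u s \<omega> + kproc L u s \<omega>) x"
    using AE_eq_iff AE_eq_commute sqint_meas[OF sq_kproc[OF KL u]] sqint_meas[OF s] by blast
  then have "ipN w (kproc (\<lambda>s r. K s r + L s r) u) = ipN w (\<lambda>s \<omega>. kproc K u s \<omega> + kproc L u s \<omega>)"
    by (intro ipN_cong_AE sq_kproc[OF KL] u s w)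
  also have "\<dots> = ipN w (kproc K u) + ipN w (kproc L u)"
    by (intro ipN_add sq_kproc[OF K] sq_kproc[OF L] u w)
  finally show ?thesis .
qed

text \<open>For a player whose control is the mean field itself, the interaction term moves from the
  target into the operator. The fixed point condition on \<nu> is therefore a single linear problem
  instead of an iteration.\<close>

lemma weak_FOC_mean_field:
  assumes A2: "bdd_kernel T C A2" and A3: "bdd_kernel T D A3" and \<beta>: "sq \<beta>"
  shows "weak_FOC lam (\<lambda>s r. A2 s r + A3 s r) \<beta> \<nu> \<longleftrightarrow> weak_FOC lam A2 (target A3 \<nu> \<beta>) \<nu>"
proof -
  note A2t = bdd_kernel_transpose[OF A2] and A3t = bdd_kernel_transpose[OF A3]
  have "ipN w (Lop lam (\<lambda>s r. A2 s r + A3 s r) \<nu>) - ipN w \<beta> = ipN w (Lop lam A2 \<nu>) - ipN w (target A3 \<nu> \<beta>)"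
    if \<nu>: "sq \<nu>" and w: "sq w" for w
    unfolding target_def[abs_def]
    by (simp add: ipN_Lop[OF bdd_kernel_add[OF A2 A3] \<nu> w] ipN_Lop[OF A2 \<nu> w]
        ipN_kproc_kernel_add[OF A2 A3 \<nu> w] ipN_kproc_kernel_add[OF A2t A3t \<nu> w]
        ipN_kproc_kernel_add[OF A3 A3t \<nu> w] ipN_diff sq_kproc[OF bdd_kernel_add[OF A3 A3t] \<nu>] \<beta> w)
  then have "ipN w (Lop lam (\<lambda>s r. A2 s r + A3 s r) \<nu>) = ipN w \<beta> \<longleftrightarrow> ipN w (Lop lam A2 \<nu>) = ipN w (target A3 \<nu> \<beta>)"
    if "\<nu> \<in> Uset T M F" "w \<in> Uset T M F" for w
    using Uset_sq[OF that(1)] Uset_sq[OF that(2)] by (metis (no_types) eq_iff_diff_eq_0)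
  then show ?thesis
    unfolding weak_FOC_def by (intro conj_cong ball_cong refl)
qed

definition avg :: "nat \<Rightarrow> (nat \<Rightarrow> real \<Rightarrow> 'a \<Rightarrow> real) \<Rightarrow> real \<Rightarrow> 'a \<Rightarrow> real" where
  "avg n v s \<omega> = (1 / real n) * (\<Sum>i=1..n. v i s \<omega>)"

lemma Uset_avg: "(\<And>i. i \<ge> 1 \<Longrightarrow> v i \<in> Uset T M F) \<Longrightarrow> avg n v \<in> Uset T M F"
  unfolding avg_def[abs_def] by (intro Uset_cmult Uset_sum) auto

lemma sq_sum: "(\<And>i. i \<in> I \<Longrightarrow> sq (v i)) \<Longrightarrow> sq (\<lambda>s \<omega>. \<Sum>i\<in>I. v i s \<omega>)"
  using sqint_sum[of I N "\<lambda>i. case_prod (v i)"] by (simp add: case_prod_beta')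

lemma ipN_sum: "sq w \<Longrightarrow> (\<And>i. i \<in> I \<Longrightarrow> sq (v i)) \<Longrightarrow> ipN w (\<lambda>s \<omega>. \<Sum>i\<in>I. v i s \<omega>) = (\<Sum>i\<in>I. ipN w (v i))"
proof (induction I rule: infinite_finite_induct)
  case (insert i I)
  then show ?case by (simp add: ipN_add sq_sum)
qed (simp_all add: ipN_def case_prod_beta')

lemma ipN_avg:
  assumes "sq w" "\<And>i. i \<ge> 1 \<Longrightarrow> sq (v i)"
  shows "ipN w (avg n v) = (1 / real n) * (\<Sum>i=1..n. ipN w (v i))"
  unfolding avg_def[abs_def] ipN_cmult using assms by (subst ipN_sum) auto

lemma sq_avg: "(\<And>i. i \<ge> 1 \<Longrightarrow> sq (v i)) \<Longrightarrow> sq (avg n v)"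
  unfolding avg_def[abs_def] by (intro sq_cmult sq_sum) auto

text \<open>Symmetry of \<open>Lop\<close> puts the operator on the fixed test w, after which
  averaging is plain linearity of \<open>ipN\<close>; sums inside \<open>Lop\<close> would split
  only almost everywhere.\<close>

lemma weak_FOC_avg:
  assumes A2: "bdd_kernel T C A2" and A3: "bdd_kernel T D A3" and \<nu>: "sq \<nu>" and b: "\<And>i. sq (b i)" and n: "n \<ge> 1"
    and foc: "\<And>i. i \<ge> 1 \<Longrightarrow> weak_FOC lam A2 (target A3 \<nu> (b i)) (v i)" and w: "w \<in> Uset T M F"
  shows "ipN w (Lop lam A2 (avg n v)) = ipN w (avg n b) - ipN w (kproc (\<lambda>s r. A3 s r + A3 r s) \<nu>)"
proof -
  note k = sq_kproc[OF bdd_kernel_add[OF A3 bdd_kernel_transpose[OF A3]] \<nu>]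
  note ws = Uset_sq[OF w]
  have vs: "sq (v i)" if "i \<ge> 1" for i using foc[OF that] by (simp add: weak_FOC_def Uset_sq)
  have avs: "sq (avg n v)" by (rule sq_avg[OF vs])
  have "ipN w (Lop lam A2 (avg n v)) = ipN (Lop lam A2 w) (avg n v)"
    using ipN_Lop_sym[OF A2 avs ws, of lam] by (simp add: ipN_commute)
  also have "\<dots> = (1 / real n) * (\<Sum>i=1..n. ipN (Lop lam A2 w) (v i))"
    by (rule ipN_avg[OF sq_Lop[OF A2 ws] vs])
  also have "(\<Sum>i=1..n. ipN (Lop lam A2 w) (v i)) = (\<Sum>i=1..n. ipN w (b i) - ipN w (kproc (\<lambda>s r. A3 s r + A3 r s) \<nu>))"
  proof (rule sum.cong[OF refl])
    fix i assume "i \<in> {1..n}"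
    then have i: "i \<ge> 1" by simp
    have "ipN (Lop lam A2 w) (v i) = ipN w (Lop lam A2 (v i))"
      using ipN_Lop_sym[OF A2 vs[OF i] ws, of lam] by (simp add: ipN_commute)
    also have "\<dots> = ipN w (target A3 \<nu> (b i))" using foc[OF i] w by (simp add: weak_FOC_def)
    also have "\<dots> = ipN w (b i) - ipN w (kproc (\<lambda>s r. A3 s r + A3 r s) \<nu>)"
      unfolding target_def[abs_def] by (intro ipN_diff b k ws)
    finally show "ipN (Lop lam A2 w) (v i) = ipN w (b i) - ipN w (kproc (\<lambda>s r. A3 s r + A3 r s) \<nu>)" .
  qed
  also have "(1 / real n) * \<dots> = (1 / real n) * (\<Sum>i=1..n. ipN w (b i)) - ipN w (kproc (\<lambda>s r. A3 s r + A3 r s) \<nu>)"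
    using n by (simp add: sum_subtractf right_diff_distrib)
  also have "(1 / real n) * (\<Sum>i=1..n. ipN w (b i)) = ipN w (avg n b)"
    using ipN_avg[OF ws, of b n] b by simp
  finally show ?thesis .
qed

lemma ipN_self_le_sup:
  assumes d: "sq d" and le: "\<And>t. t \<in> {0..T} \<Longrightarrow> (\<integral>\<^sup>+\<omega>. ennreal ((d t \<omega>)\<^sup>2) \<partial>M) \<le> e"
  shows "ennreal (ipN d d) \<le> e * ennreal T"
proof -
  note [measurable] = sqint_meas[OF d]
  have mT: "emeasure (tspace T) {0..T} = ennreal T"
    using T_pos by (simp add: tspace_def emeasure_restrict_space)
  have "ennreal (ipN d d) = (\<integral>\<^sup>+x. ennreal ((case_prod d x)\<^sup>2) \<partial>N)"
    unfolding ipN_self using sqint_integrable_power2[OF d] by (intro nn_integral_eq_integral[symmetric]) auto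
  also have "\<dots> = (\<integral>\<^sup>+t. \<integral>\<^sup>+\<omega>. ennreal ((d t \<omega>)\<^sup>2) \<partial>M \<partial>tspace T)"
    using nn_integral_fst[of "\<lambda>x. ennreal ((case_prod d x)\<^sup>2)" "tspace T"] by simp
  also have "\<dots> \<le> (\<integral>\<^sup>+t. e \<partial>tspace T)" by (intro nn_integral_mono le) simp
  also have "\<dots> = e * ennreal T" by (simp add: mT)
  finally show ?thesis .
qed

text \<open>Convergence uniform in time implies convergence in L2 of the product space, as T is
  finite, and Cauchy-Schwarz gives the limit of the pairings.\<close>

lemma ipN_tendsto:
  assumes f: "\<And>n. sq (f n)" and g: "sq g" and w: "sq w"
    and lim: "(\<lambda>n. \<Squnion>t\<in>{0..T}. \<integral>\<^sup>+\<omega>. ennreal ((f n t \<omega> - g t \<omega>)\<^sup>2) \<partial>M) \<longlonglongrightarrow> 0"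
  shows "(\<lambda>n. ipN w (f n)) \<longlonglongrightarrow> ipN w g"
proof -
  define d where "d n s \<omega> = f n s \<omega> - g s \<omega>" for n s \<omega>
  have d: "sq (d n)" for n unfolding d_def[abs_def] by (rule sq_diff[OF f g])
  define e where "e n = (\<Squnion>t\<in>{0..T}. \<integral>\<^sup>+\<omega>. ennreal ((d n t \<omega>)\<^sup>2) \<partial>M)" for n
  have e0: "e \<longlonglongrightarrow> 0" using lim unfolding e_def d_def .
  have eT: "(\<lambda>n. e n * ennreal T) \<longlonglongrightarrow> 0 * ennreal T"
    by (intro tendsto_mult_ennreal e0 tendsto_const) auto
  have "(\<lambda>n. ennreal (ipN (d n) (d n))) \<longlonglongrightarrow> ennreal 0"
  proof (rule tendsto_sandwich[of "\<lambda>_. 0" _ _ "\<lambda>n. e n * ennreal T"])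
    show "\<forall>\<^sub>F n in sequentially. ennreal (ipN (d n) (d n)) \<le> e n * ennreal T"
    proof (intro always_eventually allI ipN_self_le_sup[OF d])
      show "(\<integral>\<^sup>+\<omega>. ennreal ((d n t \<omega>)\<^sup>2) \<partial>M) \<le> e n" if "t \<in> {0..T}" for n t
        unfolding e_def using SUP_upper[of t "{0..T}" "\<lambda>t. \<integral>\<^sup>+\<omega>. ennreal ((d n t \<omega>)\<^sup>2) \<partial>M"] that by simp
    qed
  qed (use eT in auto)
  then have "(\<lambda>n. ipN (d n) (d n)) \<longlonglongrightarrow> 0"
    using ipN_self_nonneg by (subst (asm) tendsto_ennreal_iff) auto
  then have cs: "(\<lambda>n. ipN w w * ipN (d n) (d n)) \<longlonglongrightarrow> 0" by (rule tendsto_mult_right_zero)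
  have "(\<lambda>n. (ipN w (d n))\<^sup>2) \<longlonglongrightarrow> 0"
    by (rule tendsto_sandwich[of "\<lambda>_. 0" "\<lambda>n. (ipN w (d n))\<^sup>2" sequentially "\<lambda>n. ipN w w * ipN (d n) (d n)"])
      (simp_all add: cs ipN_cauchy_schwarz[OF w d])
  then have "(\<lambda>n. sqrt ((ipN w (d n))\<^sup>2)) \<longlonglongrightarrow> sqrt 0" by (rule tendsto_real_sqrt)
  then have "(\<lambda>n. ipN w (d n)) \<longlonglongrightarrow> 0" by (simp add: tendsto_rabs_zero_iff)
  then have "(\<lambda>n. ipN w (d n) + ipN w g) \<longlonglongrightarrow> 0 + ipN w g" by (intro tendsto_intros)
  moreover have "ipN w (d n) = ipN w (f n) - ipN w g" for n
    unfolding d_def[abs_def] by (rule ipN_diff[OF f g w])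
  ultimately show ?thesis by simp
qed

text \<open>The operator is moved onto w before the limit, so that only pairings with fixed elements
  have to converge. The mean field of any equilibrium is thereby shown to solve the aggregated
  problem.\<close>

lemma mean_field_FOC:
  assumes A2: "bdd_kernel T C A2" and A3: "bdd_kernel T D A3" and \<nu>: "\<nu> \<in> Uset T M F" and b: "\<And>i. sq (b i)"
    and \<beta>: "sq \<beta>" and foc: "\<And>i. i \<ge> 1 \<Longrightarrow> weak_FOC lam A2 (target A3 \<nu> (b i)) (v i)"
    and v_lim: "(\<lambda>n. \<Squnion>t\<in>{0..T}. \<integral>\<^sup>+\<omega>. ennreal ((avg n v t \<omega> - \<nu> t \<omega>)\<^sup>2) \<partial>M) \<longlonglongrightarrow> 0"
    and b_lim: "(\<lambda>n. \<Squnion>t\<in>{0..T}. \<integral>\<^sup>+\<omega>. ennreal ((avg n b t \<omega> - \<beta> t \<omega>)\<^sup>2) \<partial>M) \<longlonglongrightarrow> 0"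
  shows "weak_FOC lam (\<lambda>s r. A2 s r + A3 s r) \<beta> \<nu>"
proof (rule weak_FOC_mean_field[OF A2 A3 \<beta>, THEN iffD2], unfold weak_FOC_def, intro conjI ballI \<nu>)
  fix w assume w: "w \<in> Uset T M F"
  note ws = Uset_sq[OF w] and \<nu>s = Uset_sq[OF \<nu>]
  let ?k = "kproc (\<lambda>s r. A3 s r + A3 r s) \<nu>"
  have vs: "sq (v i)" if "i \<ge> 1" for i using foc[OF that] by (simp add: weak_FOC_def Uset_sq)
  have lim1: "(\<lambda>n. ipN (Lop lam A2 w) (avg n v)) \<longlonglongrightarrow> ipN (Lop lam A2 w) \<nu>"
    by (rule ipN_tendsto[OF sq_avg[OF vs] \<nu>s sq_Lop[OF A2 ws] v_lim])
  have lim2: "(\<lambda>n. ipN w (avg n b) - ipN w ?k) \<longlonglongrightarrow> ipN w \<beta> - ipN w ?k"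
    by (intro tendsto_diff tendsto_const ipN_tendsto[OF sq_avg \<beta> ws b_lim] b)
  have ev: "\<forall>\<^sub>F n in sequentially. ipN w (avg n b) - ipN w ?k = ipN (Lop lam A2 w) (avg n v)"
  proof (rule eventually_sequentiallyI[of 1])
    fix n :: nat assume "1 \<le> n"
    have avs: "sq (avg n v)" by (rule sq_avg[OF vs])
    from weak_FOC_avg[OF A2 A3 \<nu>s b \<open>1 \<le> n\<close> foc w]
    show "ipN w (avg n b) - ipN w ?k = ipN (Lop lam A2 w) (avg n v)"
      using ipN_Lop_sym[OF A2 avs ws, of lam] by (simp add: ipN_commute)
  qed
  have "ipN (Lop lam A2 w) \<nu> = ipN w \<beta> - ipN w ?k"
    by (rule LIMSEQ_unique[OF lim1 Lim_transform_eventually[OF lim2 ev]])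
  moreover have "ipN (Lop lam A2 w) \<nu> = ipN w (Lop lam A2 \<nu>)"
    using ipN_Lop_sym[OF A2 \<nu>s ws, of lam] by (simp add: ipN_commute)
  moreover have "ipN w (target A3 \<nu> \<beta>) = ipN w \<beta> - ipN w ?k"
    unfolding target_def[abs_def]
    by (intro ipN_diff \<beta> ws sq_kproc[OF bdd_kernel_add[OF A3 bdd_kernel_transpose[OF A3]] \<nu>s])
  ultimately show "ipN w (Lop lam A2 \<nu>) = ipN w (target A3 \<nu> \<beta>)" by simp
qed

section \<open>Stability of the weak condition in its data\<close>

lemma weak_FOC_norm_le:
  assumes K: "vkernel T C K" and lam: "lam > 0" and \<beta>: "sq \<beta>" and foc: "weak_FOC lam K \<beta> \<delta>"
  shows "ipN \<delta> \<delta> \<le> ipN \<beta> \<beta> / (4 * lam\<^sup>2)"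
proof -
  have \<delta>: "\<delta> \<in> Uset T M F" and \<delta>s: "sq \<delta>" using foc by (auto simp: weak_FOC_def Uset_sq)
  let ?a = "ipN \<delta> \<delta>" and ?c = "ipN \<delta> \<beta>"
  have "2 * lam * ?a \<le> ipN \<delta> (Lop lam K \<delta>)" by (rule ipN_Lop_coercive[OF K \<delta>s])
  also have "\<dots> = ?c" using foc \<delta> by (simp add: weak_FOC_def)
  finally have 1: "2 * lam * ?a \<le> ?c" .
  \<comment> \<open>Young's inequality, written as positivity of the square of 2 lam \<delta> -
    \<beta>.\<close>
  have "0 \<le> ipN (\<lambda>s \<omega>. 2 * lam * \<delta> s \<omega> - \<beta> s \<omega>) (\<lambda>s \<omega>. 2 * lam * \<delta> s \<omega> - \<beta> s \<omega>)" by (rule ipN_self_nonneg)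
  also have "\<dots> = 4 * lam\<^sup>2 * ?a - 4 * lam * ?c + ipN \<beta> \<beta>"
    by (simp add: ipN_diff ipN_diff_left ipN_cmult ipN_cmult_left sq_cmult sq_diff \<delta>s \<beta> ipN_commute[of \<beta> \<delta>] power2_eq_square algebra_simps)
  finally have "4 * lam * ?c \<le> 4 * lam\<^sup>2 * ?a + ipN \<beta> \<beta>" by simp
  moreover have "4 * lam * (2 * lam * ?a) \<le> 4 * lam * ?c" using 1 lam by (intro mult_left_mono) auto
  ultimately have "4 * lam\<^sup>2 * ?a \<le> ipN \<beta> \<beta>" by (simp add: power2_eq_square)
  then show ?thesis using lam by (simp add: field_simps)
qed

text \<open>An integrated bound would not reach a supremum over time. Conditioning expresses 2 lam
  \<delta> at time t as the conditional expectation of \<beta> minus two kernel terms;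
  \<open>kproc_slice\<close> controls these at every t by the global norm of \<delta>, which is
  itself bounded by a multiple of e.\<close>

lemma weak_FOC_slice_le:
  assumes K: "vkernel T C K" and lam: "lam > 0" and \<beta>: "sq \<beta>" and foc: "weak_FOC lam K \<beta> \<delta>" and e: "0 \<le> e"
    and le: "\<And>t. t \<in> {0..T} \<Longrightarrow> (\<integral>\<^sup>+\<omega>. ennreal ((\<beta> t \<omega>)\<^sup>2) \<partial>M) \<le> ennreal e"
  shows "AE t in tspace T. (\<integral>\<^sup>+\<omega>. ennreal ((\<delta> t \<omega>)\<^sup>2) \<partial>M) \<le>
    ennreal (3 / (4 * lam\<^sup>2) * (1 + C * T / (2 * lam\<^sup>2)) * e)"
proof -
  note b = vkernelD(1)[OF K] and bt = bdd_kernel_transpose[OF vkernelD(1)[OF K]]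
  have C: "C > 0" by (rule bdd_kernelD(2)[OF b])
  have \<delta>p: "progressive T F \<delta>" and \<delta>s: "sq \<delta>" using foc by (auto simp: weak_FOC_def Uset_iff)
  have "ennreal (ipN \<beta> \<beta>) \<le> ennreal (e * T)"
    using ipN_self_le_sup[OF \<beta> le] e by (simp add: ennreal_mult')
  then have "ipN \<beta> \<beta> \<le> e * T" using e T_pos by (subst (asm) ennreal_le_iff) auto
  then have "ipN \<beta> \<beta> / (4 * lam\<^sup>2) \<le> e * T / (4 * lam\<^sup>2)" by (intro divide_right_mono) auto
  then have \<delta>n: "ipN \<delta> \<delta> \<le> e * T / (4 * lam\<^sup>2)" using weak_FOC_norm_le[OF K lam \<beta> foc] by linarith
  show ?thesis
    using weak_FOC_cond_exp_zero[OF b \<beta> foc] AE_sqint_slice[OF \<delta>s] AE_sqint_slice[OF \<beta>] AE_space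
  proof eventually_elim
    case (elim t)
    then have t: "t \<in> {0..T}" by simp
    interpret S: finite_measure_subalgebra M "F t" by (rule fms[OF t])
    define k k' where "k = kproc K \<delta> t" and "k' = kproc (\<lambda>s r. K r s) \<delta> t"
    have ks: "sqint M k" "sqint M k'" and kn: "(\<integral>\<omega>. (k \<omega>)\<^sup>2 \<partial>M) \<le> C * ipN \<delta> \<delta>" "(\<integral>\<omega>. (k' \<omega>)\<^sup>2 \<partial>M) \<le> C * ipN \<delta> \<delta>"
      unfolding k_def k'_def using kproc_slice[OF b \<delta>s t] kproc_slice[OF bt \<delta>s t] by auto
    define p where "p \<omega> = \<beta> t \<omega> - k \<omega> - k' \<omega>" for \<omega>
    have ps: "sqint M p" unfolding p_def by (intro sqint_diff elim ks)
    have q: "Lop lam K \<delta> t \<omega> - \<beta> t \<omega> = 2 * lam * \<delta> t \<omega> - p \<omega>" for \<omega>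
      by (simp add: Lop_def p_def k_def k'_def)
    have qs: "sqint M (\<lambda>\<omega>. 2 * lam * \<delta> t \<omega> - p \<omega>)" by (intro sqint_diff sqint_cmult elim ps)
    \<comment> \<open>Testing with the value of \<delta> at t, which is known at t, removes the
      conditional expectation.\<close>
    have "(\<integral>\<omega>. \<delta> t \<omega> * (2 * lam * \<delta> t \<omega> - p \<omega>) \<partial>M) = (\<integral>\<omega>. \<delta> t \<omega> * real_cond_exp M (F t) (\<lambda>\<omega>. 2 * lam * \<delta> t \<omega> - p \<omega>) \<omega> \<partial>M)"
      using sqint_mult[OF elim(2) qs] progressive_adapted[OF \<delta>p t] sqint_meas[OF qs]
      by (intro S.real_cond_exp_intg(2)[symmetric])
    also have "\<dots> = (\<integral>\<omega>. 0 \<partial>M)"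
      using elim(1) sqint_meas[OF elim(2)] unfolding q by (intro integral_cong_AE) auto
    finally have orth: "(\<integral>\<omega>. \<delta> t \<omega> * (2 * lam * \<delta> t \<omega> - p \<omega>) \<partial>M) = 0" by simp
    have i: "integrable M (\<lambda>\<omega>. (\<delta> t \<omega>)\<^sup>2)" "integrable M (\<lambda>\<omega>. (p \<omega>)\<^sup>2)" "integrable M (\<lambda>\<omega>. (\<beta> t \<omega>)\<^sup>2)"
        "integrable M (\<lambda>\<omega>. (k \<omega>)\<^sup>2)" "integrable M (\<lambda>\<omega>. (k' \<omega>)\<^sup>2)"
      using elim(2,3) ks ps by (auto simp: sqint_def)
    have ip: "integrable M (\<lambda>\<omega>. \<delta> t \<omega> * p \<omega>)" by (rule sqint_mult[OF elim(2) ps])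
    have "(\<integral>\<omega>. \<delta> t \<omega> * (2 * lam * \<delta> t \<omega> - p \<omega>) \<partial>M) = (\<integral>\<omega>. 2 * lam * (\<delta> t \<omega>)\<^sup>2 - \<delta> t \<omega> * p \<omega> \<partial>M)"
      by (simp add: power2_eq_square right_diff_distrib mult_ac)
    also have "\<dots> = 2 * lam * (\<integral>\<omega>. (\<delta> t \<omega>)\<^sup>2 \<partial>M) - (\<integral>\<omega>. \<delta> t \<omega> * p \<omega> \<partial>M)" using i ip by simp
    finally have 1: "2 * lam * (\<integral>\<omega>. (\<delta> t \<omega>)\<^sup>2 \<partial>M) = (\<integral>\<omega>. \<delta> t \<omega> * p \<omega> \<partial>M)" using orth by simp
    have "(\<integral>\<omega>. \<delta> t \<omega> * p \<omega> \<partial>M) \<le> (\<integral>\<omega>. lam * (\<delta> t \<omega>)\<^sup>2 + (1 / (4 * lam)) * (p \<omega>)\<^sup>2 \<partial>M)"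
    proof (rule integral_mono[OF ip])
      show "integrable M (\<lambda>\<omega>. lam * (\<delta> t \<omega>)\<^sup>2 + (1 / (4 * lam)) * (p \<omega>)\<^sup>2)"
        using i by (intro Bochner_Integration.integrable_add integrable_mult_right)
      fix \<omega>
      have "0 \<le> (2 * lam * \<delta> t \<omega> - p \<omega>)\<^sup>2 / (4 * lam)" using lam by simp
      then show "\<delta> t \<omega> * p \<omega> \<le> lam * (\<delta> t \<omega>)\<^sup>2 + (1 / (4 * lam)) * (p \<omega>)\<^sup>2"
        using lam by (simp add: power2_eq_square field_simps)
    qed
    also have "\<dots> = lam * (\<integral>\<omega>. (\<delta> t \<omega>)\<^sup>2 \<partial>M) + (1 / (4 * lam)) * (\<integral>\<omega>. (p \<omega>)\<^sup>2 \<partial>M)"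
      using i by simp
    finally have "lam * (\<integral>\<omega>. (\<delta> t \<omega>)\<^sup>2 \<partial>M) \<le> (1 / (4 * lam)) * (\<integral>\<omega>. (p \<omega>)\<^sup>2 \<partial>M)" using 1 by simp
    then have 2: "(\<integral>\<omega>. (\<delta> t \<omega>)\<^sup>2 \<partial>M) \<le> (\<integral>\<omega>. (p \<omega>)\<^sup>2 \<partial>M) / (4 * lam\<^sup>2)"
      using lam by (simp add: field_simps power2_eq_square)
    have "(\<integral>\<omega>. (p \<omega>)\<^sup>2 \<partial>M) \<le> (\<integral>\<omega>. 3 * (\<beta> t \<omega>)\<^sup>2 + 3 * (k \<omega>)\<^sup>2 + 3 * (k' \<omega>)\<^sup>2 \<partial>M)"
    proof (rule integral_mono)
      fix \<omega>
      \<comment> \<open>The sum of these three squares is exactly the gap between the two sides of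
        the estimate below.\<close>
      have "0 \<le> (\<beta> t \<omega> + k \<omega>)\<^sup>2 + (\<beta> t \<omega> + k' \<omega>)\<^sup>2 + (k \<omega> - k' \<omega>)\<^sup>2" by simp
      then show "(p \<omega>)\<^sup>2 \<le> 3 * (\<beta> t \<omega>)\<^sup>2 + 3 * (k \<omega>)\<^sup>2 + 3 * (k' \<omega>)\<^sup>2"
        by (simp add: p_def power2_eq_square algebra_simps)
    qed (use i in auto)
    also have "\<dots> = 3 * (\<integral>\<omega>. (\<beta> t \<omega>)\<^sup>2 \<partial>M) + 3 * (\<integral>\<omega>. (k \<omega>)\<^sup>2 \<partial>M) + 3 * (\<integral>\<omega>. (k' \<omega>)\<^sup>2 \<partial>M)"
      using i by simp
    also have "\<dots> \<le> 3 * e + 6 * (C * (e * T / (4 * lam\<^sup>2)))"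
    proof -
      have "ennreal (\<integral>\<omega>. (\<beta> t \<omega>)\<^sup>2 \<partial>M) \<le> ennreal e"
        using le[OF t] i(3) by (subst (asm) nn_integral_eq_integral) auto
      then have "(\<integral>\<omega>. (\<beta> t \<omega>)\<^sup>2 \<partial>M) \<le> e" using e by (subst (asm) ennreal_le_iff) auto
      moreover have "C * ipN \<delta> \<delta> \<le> C * (e * T / (4 * lam\<^sup>2))" using C \<delta>n by (intro mult_left_mono) auto
      ultimately show ?thesis using kn by linarith
    qed
    \<comment> \<open>The 3 comes from squaring a sum of three terms, and C T / (2 lam^2) from the
      two kernel terms together.\<close>
    also have "3 * e + 6 * (C * (e * T / (4 * lam\<^sup>2))) = 3 * (1 + C * T / (2 * lam\<^sup>2)) * e"
      by (simp add: field_simps)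
    finally have "(\<integral>\<omega>. (p \<omega>)\<^sup>2 \<partial>M) / (4 * lam\<^sup>2) \<le> 3 * (1 + C * T / (2 * lam\<^sup>2)) * e / (4 * lam\<^sup>2)"
      by (intro divide_right_mono) auto
    then have "(\<integral>\<omega>. (\<delta> t \<omega>)\<^sup>2 \<partial>M) \<le> 3 / (4 * lam\<^sup>2) * (1 + C * T / (2 * lam\<^sup>2)) * e"
      using 2 by simp
    then show ?case
      using i(1) by (subst nn_integral_eq_integral) (auto intro: ennreal_leI)
  qed
qed

section \<open>Existence of an equilibrium\<close>

lemma weak_FOC_cong:
  assumes K: "bdd_kernel T C K" and foc: "weak_FOC lam K y u" and u': "u' \<in> Uset T M F"
    and eq: "AE x in N. case_prod u x = case_prod u' x"
    and y: "\<And>w. w \<in> Uset T M F \<Longrightarrow> ipN w y = ipN w y'"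
  shows "weak_FOC lam K y' u'"
  unfolding weak_FOC_def
proof (intro conjI ballI u')
  fix w assume w: "w \<in> Uset T M F"
  have u: "sq u" using foc by (simp add: weak_FOC_def Uset_sq)
  note ws = Uset_sq[OF w] and u's = Uset_sq[OF u']
  have "ipN w (Lop lam K u') = ipN (Lop lam K w) u'"
    using ipN_Lop_sym[OF K u's ws, of lam] by (simp add: ipN_commute)
  also have "\<dots> = ipN (Lop lam K w) u" using eq by (intro ipN_cong_AE[symmetric] u u's sq_Lop[OF K ws])
  also have "\<dots> = ipN w (Lop lam K u)"
    using ipN_Lop_sym[OF K u ws, of lam] by (simp add: ipN_commute)
  also have "\<dots> = ipN w y'" using foc w y by (simp add: weak_FOC_def)
  finally show "ipN w (Lop lam K u') = ipN w y'" .
qed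

lemma ipN_kproc_cong:
  assumes K: "bdd_kernel T C K" and u: "sq u" and u': "sq u'" and w: "sq w"
    and eq: "AE x in N. case_prod u x = case_prod u' x"
  shows "ipN w (kproc K u) = ipN w (kproc K u')"
  unfolding kproc_duality[OF K w u] kproc_duality[OF K w u']
  by (subst (1 2) ipN_commute) (intro ipN_cong_AE u u' sq_kproc[OF bdd_kernel_transpose[OF K] w] eq)

text \<open>The mean field is solved for first, from the aggregated problem; the players' best
  responses to it are then found separately. What remains is consistency: the averages must approach
  \<nu> at every time, which requires choosing versions.\<close>

lemma equilibrium_exists:
  assumes A2: "vkernel T C A2" and A3: "vkernel T D A3" and lam: "lam > 0"
    and b: "\<And>i. sq (b i)" and \<beta>: "sq \<beta>"
    and h0: "\<And>n. 0 \<le> h n" and h: "h \<longlonglongrightarrow> 0"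
    and conv: "\<And>n t. n \<ge> 1 \<Longrightarrow> t \<in> {0..T} \<Longrightarrow> (\<integral>\<^sup>+\<omega>. ennreal ((avg n b t \<omega> - \<beta> t \<omega>)\<^sup>2) \<partial>M) \<le> ennreal (h n)"
  shows "\<exists>\<nu> v. \<nu> \<in> Uset T M F \<and> (\<forall>i\<ge>1. weak_FOC lam A2 (target A3 \<nu> (b i)) (v i)) \<and>
    (\<lambda>n. \<Squnion>t\<in>{0..T}. \<integral>\<^sup>+\<omega>. ennreal ((avg n v t \<omega> - \<nu> t \<omega>)\<^sup>2) \<partial>M) \<longlonglongrightarrow> 0"
proof -
  note b2 = vkernelD(1)[OF A2] and b3 = vkernelD(1)[OF A3]
  note H = bdd_kernel_add[OF b3 bdd_kernel_transpose[OF b3]]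
  obtain \<nu> where \<nu>': "weak_FOC lam (\<lambda>s r. A2 s r + A3 s r) \<beta> \<nu>"
    using weak_FOC_exists[OF vkernel_add[OF A2 A3] lam \<beta>] by blast
  then have \<nu>: "\<nu> \<in> Uset T M F" by (simp add: weak_FOC_def)
  note \<nu>s = Uset_sq[OF \<nu>]
  have \<nu>2: "weak_FOC lam A2 (target A3 \<nu> \<beta>) \<nu>" using \<nu>' weak_FOC_mean_field[OF b2 b3 \<beta>] by blast
  have "\<forall>i. \<exists>u. weak_FOC lam A2 (target A3 \<nu> (b i)) u"
    using weak_FOC_exists[OF A2 lam sq_target[OF b3 \<nu>s b]] by blast
  then obtain v where v: "\<And>i. weak_FOC lam A2 (target A3 \<nu> (b i)) (v i)" by metis
  then have vU: "v i \<in> Uset T M F" for i by (simp add: weak_FOC_def)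
  define E where "E = 3 / (4 * lam\<^sup>2) * (1 + C * T / (2 * lam\<^sup>2))"
  \<comment> \<open>Both problems carry the same interaction term, which cancels, so the deviation
    solves the problem with kernel \<open>A2\<close> and data \<open>avg n b\<close> minus
    \<beta>.\<close>
  have foc: "weak_FOC lam A2 (\<lambda>s \<omega>. avg n b s \<omega> - \<beta> s \<omega>) (\<lambda>s \<omega>. avg n v s \<omega> - \<nu> s \<omega>)" if n: "n \<ge> 1" for n
    unfolding weak_FOC_def
  proof (intro conjI ballI)
    have aU: "avg n v \<in> Uset T M F" by (rule Uset_avg[OF vU])
    show "(\<lambda>s \<omega>. avg n v s \<omega> - \<nu> s \<omega>) \<in> Uset T M F" by (rule Uset_diff[OF aU \<nu>])
    fix w assume w: "w \<in> Uset T M F"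
    note ws = Uset_sq[OF w]
    have "ipN w (Lop lam A2 (\<lambda>s \<omega>. avg n v s \<omega> - \<nu> s \<omega>)) = ipN (Lop lam A2 w) (\<lambda>s \<omega>. avg n v s \<omega> - \<nu> s \<omega>)"
      using ipN_Lop_sym[OF b2 sq_diff[OF Uset_sq[OF aU] \<nu>s] ws, of lam] by (simp add: ipN_commute)
    also have "\<dots> = ipN (Lop lam A2 w) (avg n v) - ipN (Lop lam A2 w) \<nu>"
      by (intro ipN_diff Uset_sq[OF aU] \<nu>s sq_Lop[OF b2 ws])
    also have "ipN (Lop lam A2 w) (avg n v) = ipN w (avg n b) - ipN w (kproc (\<lambda>s r. A3 s r + A3 r s) \<nu>)"
      using ipN_Lop_sym[OF b2 Uset_sq[OF aU] ws, of lam] weak_FOC_avg[OF b2 b3 \<nu>s b n v w] by (simp add: ipN_commute)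
    also have "ipN (Lop lam A2 w) \<nu> = ipN w (target A3 \<nu> \<beta>)"
      using ipN_Lop_sym[OF b2 \<nu>s ws, of lam] \<nu>2 w by (simp add: ipN_commute weak_FOC_def)
    also have "\<dots> = ipN w \<beta> - ipN w (kproc (\<lambda>s r. A3 s r + A3 r s) \<nu>)"
      unfolding target_def[abs_def] by (intro ipN_diff \<beta> ws sq_kproc[OF H \<nu>s])
    finally show "ipN w (Lop lam A2 (\<lambda>s \<omega>. avg n v s \<omega> - \<nu> s \<omega>)) = ipN w (\<lambda>s \<omega>. avg n b s \<omega> - \<beta> s \<omega>)"
      using ipN_diff[OF sq_avg[OF b] \<beta> ws, of n] by simp
  qed
  have "AE t in tspace T. (\<integral>\<^sup>+\<omega>. ennreal ((avg n v t \<omega> - \<nu> t \<omega>)\<^sup>2) \<partial>M) \<le> ennreal (E * h n)" if n: "n \<ge> 1" for n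
    unfolding E_def
    by (rule weak_FOC_slice_le[OF A2 lam sq_diff[OF sq_avg[OF b] \<beta>] foc[OF n] h0 conv[OF n]])
  \<comment> \<open>There are countably many n, so one exceptional set of times serves them
    all.\<close>
  then have "AE t in tspace T. \<forall>n. n \<ge> 1 \<longrightarrow> (\<integral>\<^sup>+\<omega>. ennreal ((avg n v t \<omega> - \<nu> t \<omega>)\<^sup>2) \<partial>M) \<le> ennreal (E * h n)"
    by (subst AE_all_countable) auto
  then have "AE t in lborel. t \<in> {0..T} \<longrightarrow>
      (\<forall>n. n \<ge> 1 \<longrightarrow> (\<integral>\<^sup>+\<omega>. ennreal ((avg n v t \<omega> - \<nu> t \<omega>)\<^sup>2) \<partial>M) \<le> ennreal (E * h n))"
    by (simp only: AE_tspace)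
  then obtain Z where Zsub: "{t \<in> space lborel. \<not> (t \<in> {0..T} \<longrightarrow>
      (\<forall>n. n \<ge> 1 \<longrightarrow> (\<integral>\<^sup>+\<omega>. ennreal ((avg n v t \<omega> - \<nu> t \<omega>)\<^sup>2) \<partial>M) \<le> ennreal (E * h n)))} \<subseteq> Z"
    and Z0: "emeasure lborel Z = 0" and Zs: "Z \<in> sets lborel"
    by (rule AE_E)
  have Z: "(\<integral>\<^sup>+\<omega>. ennreal ((avg n v t \<omega> - \<nu> t \<omega>)\<^sup>2) \<partial>M) \<le> ennreal (E * h n)"
    if "t \<notin> Z" "t \<in> {0..T}" "n \<ge> 1" for t n using Zsub that by auto
  \<comment> \<open>A deterministic factor common to all players and the mean field: multiplying by
    it preserves progressiveness, it equals 1 at almost every time, and it annihilates the deviation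
    at the exceptional times.\<close>
  define g :: "real \<Rightarrow> real" where "g = indicator (- Z)"
  have gm: "g \<in> borel_measurable borel" unfolding g_def using Zs by simp
  have "AE t in lborel. t \<notin> Z" using Z0 Zs by (intro AE_not_in) auto
  then have g1: "AE t in tspace T. g t = 1"
    by (subst AE_tspace[symmetric]) (auto elim!: eventually_mono simp: g_def)
  have mod: "(\<lambda>s \<omega>. g s * u s \<omega>) \<in> Uset T M F" "AE x in N. case_prod u x = case_prod (\<lambda>s \<omega>. g s * u s \<omega>) x"
    if u: "u \<in> Uset T M F" for u
  proof -
    have p: "progressive T F (\<lambda>s \<omega>. g s * u s \<omega>)" using u gm by (intro progressive_time_mult) (auto simp: Uset_iff)
    have "sq (\<lambda>s \<omega>. g s * u s \<omega>)"
      by (rule sqint_bounded[OF Uset_sq[OF u] progressive_joint[OF p]]) (auto simp: g_def indicator_def)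
    then show "(\<lambda>s \<omega>. g s * u s \<omega>) \<in> Uset T M F" using p by (simp add: Uset_iff)
    have "AE s in tspace T. AE \<omega> in M. u s \<omega> = g s * u s \<omega>" using g1 by eventually_elim simp
    then show "AE x in N. case_prod u x = case_prod (\<lambda>s \<omega>. g s * u s \<omega>) x"
      using AE_eq_iff[OF sqint_meas[OF Uset_sq[OF u]] progressive_joint[OF p]] by blast
  qed
  define \<nu>0 where "\<nu>0 s \<omega> = g s * \<nu> s \<omega>" for s \<omega>
  define v0 where "v0 i s \<omega> = g s * v i s \<omega>" for i s \<omega>
  have \<nu>0: "\<nu>0 \<in> Uset T M F" "AE x in N. case_prod \<nu> x = case_prod \<nu>0 x"
    unfolding \<nu>0_def[abs_def] using mod[OF \<nu>] by auto
  have v0: "v0 i \<in> Uset T M F" "AE x in N. case_prod (v i) x = case_prod (v0 i) x" for i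
    unfolding v0_def[abs_def] using mod[OF vU] by auto
  \<comment> \<open>Changing \<nu> on a null set of times may change the targets, but not their
    pairings with controls.\<close>
  have "weak_FOC lam A2 (target A3 \<nu>0 (b i)) (v0 i)" for i
  proof (rule weak_FOC_cong[OF b2 v v0])
    fix w assume w: "w \<in> Uset T M F"
    note ws = Uset_sq[OF w]
    show "ipN w (target A3 \<nu> (b i)) = ipN w (target A3 \<nu>0 (b i))"
      unfolding target_def[abs_def]
      using ipN_kproc_cong[OF H \<nu>s Uset_sq[OF \<nu>0(1)] ws \<nu>0(2)]
      by (simp add: ipN_diff b ws sq_kproc[OF H] \<nu>s Uset_sq[OF \<nu>0(1)])
  qed
  moreover have "(\<lambda>n. \<Squnion>t\<in>{0..T}. \<integral>\<^sup>+\<omega>. ennreal ((avg n v0 t \<omega> - \<nu>0 t \<omega>)\<^sup>2) \<partial>M) \<longlonglongrightarrow> 0"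
  proof (rule tendsto_sandwich[of "\<lambda>_. 0" _ _ "\<lambda>n. ennreal (E * h n)"])
    show "\<forall>\<^sub>F n in sequentially. (\<Squnion>t\<in>{0..T}. \<integral>\<^sup>+\<omega>. ennreal ((avg n v0 t \<omega> - \<nu>0 t \<omega>)\<^sup>2) \<partial>M) \<le> ennreal (E * h n)"
    proof (rule eventually_sequentiallyI[of 1], rule SUP_least)
      fix n :: nat and t assume n: "1 \<le> n" and t: "t \<in> {0..T}"
      have av: "avg n v0 t \<omega> - \<nu>0 t \<omega> = g t * (avg n v t \<omega> - \<nu> t \<omega>)" for \<omega>
        by (simp add: avg_def v0_def \<nu>0_def right_diff_distrib mult.left_commute flip: sum_distrib_left)
      show "(\<integral>\<^sup>+\<omega>. ennreal ((avg n v0 t \<omega> - \<nu>0 t \<omega>)\<^sup>2) \<partial>M) \<le> ennreal (E * h n)"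
        unfolding av using Z[OF _ t n] by (cases "t \<in> Z") (auto simp: g_def)
    qed
    have "(\<lambda>n. E * h n) \<longlonglongrightarrow> E * 0" by (intro tendsto_intros h)
    then show "(\<lambda>n. ennreal (E * h n)) \<longlonglongrightarrow> 0" using tendsto_ennrealI by fastforce
  qed auto
  ultimately show ?thesis using \<nu>0(1) by blast
qed

end

theorem mainTheorem10:
  fixes T lam :: real
    and M :: "'a measure" and F :: "real \<Rightarrow> 'a measure"
    and A1 A2h A3 :: "real \<Rightarrow> real \<Rightarrow> real"
    and b :: "nat \<Rightarrow> real \<Rightarrow> 'a \<Rightarrow> real" and binf :: "real \<Rightarrow> 'a \<Rightarrow> real"
    and c :: "nat \<Rightarrow> 'a \<Rightarrow> real" and h :: "real \<Rightarrow> real"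
  assumes T_pos: "T > 0"
    and filt: "usual_filtration T M F"
    and A1: "admissible_kernel T A1"
    and A2h: "admissible_kernel T A2h" and lam_pos: "lam > 0"
    and A3: "admissible_kernel T A3"
    and b_U: "\<And>i. b i \<in> Uset T M F"
    and c_int: "\<And>i. i \<ge> 1 \<Longrightarrow> integrable M (c i)"
    and binf_U: "binf \<in> Uset T M F"
    and h_nonneg: "\<And>x. x \<ge> 0 \<Longrightarrow> h x \<ge> 0"
    and h_bdd: "\<exists>C. \<forall>x\<ge>0. h x \<le> C"
    and h_lim: "(h \<longlongrightarrow> 0) at_top"
    and b_conv: "\<And>N t. N \<ge> 1 \<Longrightarrow> t \<in> {0..T} \<Longrightarrow>
        (\<integral>\<^sup>+ \<omega>. ennreal (((1 / real N) * (\<Sum>i=1..N. b i t \<omega>) - binf t \<omega>)\<^sup>2) \<partial>M)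
          \<le> ennreal (h (real N))"
  shows "(\<exists>\<nu> v. MFG_NE T M F A1 lam A2h A3 b c \<nu> v) \<and>
         (\<forall>\<nu> v. MFG_NE T M F A1 lam A2h A3 b c \<nu> v \<longrightarrow>
            ae_eq_proc T M \<nu> (solmap T lam (\<lambda>s r. A2h s r + A3 s r) M F binf) \<and>
            (\<forall>i\<ge>1. ae_eq_proc T M (v i) (solmap T lam A2h M F (xproc T M F A3 \<nu> (b i)))))"
proof -
  interpret prob_space M using filt by (simp add: usual_filtration_def)
  interpret filtered_prob M T F by unfold_locales (fact T_pos filt)+
  obtain C1 where K1: "vkernel T C1 A1" using admissible_kernel_vkernel[OF A1] .
  obtain C2 where K2: "vkernel T C2 A2h" using admissible_kernel_vkernel[OF A2h] .
  obtain C3 where K3: "vkernel T C3 A3" using admissible_kernel_vkernel[OF A3] .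
  note k1 = vkernelD(1)[OF K1] and k2 = vkernelD(1)[OF K2] and k3 = vkernelD(1)[OF K3]
  note bs = Uset_sq[OF b_U] and \<beta>s = Uset_sq[OF binf_U]
  have hn: "(\<lambda>n. h (real n)) \<longlonglongrightarrow> 0"
    by (rule filterlim_compose[OF h_lim filterlim_real_sequentially])
  have conv: "(\<integral>\<^sup>+\<omega>. ennreal ((avg n b t \<omega> - binf t \<omega>)\<^sup>2) \<partial>M) \<le> ennreal (h (real n))"
    if "n \<ge> 1" "t \<in> {0..T}" for n t unfolding avg_def using b_conv[OF that] .
  \<comment> \<open>The definition of equilibrium is translated once into weak conditions; existence
    and the formulas use only this form.\<close>
  have NE: "MFG_NE T M F A1 lam A2h A3 b c \<nu> v \<longleftrightarrow>
      \<nu> \<in> Uset T M F \<and> (\<forall>i\<ge>1. weak_FOC lam A2h (target A3 \<nu> (b i)) (v i)) \<and>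
      (\<lambda>n. \<Squnion>t\<in>{0..T}. \<integral>\<^sup>+\<omega>. ennreal ((avg n v t \<omega> - \<nu> t \<omega>)\<^sup>2) \<partial>M) \<longlonglongrightarrow> 0" for \<nu> v
  proof (cases "\<nu> \<in> Uset T M F")
    case True
    have eq: "(v i \<in> Uset T M F \<and> (\<forall>w\<in>Uset T M F. Jinf T M A1 lam A2h A3 b c i w \<nu> \<le> Jinf T M A1 lam A2h A3 b c i (v i) \<nu>))
        \<longleftrightarrow> weak_FOC lam A2h (target A3 \<nu> (b i)) (v i)" if "i \<ge> 1" for i
      using best_response_iff[where b = b and c = c and i = i, OF k1 K2 lam_pos k3 bs bs c_int[OF that] Uset_sq[OF True], of "v i"]
      by (auto simp: weak_FOC_def)
    show ?thesis unfolding MFG_NE_def avg_def by (simp only: eq True simp_thms cong: imp_cong)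
  next
    case False
    then show ?thesis by (simp add: MFG_NE_def)
  qed
  have "\<exists>\<nu> v. MFG_NE T M F A1 lam A2h A3 b c \<nu> v"
    unfolding NE by (rule equilibrium_exists[OF K2 K3 lam_pos bs \<beta>s _ hn conv]) (simp add: h_nonneg)
  \<comment> \<open>Uniqueness takes the form of formulas valid for every equilibrium: \<nu> is
    determined by \<open>binf\<close>, and each control by \<nu> and \<open>b i\<close>, up to null
    sets.\<close>
  moreover have "ae_eq_proc T M \<nu> (solmap T lam (\<lambda>s r. A2h s r + A3 s r) M F binf) \<and>
      (\<forall>i\<ge>1. ae_eq_proc T M (v i) (solmap T lam A2h M F (xproc T M F A3 \<nu> (b i))))"
    if "MFG_NE T M F A1 lam A2h A3 b c \<nu> v" for \<nu> v
  proof -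
    have \<nu>: "\<nu> \<in> Uset T M F" and foc: "\<And>i. i \<ge> 1 \<Longrightarrow> weak_FOC lam A2h (target A3 \<nu> (b i)) (v i)"
      and lim: "(\<lambda>n. \<Squnion>t\<in>{0..T}. \<integral>\<^sup>+\<omega>. ennreal ((avg n v t \<omega> - \<nu> t \<omega>)\<^sup>2) \<partial>M) \<longlonglongrightarrow> 0"
      using that unfolding NE by auto
    have b_lim: "(\<lambda>n. \<Squnion>t\<in>{0..T}. \<integral>\<^sup>+\<omega>. ennreal ((avg n b t \<omega> - binf t \<omega>)\<^sup>2) \<partial>M) \<longlonglongrightarrow> 0"
    proof (rule tendsto_sandwich[of "\<lambda>_. 0" _ _ "\<lambda>n. ennreal (h (real n))"])
      show "\<forall>\<^sub>F n in sequentially. (\<Squnion>t\<in>{0..T}. \<integral>\<^sup>+\<omega>. ennreal ((avg n b t \<omega> - binf t \<omega>)\<^sup>2) \<partial>M) \<le> ennreal (h (real n))"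
        by (rule eventually_sequentiallyI[of 1], rule SUP_least, rule conv)
      show "(\<lambda>n. ennreal (h (real n))) \<longlonglongrightarrow> 0" using tendsto_ennrealI[OF hn] by simp
    qed auto
    \<comment> \<open>The mean field is identified from the limit of the averages alone; each
      control is then identified from its own condition, with the mean field as data.\<close>
    have "weak_FOC lam (\<lambda>s r. A2h s r + A3 s r) binf \<nu>"
      by (rule mean_field_FOC[OF k2 k3 \<nu> bs \<beta>s foc lim b_lim])
    then have "ae_eq_proc T M \<nu> (solmap T lam (\<lambda>s r. A2h s r + A3 s r) M F binf)"
      by (rule weak_FOC_eq_solmap[OF vkernel_add[OF K2 K3] lam_pos \<beta>s _ Uset_adapted_cond_exp[OF binf_U]])
    moreover have "ae_eq_proc T M (v i) (solmap T lam A2h M F (xproc T M F A3 \<nu> (b i)))" if "i \<ge> 1" for i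
      by (rule weak_FOC_eq_solmap[OF K2 lam_pos sq_target[OF k3 Uset_sq[OF \<nu>] bs] foc[OF that] xproc_eq_cond_exp[OF K3 \<nu> b_U]])
    ultimately show ?thesis by blast
  qed
  ultimately show ?thesis by blast
qed

end
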